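(* Let $k$ be a field, let $d$ be a positive integer, let $R=k\llbracket x^d,x^{d-1}y,\ldots,xy^{d-1},y^d\rrbracket$ (a subring of $k\llbracket x,y\rrbracket$), and let $m$ be the maximal ideal of $R$. Then $\tau_{MCM}(R)=m$. Furthermore, $\tau_M(R)=m$ for all non-free indecomposable maximal Cohen-Macaulay $R$-modules $M$.
   Context: All rings are commutative, unital, Noetherian and local. A maximal Cohen-Macaulay (MCM) module over a ring $R$ is a finitely generated (nonzero) $R$-module $M$ such that the length of the longest regular sequence on $M$ equals the Krull dimension of $R$; a sequence $x_1,\ldots,x_n$ in $R$ is regular on $M$ if $(x_1,\ldots,x_n)M\ne M$, $x_1$ is a non-zerodivisor on $M$, and $x_i$ is a non-zerodivisor on $M/(x_1,\ldots,x_{i-1})M$ for $2\le i\le n$. For an $R$-module $M$ and $R$-modules $A\subseteq B$, let $A_B^{\mathrm{cl}_M}=\{b\in B : x\otimes b\in \operatorname{im}(M\otimes_R A\to M\otimes_R B)\text{ for all }x\in M\}$. The test ideal of $R$ associated to $M$ is $\tau_M(R)=\bigcap_{A\subseteq B}(A:_R A_B^{\mathrm{cl}_M})$, the intersection over all pairs of $R$-modules $A\subseteq B$. By a known theorem, when $R$ is local and $M$ is finitely generated, $\tau_M(R)$ equals the trace ideal $\sum_{f\in\operatorname{Hom}_R(M,R)}f(M)$, and $\tau_M(R)$ denotes this common ideal. $\tau_{MCM}(R)=\bigcap_M \tau_M(R)$, the intersection over all isomorphism classes of maximal Cohen-Macaulay $R$-modules $M$.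
   Formalization: The claim τ_MCM(R)=m is stated only for d≥2, since for d=1 R=k[[x,y]] is regular and τ_MCM(R)=R; in τ_M(R) the pairs A⊆B range over modules in one fixed set-theoretic type containing all finitely generated ones up to isomorphism, which suffices as M is finitely generated. *)

theory Defs
  imports
    "HOL-Algebra.Ideal"
    "HOL-Algebra.Module"
    "HOL-Algebra.Free_Abelian_Groups"
    "HOL-Computational_Algebra.Formal_Power_Series"
    "HOL-Library.Extended_Nat"
begin

section \<open>Modules over a commutative ring\<close>

definition linear_span ::
    "('r, 'a) ring_scheme \<Rightarrow> ('r, 'm, 'b) module_scheme \<Rightarrow> 'm set \<Rightarrow> 'm set" where
  "linear_span R M S =
     {(\<Oplus>\<^bsub>M\<^esub>s\<in>F. a s \<odot>\<^bsub>M\<^esub> s) | F a. finite F \<and> F \<subseteq> S \<and> a \<in> F \<rightarrow> carrier R}"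

definition fin_gen_module ::
    "('r, 'a) ring_scheme \<Rightarrow> ('r, 'm, 'b) module_scheme \<Rightarrow> bool" where
  "fin_gen_module R M \<longleftrightarrow>
     Module.module R M \<and> (\<exists>S \<subseteq> carrier M. finite S \<and> linear_span R M S = carrier M)"

definition free_module ::
    "('r, 'a) ring_scheme \<Rightarrow> ('r, 'm, 'b) module_scheme \<Rightarrow> bool" where
  "free_module R M \<longleftrightarrow> Module.module R M \<and>
     (\<exists>B \<subseteq> carrier M. linear_span R M B = carrier M \<and>
        (\<forall>F a. finite F \<and> F \<subseteq> B \<and> a \<in> F \<rightarrow> carrier R \<and> (\<Oplus>\<^bsub>M\<^esub>s\<in>F. a s \<odot>\<^bsub>M\<^esub> s) = \<zero>\<^bsub>M\<^esub>
           \<longrightarrow> (\<forall>s\<in>F. a s = \<zero>\<^bsub>R\<^esub>)))"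

definition indecomposable_module ::
    "('r, 'a) ring_scheme \<Rightarrow> ('r, 'm, 'b) module_scheme \<Rightarrow> bool" where
  "indecomposable_module R M \<longleftrightarrow> Module.module R M \<and> carrier M \<noteq> {\<zero>\<^bsub>M\<^esub>} \<and>
     (\<forall>N1 N2. submodule N1 R M \<and> submodule N2 R M \<and>
              N1 <+>\<^bsub>M\<^esub> N2 = carrier M \<and> N1 \<inter> N2 = {\<zero>\<^bsub>M\<^esub>}
        \<longrightarrow> N1 = {\<zero>\<^bsub>M\<^esub>} \<or> N2 = {\<zero>\<^bsub>M\<^esub>})"


section \<open>Maximal Cohen-Macaulay modules\<close>

definition krull_dim :: "('r, 'a) ring_scheme \<Rightarrow> enat" where
  "krull_dim R =
     Sup {enat n | n. \<exists>P :: nat \<Rightarrow> 'r set.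
            (\<forall>i\<le>n. primeideal (P i) R) \<and> (\<forall>i<n. P i \<subset> P (Suc i))}"

text \<open>The submodule \<open>(x\<^sub>1,\<dots>,x\<^sub>n)M\<close>; it is zero for the empty sequence.\<close>

definition seq_submodule ::
    "('r, 'm, 'b) module_scheme \<Rightarrow> 'r list \<Rightarrow> 'm set" where
  "seq_submodule M xs =
     {(\<Oplus>\<^bsub>M\<^esub>i\<in>{..<length xs}. (xs ! i) \<odot>\<^bsub>M\<^esub> v i) | v. v \<in> {..<length xs} \<rightarrow> carrier M}"

text \<open>The last conjunct says that \<open>xs ! i\<close> is a non-zerodivisor on
  \<open>M/(xs ! 0,\<dots>,xs ! (i-1))M\<close>.\<close>

definition regular_sequence ::
    "('r, 'a) ring_scheme \<Rightarrow> ('r, 'm, 'b) module_scheme \<Rightarrow> 'r list \<Rightarrow> bool" where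
  "regular_sequence R M xs \<longleftrightarrow>
     set xs \<subseteq> carrier R \<and> seq_submodule M xs \<noteq> carrier M \<and>
     (\<forall>i<length xs. \<forall>v\<in>carrier M.
        (xs ! i) \<odot>\<^bsub>M\<^esub> v \<in> seq_submodule M (take i xs) \<longrightarrow> v \<in> seq_submodule M (take i xs))"

definition module_depth ::
    "('r, 'a) ring_scheme \<Rightarrow> ('r, 'm, 'b) module_scheme \<Rightarrow> enat" where
  "module_depth R M = Sup {enat (length xs) | xs. regular_sequence R M xs}"

definition MCM_module ::
    "('r, 'a) ring_scheme \<Rightarrow> ('r, 'm, 'b) module_scheme \<Rightarrow> bool" where
  "MCM_module R M \<longleftrightarrow>
     fin_gen_module R M \<and> carrier M \<noteq> {\<zero>\<^bsub>M\<^esub>} \<and> module_depth R M = krull_dim R"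


section \<open>Tensor products and module closures\<close>

text \<open>Only the additive group of \<open>M \<otimes>\<^sub>R B\<close> is needed: the free abelian group on
  \<open>M \<times> B\<close> modulo the bilinearity relations.\<close>

definition tensor_relations ::
    "('r, 'a) ring_scheme \<Rightarrow> ('r, 'm, 'c) module_scheme \<Rightarrow> ('r, 'b, 'd) module_scheme
      \<Rightarrow> ('m \<times> 'b \<Rightarrow>\<^sub>0 int) set" where
  "tensor_relations R M B = generate (free_Abelian_group (carrier M \<times> carrier B))
     ({frag_of (x \<oplus>\<^bsub>M\<^esub> x', b) - frag_of (x, b) - frag_of (x', b) | x x' b.
         x \<in> carrier M \<and> x' \<in> carrier M \<and> b \<in> carrier B} \<union>
      {frag_of (x, b \<oplus>\<^bsub>B\<^esub> b') - frag_of (x, b) - frag_of (x, b') | x b b'.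
         x \<in> carrier M \<and> b \<in> carrier B \<and> b' \<in> carrier B} \<union>
      {frag_of (r \<odot>\<^bsub>M\<^esub> x, b) - frag_of (x, r \<odot>\<^bsub>B\<^esub> b) | r x b.
         r \<in> carrier R \<and> x \<in> carrier M \<and> b \<in> carrier B})"

definition tensor_product ::
    "('r, 'a) ring_scheme \<Rightarrow> ('r, 'm, 'c) module_scheme \<Rightarrow> ('r, 'b, 'd) module_scheme
      \<Rightarrow> ('m \<times> 'b \<Rightarrow>\<^sub>0 int) set monoid" where
  "tensor_product R M B =
     free_Abelian_group (carrier M \<times> carrier B) Mod tensor_relations R M B"

definition simple_tensor ::
    "('r, 'a) ring_scheme \<Rightarrow> ('r, 'm, 'c) module_scheme \<Rightarrow> ('r, 'b, 'd) module_scheme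
      \<Rightarrow> 'm \<Rightarrow> 'b \<Rightarrow> ('m \<times> 'b \<Rightarrow>\<^sub>0 int) set" where
  "simple_tensor R M B x b =
     tensor_relations R M B #>\<^bsub>free_Abelian_group (carrier M \<times> carrier B)\<^esub> frag_of (x, b)"

text \<open>For a submodule \<open>A\<close> of \<open>B\<close>, the image of \<open>M \<otimes>\<^sub>R A \<rightarrow> M \<otimes>\<^sub>R B\<close> is the subgroup
  generated by the images of the simple tensors.\<close>

definition tensor_image ::
    "('r, 'a) ring_scheme \<Rightarrow> ('r, 'm, 'c) module_scheme \<Rightarrow> 'b set \<Rightarrow> ('r, 'b, 'd) module_scheme
      \<Rightarrow> ('m \<times> 'b \<Rightarrow>\<^sub>0 int) set set" where
  "tensor_image R M A B = generate (tensor_product R M B)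
     {simple_tensor R M B x a | x a. x \<in> carrier M \<and> a \<in> A}"

definition module_closure ::
    "('r, 'a) ring_scheme \<Rightarrow> ('r, 'm, 'c) module_scheme \<Rightarrow> 'b set \<Rightarrow> ('r, 'b, 'd) module_scheme
      \<Rightarrow> 'b set" where
  "module_closure R M A B =
     {b \<in> carrier B. \<forall>x\<in>carrier M. simple_tensor R M B x b \<in> tensor_image R M A B}"


section \<open>Test ideals\<close>

text \<open>The elements of \<open>(nat \<Rightarrow> 'r) set\<close> include the cosets in quotients of \<open>R\<^sup>n\<close>, so every
  finitely generated \<open>R\<close>-module is isomorphic to one with carrier in this type.
  In \<open>MCM_test_ideal\<close> the bound module therefore meets every isomorphism class.

  In \<open>test_ideal\<close> the type restricts the pairs \<open>A \<subseteq> B\<close>, but for finitely generated \<open>M\<close>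
  the intersection is the one over all pairs of \<open>R\<close>-modules. The trace ideal of \<open>M\<close> multiplies
  the closure of \<open>A\<close> in \<open>B\<close> into \<open>A\<close> for every pair. Conversely, let \<open>x\<^sub>1,\<dots>,x\<^sub>n\<close>
  generate \<open>M\<close> and let \<open>P\<close> be the matrix of relations among them. For finitely many columns \<open>p\<close>
  of \<open>P\<close>, let \<open>B\<close> be generated by \<open>b\<close> and elements \<open>c\<^sub>i\<^sub>p\<close> subject to
  \<open>\<delta>\<^sub>i\<^sub>j b = (\<Sum>p. P\<^sub>j\<^sub>p c\<^sub>i\<^sub>p)\<close> for all \<open>i, j \<le> n\<close>. Then \<open>b\<close> lies in the closure of \<open>0\<close>, and if the
  columns generate all relations (\<open>R\<close> is Noetherian), \<open>r b = 0\<close> exactly when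
  \<open>r\<close> is in the trace ideal of \<open>M\<close>. This \<open>B\<close> is finitely generated.\<close>

definition test_ideal ::
    "('r, 'a) ring_scheme \<Rightarrow> ('r, 'm, 'c) module_scheme \<Rightarrow> 'r set" where
  "test_ideal R M =
     {r \<in> carrier R. \<forall>(B :: ('r, (nat \<Rightarrow> 'r) set) module) A.
        Module.module R B \<and> submodule A R B \<longrightarrow> (\<forall>b\<in>module_closure R M A B. r \<odot>\<^bsub>B\<^esub> b \<in> A)}"

definition MCM_test_ideal :: "('r, 'a) ring_scheme \<Rightarrow> 'r set" where
  "MCM_test_ideal R =
     {r \<in> carrier R. \<forall>M :: ('r, (nat \<Rightarrow> 'r) set) module.
        MCM_module R M \<longrightarrow> r \<in> test_ideal R M}"


section \<open>The ring \<open>k\<lbrakk>x\<^sup>d, x\<^sup>d\<^sup>-\<^sup>1y, \<dots>, y\<^sup>d\<rbrakk>\<close>\<close>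

text \<open>In \<open>'k fps fps\<close> the outer variable is \<open>y\<close> and the inner one \<open>x\<close>, so
  \<open>fps_nth (fps_nth f b) a\<close> is the coefficient of \<open>x\<^sup>ay\<^sup>b\<close>. The subring consists of the values
  at \<open>t\<^sub>i = x\<^sup>d\<^sup>-\<^sup>iy\<^sup>i\<close> of the power series \<open>\<Sum>\<^sub>\<alpha> c \<alpha> \<cdot> (\<Prod>i\<le>d. t\<^sub>i ^ \<alpha> i)\<close>, and the set below
  collects the exponents \<open>\<alpha>\<close> whose monomial is sent to \<open>x\<^sup>ay\<^sup>b\<close>. It is finite if \<open>d > 0\<close>.\<close>

definition veronese_exponents :: "nat \<Rightarrow> nat \<Rightarrow> nat \<Rightarrow> (nat \<Rightarrow> nat) set" where
  "veronese_exponents d a b =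
     {\<alpha>. (\<forall>i>d. \<alpha> i = 0) \<and> (\<Sum>i\<le>d. (d - i) * \<alpha> i) = a \<and> (\<Sum>i\<le>d. i * \<alpha> i) = b}"

definition veronese_ring :: "nat \<Rightarrow> 'k::field fps fps ring" where
  "veronese_ring d =
     \<lparr>carrier = {f. \<exists>c :: (nat \<Rightarrow> nat) \<Rightarrow> 'k.
                   \<forall>a b. fps_nth (fps_nth f b) a = (\<Sum>\<alpha>\<in>veronese_exponents d a b. c \<alpha>)},
      monoid.mult = (*), monoid.one = 1, ring.zero = 0, ring.add = (+)\<rparr>"

end

theory Submission
  imports Defs "HOL-Library.Function_Algebras"
begin

text \<open>Write \<open>S = k\<lbrakk>x,y\<rbrakk>\<close>, graded by total degree modulo \<open>d\<close>, and \<open>S\<^sub>j\<close> for the part of degree \<open>j\<close>. The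
  subring \<open>R\<close> is \<open>S\<^sub>0\<close>, and every \<open>S\<^sub>j\<close> is an \<open>R\<close>-module. The theorem follows from two facts: every maximal
  Cohen-Macaulay module has some \<open>S\<^sub>j\<close> with \<open>0 \<le> j < d\<close> as a direct summand, and the test ideal of \<open>S\<^sub>j\<close> is
  the maximal ideal \<open>m\<close> for \<open>0 < j < d\<close>.

  For the summand (lemma \<open>MCM_split_surjection\<close>), let \<open>M\<close> be a finitely generated \<open>R\<close>-module of
  depth at least \<open>2\<close>. Some pair \<open>a, b\<close> in \<open>m\<close> is regular on \<open>M\<close>. The
  lemmas \<open>yd_regular\<close> and \<open>xd_regular_mod_yd\<close> deduce that \<open>y\<^sup>d, x\<^sup>d\<close> is regular on \<open>M\<close>. The
  \<open>S\<close>-module \<open>H = Hom\<^sub>R(S, M)\<close> is graded, its part of degree \<open>0\<close> is \<open>Hom\<^sub>R(R, M) = M\<close>, and \<open>y, x\<close> is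
  regular on it. As in the proof that a finitely generated module of depth \<open>2\<close> over the regular ring \<open>S\<close> is
  free, a homogeneous generating set of \<open>H\<close> of minimal size is a basis: a relation
  between its members cannot have a unit coefficient, and then all coefficients can be divided by \<open>x\<close> or by
  \<open>y\<close>, for ever. A basis element \<open>e\<close> of degree \<open>j\<close> spans a direct summand of \<open>H\<close>. The part of degree \<open>0\<close> of
  \<open>S e\<close> is a copy of \<open>S\<^sub>j\<close>, and a direct summand of \<open>M\<close>. If \<open>M\<close> is indecomposable, then \<open>M\<close> is isomorphic to
  \<open>S\<^sub>j\<close>, and \<open>j > 0\<close> if \<open>M\<close> is not free.

  For the lower bound on test ideals (\<open>test_ideal_contains_maximal\<close>), a functional \<open>f : M \<rightarrow> R\<close> induces
  \<open>M \<otimes> B \<rightarrow> B\<close>, and this shows that \<open>f(v)\<close> multiplies the closure of \<open>A\<close> into \<open>A\<close>. The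
  functionals \<open>M \<rightarrow> S\<^sub>j \<rightarrow> R\<close>, the second map being multiplication by some \<open>t \<in> S\<^sub>d\<^sub>-\<^sub>j\<close>, have all products \<open>t s\<close>
  with \<open>s \<in> S\<^sub>j\<close> as values, and sums of such products give all of \<open>m\<close>.

  For the upper bound (\<open>test_ideal_proper\<close>), let \<open>0 < i < d\<close>, let \<open>B = S\<^sub>d\<^sub>-\<^sub>2\<close> and
  \<open>A = (x\<^sup>d, y\<^sup>d) B\<close>. The element \<open>b = x\<^sup>d\<^sup>-\<^sup>1 y\<^sup>d\<^sup>-\<^sup>1\<close> of \<open>B\<close> is not in \<open>A\<close>, but it is in the closure of \<open>A\<close> with
  respect to \<open>S\<^sub>i\<close>: every element of \<open>S\<^sub>i\<close> has the form \<open>x s + y s'\<close>, and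
  \<open>x s \<otimes> b = x s \<otimes> (x\<^sup>d\<^sup>-\<^sup>1 y) y\<^sup>d\<^sup>-\<^sup>2 = x\<^sup>d y s \<otimes> y\<^sup>d\<^sup>-\<^sup>2 = y s \<otimes> x\<^sup>d y\<^sup>d\<^sup>-\<^sup>2\<close>, and likewise for \<open>y s'\<close>. (\<open>B\<close> is the
  canonical module, and \<open>b\<close> spans the socle of \<open>B / A\<close>.) So no unit of \<open>R\<close> is in the test ideal.

  The intersection over all maximal Cohen-Macaulay modules is \<open>m\<close> because one of them, \<open>S\<^sub>1\<close>, has
  test ideal \<open>m\<close> if \<open>d \<ge> 2\<close>. That \<open>S\<^sub>1\<close> is maximal Cohen-Macaulay means that \<open>R\<close> has Krull dimension \<open>2\<close> and
  that \<open>y\<^sup>d, x\<^sup>d\<close> is a longest regular sequence on \<open>S\<^sub>1\<close>. Both upper bounds rest on the lemma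
  \<open>elimination\<close>: modulo an element \<open>f\<close> that does not vanish at \<open>y = 0\<close>, every \<open>g\<close> satisfies a monic equation
  over \<open>k\<lbrakk>y\<^sup>d\<rbrakk>\<close>, whose lowest non-zero coefficient is a power of \<open>y\<^sup>d\<close> up to a unit.\<close>

unbundle fps_syntax

section \<open>Noetherian rings of power series\<close>

lemma (in Modules.module) finite_span_finite_generators:
  assumes "finite E" "E \<subseteq> span G"
  shows "\<exists>F\<subseteq>G. finite F \<and> E \<subseteq> span F"
  using assms
proof (induction E)
  case empty
  show ?case by (rule exI[of _ "{}"]) simp
next
  case (insert e E)
  then obtain F where F: "F \<subseteq> G" "finite F" "E \<subseteq> span F" by blast
  have "e \<in> span G" using insert.prems by simp
  then obtain F' u where F': "finite F'" "F' \<subseteq> G" "e = (\<Sum>a\<in>F'. u a *s a)"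
    unfolding span_explicit mem_Collect_eq by metis
  have "e \<in> span F'" unfolding F'(3) by (intro span_sum span_scale span_base)
  then have "insert e E \<subseteq> span (F \<union> F')"
    using F(3) span_mono[of F "F \<union> F'"] span_mono[of F' "F \<union> F'"] by blast
  then show ?case using F F' by (intro exI[of _ "F \<union> F'"]) simp
qed

interpretation ideal_span: Modules.module "(*) :: 'a::comm_ring_1 \<Rightarrow> 'a \<Rightarrow> 'a"
proof
  show "a * (x + y) = a * x + a * y" for a x y :: 'a by (rule distrib_left)
  show "(a + b) * x = a * x + b * x" for a b x :: 'a by (rule distrib_right)
  show "a * (b * x) = a * b * x" for a b x :: 'a by (rule mult.assoc[symmetric])
  show "1 * x = x" for x :: 'a by simp
qed

interpretation fun_span: Modules.module "\<lambda>(c::'a::comm_ring_1) (v :: 'i \<Rightarrow> 'a) i. c * v i"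
proof
  fix a b :: 'a and x y :: "'i \<Rightarrow> 'a"
  show "(\<lambda>i. a * (x + y) i) = (\<lambda>i. a * x i) + (\<lambda>i. a * y i)"
    by (rule ext) (simp only: plus_fun_apply distrib_left)
  show "(\<lambda>i. (a + b) * x i) = (\<lambda>i. a * x i) + (\<lambda>i. b * x i)"
    by (rule ext) (simp only: plus_fun_apply distrib_right)
  show "(\<lambda>i. a * (b * x i)) = (\<lambda>i. a * b * x i)"
    by (simp only: mult.assoc)
  show "(\<lambda>i. 1 * x i) = x" by (simp only: mult_1)
qed

text \<open>As rewrite rules, these facts would move brackets to the left, against \<open>mult.assoc\<close>.\<close>

declare ideal_span.scale_scale [simp del] fun_span.scale_scale [simp del]

definition noetherian :: "'a::comm_ring_1 itself \<Rightarrow> bool" where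
  "noetherian _ \<longleftrightarrow> (\<forall>G :: 'a set. \<exists>F\<subseteq>G. finite F \<and> G \<subseteq> ideal_span.span F)"

lemma noetherianD:
  assumes "noetherian TYPE('a::comm_ring_1)"
  obtains F where "F \<subseteq> G" "finite F" "(G :: 'a set) \<subseteq> ideal_span.span F"
  using assms unfolding noetherian_def by blast

lemma noetherian_field: "noetherian TYPE('k::field)"
  unfolding noetherian_def
proof
  fix G :: "'k set"
  show "\<exists>F\<subseteq>G. finite F \<and> G \<subseteq> ideal_span.span F"
  proof (cases "G \<subseteq> {0}")
    case True
    then show ?thesis by (intro exI[of _ "{}"]) auto
  next
    case False
    then obtain g where g: "g \<in> G" "g \<noteq> 0" by auto
    have "h \<in> ideal_span.span {g}" for h
    proof -
      have "h = (h / g) * g" using g by simp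
      then show ?thesis using ideal_span.span_scale[OF ideal_span.span_base, of g "{g}" "h / g"] by simp
    qed
    then show ?thesis using g by (intro exI[of _ "{g}"]) auto
  qed
qed

text \<open>Induction on the number of coordinates: generators of the ideal of \<open>j\<close>-th coordinates reduce a vector of
  the submodule to one with vanishing \<open>j\<close>-th coordinate.\<close>

lemma noetherian_vectors:
  assumes noeth: "noetherian TYPE('a::comm_ring_1)" and "finite I"
    and "\<And>g i. g \<in> G \<Longrightarrow> i \<notin> I \<Longrightarrow> (g :: 'i \<Rightarrow> 'a) i = 0"
  shows "\<exists>F\<subseteq>G. finite F \<and> G \<subseteq> fun_span.span F"
  using assms(2,3)
proof (induction I arbitrary: G)
  case empty
  then have "G \<subseteq> {0}" by (auto simp: fun_eq_iff)
  then show ?case by (intro exI[of _ "{}"]) auto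
next
  case (insert j I)
  let ?K = "fun_span.span G"
  have supp: "g i = 0" if "g \<in> ?K" "i \<notin> insert j I" for g i
    using that(1)
  proof (induction rule: fun_span.span_induct_alt)
    case base then show ?case by simp
  next
    case (step c x y) then show ?case using insert.prems[of x i] that(2) by auto
  qed
  obtain C where C: "C \<subseteq> (\<lambda>g. g j) ` ?K" "finite C" "(\<lambda>g. g j) ` ?K \<subseteq> ideal_span.span C"
    by (rule noetherianD[OF noeth])
  then obtain E where E: "E \<subseteq> ?K" "finite E" "C = (\<lambda>g. g j) ` E"
    by (metis finite_subset_image)
  let ?Z = "{g\<in>?K. g j = 0}"
  have "\<exists>F\<subseteq>?Z. finite F \<and> ?Z \<subseteq> fun_span.span F"
  proof (rule insert.IH)
    fix g i assume "g \<in> ?Z" "i \<notin> I"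
    then show "g i = 0" using supp[of g i] by (cases "i = j") auto
  qed
  then obtain F where F: "F \<subseteq> ?Z" "finite F" "?Z \<subseteq> fun_span.span F" by auto
  have 1: "\<exists>h \<in> fun_span.span E. h j = c" if "c \<in> ideal_span.span C" for c
    using that
  proof (induction rule: ideal_span.span_induct_alt)
    case base then show ?case by (intro bexI[of _ 0]) (auto simp: fun_span.span_zero)
  next
    case (step c x y)
    then obtain h e where "h \<in> fun_span.span E" "h j = y" "e \<in> E" "e j = x"
      unfolding E(3) by auto
    then show ?case
      by (intro bexI[of _ "(\<lambda>i. c * e i) + h"])
         (auto intro: fun_span.span_add fun_span.span_scale[of e] fun_span.span_base)
  qed
  have "?K \<subseteq> fun_span.span (E \<union> F)"
  proof
    fix g assume g: "g \<in> ?K"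
    then obtain h where h: "h \<in> fun_span.span E" "h j = g j" using 1 C(3) by blast
    then have "h \<in> ?K" using fun_span.span_minimal[OF E(1)] by auto
    then have "g - h \<in> ?Z" using g h by (auto intro: fun_span.span_diff)
    then have "g - h \<in> fun_span.span (E \<union> F)" using F(3) fun_span.span_mono[of F "E \<union> F"] by auto
    moreover have "h \<in> fun_span.span (E \<union> F)" using h fun_span.span_mono[of E "E \<union> F"] by auto
    ultimately have "(g - h) + h \<in> fun_span.span (E \<union> F)" by (rule fun_span.span_add)
    then show "g \<in> fun_span.span (E \<union> F)" by simp
  qed
  moreover have "finite (E \<union> F)" "E \<union> F \<subseteq> ?K" using E F by auto
  then obtain F' where F': "F' \<subseteq> G" "finite F'" "E \<union> F \<subseteq> fun_span.span F'"
    using fun_span.finite_span_finite_generators[of "E \<union> F" G] by auto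
  ultimately have "?K \<subseteq> fun_span.span F'"
    using fun_span.span_minimal[OF F'(3)] by auto
  then show ?case using F' fun_span.span_superset[of G] by (intro exI[of _ F']) auto
qed

text \<open>Hilbert's basis theorem for power series. Let \<open>L n\<close> be the ideal of coefficients at \<open>n\<close> of those elements
  of the given ideal \<open>K\<close> that have order at least \<open>n\<close>. These ideals increase, so they are constant from some
  \<open>N\<close> on. Elements of \<open>K\<close> that realise finite generating sets of \<open>L 0, \<dots>, L N\<close> generate \<open>K\<close>.\<close>

lemma noetherian_fps:
  assumes noeth: "noetherian TYPE('a::comm_ring_1)"
  shows "noetherian TYPE('a fps)"
  unfolding noetherian_def
proof
  fix G :: "'a fps set"
  define K where "K = ideal_span.span G"
  define T where "T n = {f\<in>K. \<forall>i<n. f $ i = 0}" for n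
  define L where "L n = (\<lambda>f. f $ n) ` T n" for n
  have K_sub: "ideal_span.subspace K" unfolding K_def by simp
  have K_add: "f + g \<in> K" and K_diff: "f - g \<in> K" and K_mult: "h * f \<in> K" if "f \<in> K" "g \<in> K" for f g h
    using that K_sub by (auto intro: ideal_span.subspace_add ideal_span.subspace_diff ideal_span.subspace_scale)
  have L_mono: "L n \<subseteq> L m" if "n \<le> m" for n m
    using that
  proof (induction rule: dec_induct)
    case (step m)
    have "L m \<subseteq> L (Suc m)"
    proof
      fix a assume "a \<in> L m"
      then obtain f where f: "f \<in> T m" "f $ m = a" unfolding L_def by auto
      then have "fps_X * f \<in> T (Suc m)" unfolding T_def using K_mult by auto
      then show "a \<in> L (Suc m)" unfolding L_def using f by (auto intro!: image_eqI[of _ _ "fps_X * f"])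
    qed
    then show ?case using step by auto
  qed auto
  obtain C where C: "C \<subseteq> (\<Union>n. L n)" "finite C" "(\<Union>n. L n) \<subseteq> ideal_span.span C"
    by (rule noetherianD[OF noeth])
  have "\<exists>N. C' \<subseteq> L N" if "finite C'" "C' \<subseteq> (\<Union>n. L n)" for C'
    using that
  proof (induction)
    case empty
    then show ?case by blast
  next
    case (insert c C')
    then obtain N n where Nn: "C' \<subseteq> L N" "c \<in> L n" by blast
    have "insert c C' \<subseteq> L (max N n)" using L_mono[of N "max N n"] L_mono[of n "max N n"] Nn by auto
    then show ?case by blast
  qed
  from this[OF C(2,1)] obtain N where N: "C \<subseteq> L N" by blast
  obtain E where E: "E \<subseteq> T N" "finite E" "inj_on (\<lambda>f. f $ N) E" "C = (\<lambda>f. f $ N) ` E"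
    using N C(2) unfolding L_def subset_image_inj by (auto dest: finite_imageD)
  have EK: "E \<subseteq> K" using E(1) T_def by auto
  \<comment> \<open>Above order \<open>N\<close> the leading coefficients of \<open>E\<close>, shifted by powers of the variable, cancel one
    coefficient after the other; the multipliers used are the coefficients of power series.\<close>
  have top: "f \<in> ideal_span.span E" if f: "f \<in> T N" for f
  proof -
    have ex: "\<exists>c. g $ (N + k) = (\<Sum>h\<in>E. c h * h $ N)" if "g \<in> T (N + k)" for k g
    proof -
      have "g $ (N + k) \<in> ideal_span.span C" using that C(3) L_def by blast
      then obtain u where "g $ (N + k) = (\<Sum>a\<in>C. u a * a)"
        unfolding ideal_span.span_finite[OF C(2)] by auto
      also have "\<dots> = (\<Sum>h\<in>E. u (h $ N) * h $ N)"
        unfolding E(4) by (subst sum.reindex[OF E(3)]) simp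
      finally show ?thesis by (intro exI[of _ "\<lambda>h. u (h $ N)"])
    qed
    define c where "c k g = (SOME c. g $ (N + k) = (\<Sum>h\<in>E. c h * h $ N))" for k g
    have c: "g $ (N + k) = (\<Sum>h\<in>E. c k g h * h $ N)" if "g \<in> T (N + k)" for k g
      unfolding c_def by (rule someI_ex[OF ex[OF that]])
    define r where "r = rec_nat f (\<lambda>k g. g - (\<Sum>h\<in>E. fps_const (c k g h) * fps_X ^ k * h))"
    have r0: "r 0 = f" and rS: "r (Suc k) = r k - (\<Sum>h\<in>E. fps_const (c k (r k) h) * fps_X ^ k * h)" for k
      by (simp_all add: r_def)
    have rT: "r k \<in> T (N + k)" for k
    proof (induction k)
      case 0 then show ?case using f r0 by simp
    next
      case (Suc k)
      have "(\<Sum>h\<in>E. fps_const (c k (r k) h) * fps_X ^ k * h) \<in> K"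
        by (rule ideal_span.subspace_sum[OF K_sub]) (use EK K_mult in blast)
      then have "r (Suc k) \<in> K" using Suc K_diff rS T_def by auto
      moreover have "r (Suc k) $ i = 0" if i: "i < N + Suc k" for i
      proof -
        have h: "(fps_const a * fps_X ^ k * h) $ i = (if i = N + k then a * h $ N else 0)" if "h \<in> E" for h a
        proof -
          have "\<forall>i<N. h $ i = 0" using that E(1) T_def by auto
          moreover have "(fps_const a * fps_X ^ k * h) $ i = a * (if i < k then 0 else h $ (i - k))"
            by (simp only: mult.assoc fps_mult_left_const_nth fps_X_power_mult_nth)
          moreover have "i - k = N" if "i = N + k" using that by simp
          moreover have "i - k < N" if "i \<noteq> N + k" "\<not> i < k" using that i by simp
          ultimately show ?thesis by auto
        qed
        have "r (Suc k) $ i = r k $ i - (\<Sum>h\<in>E. if i = N + k then c k (r k) h * h $ N else 0)"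
          unfolding rS by (simp add: fps_sum_nth h)
        also have "\<dots> = 0"
          using c[OF Suc] Suc i by (cases "i = N + k") (auto simp: T_def)
        finally show ?thesis .
      qed
      ultimately show ?case unfolding T_def by auto
    qed
    have part: "f = r k + (\<Sum>h\<in>E. (\<Sum>j<k. fps_const (c j (r j) h) * fps_X ^ j) * h)" for k
    proof (induction k)
      case 0 then show ?case using r0 by simp
    next
      case (Suc k)
      then show ?case by (simp add: rS sum.distrib distrib_right)
    qed
    have "f = (\<Sum>h\<in>E. Abs_fps (\<lambda>j. c j (r j) h) * h)"
    proof (rule fps_ext)
      fix n
      have coeff: "(\<Sum>j<Suc n. fps_const (c j (r j) h) * fps_X ^ j) $ i = (if i \<le> n then c i (r i) h else 0)" for i h
      proof -
        have "(\<Sum>j<Suc n. fps_const (c j (r j) h) * fps_X ^ j) $ i = (\<Sum>j<Suc n. if j = i then c i (r i) h else 0)"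
          unfolding fps_sum_nth by (intro sum.cong) auto
        then show ?thesis by auto
      qed
      have "r (Suc n) $ n = 0" using rT[of "Suc n"] T_def by auto
      then have "f $ n = (\<Sum>h\<in>E. (\<Sum>j<Suc n. fps_const (c j (r j) h) * fps_X ^ j) * h) $ n"
        using arg_cong[OF part[of "Suc n"], of "\<lambda>p. p $ n"] unfolding fps_add_nth by simp
      also have "\<dots> = (\<Sum>h\<in>E. Abs_fps (\<lambda>j. c j (r j) h) * h) $ n"
        unfolding fps_sum_nth[of _ E] fps_mult_nth[of "sum _ _"] fps_mult_nth[of "Abs_fps _"] coeff
        by (intro sum.cong) auto
      finally show "f $ n = (\<Sum>h\<in>E. Abs_fps (\<lambda>j. c j (r j) h) * h) $ n" .
    qed
    also have "\<dots> \<in> ideal_span.span E"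
      by (intro ideal_span.span_sum ideal_span.span_scale ideal_span.span_base)
    finally show ?thesis .
  qed
  \<comment> \<open>Below \<open>N\<close> the order is lowered step by step from \<open>N\<close> to \<open>0\<close>.\<close>
  have "\<exists>D\<subseteq>K. finite D \<and> T n \<subseteq> ideal_span.span D" if "n \<le> N" for n
    using that
  proof (induction rule: inc_induct)
    case base
    have "T N \<subseteq> ideal_span.span E" using top by (rule subsetI)
    then show ?case using E(2) EK by (intro exI[of _ E] conjI)
  next
    case (step n)
    then obtain D where D: "D \<subseteq> K" "finite D" "T (Suc n) \<subseteq> ideal_span.span D" by auto
    obtain C' where C': "C' \<subseteq> L n" "finite C'" "L n \<subseteq> ideal_span.span C'"
      by (rule noetherianD[OF noeth])
    then obtain E' where E': "E' \<subseteq> T n" "finite E'" "C' = (\<lambda>f. f $ n) ` E'"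
      unfolding L_def by (meson finite_subset_image)
    have lift: "\<exists>h \<in> ideal_span.span E' \<inter> T n. h $ n = a" if "a \<in> ideal_span.span C'" for a
      using that
    proof (induction rule: ideal_span.span_induct_alt)
      case base
      then show ?case using ideal_span.subspace_0[OF K_sub]
        by (intro bexI[of _ 0]) (auto simp: ideal_span.span_zero T_def)
    next
      case (step a x y)
      then obtain h e where he: "h \<in> ideal_span.span E'" "h \<in> T n" "h $ n = y" "e \<in> E'" "e \<in> T n" "e $ n = x"
        using E'(1) unfolding E'(3) by auto
      then have "fps_const a * e + h \<in> T n" using K_add K_mult by (auto simp: T_def)
      moreover have "fps_const a * e + h \<in> ideal_span.span E'"
        by (rule ideal_span.span_add[OF ideal_span.span_scale[OF ideal_span.span_base]]) (use he in auto)
      ultimately show ?case using he by (intro bexI[of _ "fps_const a * e + h"]) auto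
    qed
    have "T n \<subseteq> ideal_span.span (D \<union> E')"
    proof
      fix f assume f: "f \<in> T n"
      then have "f $ n \<in> ideal_span.span C'" using C'(3) L_def by blast
      then obtain h where h: "h \<in> ideal_span.span E'" "h \<in> T n" "h $ n = f $ n" using lift by auto
      then have "f - h \<in> T (Suc n)" using f K_diff by (auto simp: T_def less_Suc_eq)
      then have "f - h \<in> ideal_span.span (D \<union> E')"
        using D(3) ideal_span.span_mono[of D "D \<union> E'"] by auto
      moreover have "h \<in> ideal_span.span (D \<union> E')"
        using h ideal_span.span_mono[of E' "D \<union> E'"] by auto
      ultimately have "(f - h) + h \<in> ideal_span.span (D \<union> E')" by (rule ideal_span.span_add)
      then show "f \<in> ideal_span.span (D \<union> E')" by simp
    qed
    moreover have "D \<union> E' \<subseteq> K" using D E' T_def by auto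
    moreover have "finite (D \<union> E')" using D(2) E'(2) by simp
    ultimately show ?case by blast
  qed
  then obtain D where D: "D \<subseteq> K" "finite D" "T 0 \<subseteq> ideal_span.span D" by blast
  have T0: "T 0 = K" by (simp add: T_def)
  obtain F where F: "F \<subseteq> G" "finite F" "D \<subseteq> ideal_span.span F"
    using ideal_span.finite_span_finite_generators[OF D(2), of G] D(1) unfolding K_def by blast
  have "ideal_span.span D \<subseteq> ideal_span.span F" using F(3) by (simp add: ideal_span.span_minimal)
  moreover have "G \<subseteq> K" unfolding K_def by (rule ideal_span.span_superset)
  ultimately have "G \<subseteq> ideal_span.span F" using D(3) unfolding T0 by (meson subset_trans)
  then show "\<exists>F\<subseteq>G. finite F \<and> G \<subseteq> ideal_span.span F"
    using F by blast
qed

section \<open>The grading of \<open>k\<lbrakk>x,y\<rbrakk>\<close> by degree modulo \<open>d\<close>\<close>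

definition graded_part :: "nat \<Rightarrow> nat \<Rightarrow> 'k::field fps fps set" where
  "graded_part d j = {f. \<forall>a b. f $ b $ a \<noteq> 0 \<longrightarrow> (a + b) mod d = j mod d}"

definition graded_proj :: "nat \<Rightarrow> nat \<Rightarrow> 'k::field fps fps \<Rightarrow> 'k fps fps" where
  "graded_proj d j f = Abs_fps (\<lambda>b. Abs_fps (\<lambda>a. if (a + b) mod d = j mod d then f $ b $ a else 0))"

definition xv :: "'k::field fps fps" where "xv = fps_const fps_X"
abbreviation yv :: "'k::field fps fps" where "yv \<equiv> fps_X"

lemma graded_partI: "(\<And>a b. f $ b $ a \<noteq> 0 \<Longrightarrow> (a + b) mod d = j mod d) \<Longrightarrow> f \<in> graded_part d j"
  by (simp add: graded_part_def)

lemma graded_partD: "f \<in> graded_part d j \<Longrightarrow> f $ b $ a \<noteq> 0 \<Longrightarrow> (a + b) mod d = j mod d"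
  by (simp add: graded_part_def)

lemma graded_proj_nth: "graded_proj d j f $ b $ a = (if (a + b) mod d = j mod d then f $ b $ a else 0)"
  by (simp add: graded_proj_def)

lemma graded_proj_in [simp]: "graded_proj d j f \<in> graded_part d j"
  by (rule graded_partI) (simp add: graded_proj_nth split: if_splits)

lemma fps_fps_ext: "(\<And>a b. f $ b $ a = g $ b $ a) \<Longrightarrow> f = g"
  by (intro fps_ext) simp

lemma graded_proj_id: "f \<in> graded_part d j \<Longrightarrow> graded_proj d j f = f"
  by (rule fps_fps_ext) (auto simp: graded_proj_nth dest: graded_partD)

lemma graded_proj_id_iff: "graded_proj d j f = f \<longleftrightarrow> f \<in> graded_part d j"
  using graded_proj_id graded_proj_in by metis

lemma graded_proj_add: "graded_proj d j (f + g) = graded_proj d j f + graded_proj d j g"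
  by (rule fps_fps_ext) (simp add: graded_proj_nth)

lemma graded_proj_0 [simp]: "graded_proj d j 0 = 0"
  by (rule fps_fps_ext) (simp add: graded_proj_nth)

lemma graded_proj_sum: "graded_proj d j (\<Sum>i\<in>A. f i) = (\<Sum>i\<in>A. graded_proj d j (f i))"
  by (induction A rule: infinite_finite_induct) (simp_all add: graded_proj_add)

lemma graded_part_add: "f \<in> graded_part d j \<Longrightarrow> g \<in> graded_part d j \<Longrightarrow> f + g \<in> graded_part d j"
  by (metis graded_proj_add graded_proj_id_iff)

lemma graded_part_0 [simp]: "0 \<in> graded_part d j"
  by (simp add: graded_part_def)

lemma graded_part_uminus: "f \<in> graded_part d j \<Longrightarrow> - f \<in> graded_part d j"
  by (simp add: graded_part_def)

lemma graded_part_diff: "f \<in> graded_part d j \<Longrightarrow> g \<in> graded_part d j \<Longrightarrow> f - g \<in> graded_part d j"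
  using graded_part_add[of f d j "- g"] by (simp add: graded_part_uminus)

lemma graded_part_sum: "(\<And>i. i \<in> A \<Longrightarrow> f i \<in> graded_part d j) \<Longrightarrow> (\<Sum>i\<in>A. f i) \<in> graded_part d j"
  by (induction A rule: infinite_finite_induct) (simp_all add: graded_part_add)

lemma graded_part_cong: "j mod d = j' mod d \<Longrightarrow> graded_part d j = graded_part d j'"
  by (simp add: graded_part_def)

lemma sum_graded_proj:
  assumes "d > 0"
  shows "(\<Sum>j<d. graded_proj d j f) = f"
proof (rule fps_fps_ext)
  fix a b
  have "(\<Sum>j<d. graded_proj d j f) $ b $ a = (\<Sum>j<d. if j = (a + b) mod d then f $ b $ a else 0)"
    unfolding fps_sum_nth by (intro sum.cong) (auto simp: graded_proj_nth)
  then show "(\<Sum>j<d. graded_proj d j f) $ b $ a = f $ b $ a" using assms by simp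
qed

lemma fps_fps_mult_nth:
  "(f * g) $ b $ a = (\<Sum>i=0..b. \<Sum>l=0..a. f $ i $ l * g $ (b - i) $ (a - l))"
  by (simp add: fps_mult_nth fps_sum_nth)

lemma mod_add_left_cancel_nat: "(j + m) mod d = (j + k) mod d \<longleftrightarrow> m mod d = k mod d" for j :: nat
proof -
  have "(j + m) mod d = (j + k) mod d \<longleftrightarrow> int (j + m) mod int d = int (j + k) mod int d"
    by (simp only: flip: of_nat_mod) simp
  also have "\<dots> \<longleftrightarrow> int m mod int d = int k mod int d"
    by (simp add: mod_eq_dvd_iff)
  also have "\<dots> \<longleftrightarrow> m mod d = k mod d"
    by (simp only: flip: of_nat_mod) simp
  finally show ?thesis .
qed

text \<open>Multiplication by a homogeneous element shifts the degrees, so it commutes with taking components.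
  In particular the projection to degree \<open>0\<close> is \<open>R\<close>-linear, which transfers finiteness from \<open>k\<lbrakk>x,y\<rbrakk>\<close> to \<open>R\<close>.\<close>

lemma graded_proj_mult:
  assumes "f \<in> graded_part d j"
  shows "graded_proj d (j + k) (f * g) = f * graded_proj d k g"
proof (rule fps_fps_ext)
  fix a b
  have "(if (a + b) mod d = (j + k) mod d then f $ i $ l * g $ (b - i) $ (a - l) else 0)
      = f $ i $ l * graded_proj d k g $ (b - i) $ (a - l)" if "i \<le> b" "l \<le> a" for i l
  proof (cases "f $ i $ l = 0")
    case False
    then have j: "(l + i) mod d = j mod d" using graded_partD[OF assms] by auto
    have ab: "a + b = (l + i) + ((a - l) + (b - i))" using that by simp
    have "(a + b) mod d = (j + ((a - l) + (b - i))) mod d"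
      unfolding ab using j by (metis mod_add_left_eq)
    then have "(a + b) mod d = (j + k) mod d \<longleftrightarrow> ((a - l) + (b - i)) mod d = k mod d"
      by (simp only: mod_add_left_cancel_nat)
    then show ?thesis by (simp add: graded_proj_nth)
  qed simp
  then show "graded_proj d (j + k) (f * g) $ b $ a = (f * graded_proj d k g) $ b $ a"
    unfolding graded_proj_nth[of d "j + k"] fps_fps_mult_nth
    by (cases "(a + b) mod d = (j + k) mod d") (auto intro!: sum.cong sum.neutral)
qed

lemma graded_part_mult:
  assumes "f \<in> graded_part d j" "g \<in> graded_part d k"
  shows "f * g \<in> graded_part d (j + k)"
  using graded_proj_mult[OF assms(1), of k g] assms(2) by (metis graded_proj_id graded_proj_in)

lemma graded_part_mult_0:
  "f \<in> graded_part d 0 \<Longrightarrow> g \<in> graded_part d k \<Longrightarrow> f * g \<in> graded_part d k"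
  using graded_part_mult[of f d 0 g k] by simp

lemma graded_proj_mult_0: "f \<in> graded_part d 0 \<Longrightarrow> graded_proj d k (f * g) = f * graded_proj d k g"
  using graded_proj_mult[of f d 0 k g] by simp

lemma graded_part_1 [simp]: "1 \<in> graded_part d 0"
  by (rule graded_partI) (auto simp: fps_one_nth split: if_splits)

lemma graded_part_power:
  assumes "f \<in> graded_part d j"
  shows "f ^ n \<in> graded_part d (n * j)"
  by (induction n) (use assms graded_part_mult in auto)

lemma graded_part_power_0: "f \<in> graded_part d 0 \<Longrightarrow> f ^ n \<in> graded_part d 0"
  using graded_part_power[of f d 0 n] by simp

lemma graded_part_power_d: "f \<in> graded_part d j \<Longrightarrow> f ^ d \<in> graded_part d 0"
  using graded_part_power[of f d j d] graded_part_cong[of "d * j" d 0] by auto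

lemma xv_part: "xv \<in> graded_part d 1"
  unfolding xv_def by (rule graded_partI) (auto split: if_splits)

lemma yv_part: "yv \<in> graded_part d 1"
  by (rule graded_partI) (auto split: if_splits)

lemma xv_power_part: "xv ^ n \<in> graded_part d n"
  using graded_part_power[OF xv_part, of n d] by simp

lemma yv_power_part: "yv ^ n \<in> graded_part d n"
  using graded_part_power[OF yv_part, of n d] by simp

lemma xv_power_d [simp]: "xv ^ d \<in> graded_part d 0" and yv_power_d [simp]: "yv ^ d \<in> graded_part d 0"
  using graded_part_power_d xv_part yv_part by blast+

text \<open>A homogeneous factor can be cancelled: the ring is a domain and the complementary
  components of the cofactor are annihilated.\<close>

lemma graded_part_cancel:
  assumes "t \<in> graded_part d j" "t \<noteq> 0" "t * w \<in> graded_part d (j + k)"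
  shows "w \<in> graded_part d k"
proof -
  have "t * graded_proj d k w = t * w"
    using graded_proj_mult[OF assms(1), of k w] graded_proj_id[OF assms(3)] by (simp only:)
  then have "graded_proj d k w = w" using assms(2) mult_left_cancel by blast
  then show ?thesis by (simp only: graded_proj_id_iff)
qed

lemma split_constant_y: "s = fps_const (s $ 0) + yv * fps_shift 1 s"
  by (rule fps_ext) simp

text \<open>The monomials that involve no \<open>y\<close> are divided by \<open>x\<close>, the others by \<open>y\<close>.\<close>

lemma split_xy:
  assumes "s \<in> graded_part d (Suc j)" "s $ 0 $ 0 = 0"
  obtains s' s'' where "s' \<in> graded_part d j" "s'' \<in> graded_part d j" "s = xv * s' + yv * s''"
proof
  have *: "Suc j mod d = Suc n mod d \<Longrightarrow> j mod d = n mod d" for n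
    using mod_add_left_cancel_nat[of 1 j d n] by simp
  show "fps_const (fps_shift 1 (s $ 0)) \<in> graded_part d j"
  proof (rule graded_partI)
    fix a b assume "fps_const (fps_shift 1 (s $ 0)) $ b $ a \<noteq> 0"
    then have "b = 0" "s $ 0 $ Suc a \<noteq> 0" by (auto split: if_splits)
    then show "(a + b) mod d = j mod d" using graded_partD[OF assms(1), of 0 "Suc a"] *[of a] by simp
  qed
  show "fps_shift 1 s \<in> graded_part d j"
  proof (rule graded_partI)
    fix a b assume "fps_shift 1 s $ b $ a \<noteq> 0"
    then have "(a + Suc b) mod d = Suc j mod d" using graded_partD[OF assms(1), of "Suc b" a] by simp
    then show "(a + b) mod d = j mod d" using *[of "a + b"] by simp
  qed
  have "s $ 0 = fps_X * fps_shift 1 (s $ 0)"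
    by (rule fps_ext) (use assms(2) in \<open>auto\<close>)
  then show "s = xv * fps_const (fps_shift 1 (s $ 0)) + yv * fps_shift 1 s"
    using split_constant_y[of s] by (simp only: fps_const_mult xv_def)
qed

lemma unit_if_constant_nonzero:
  assumes "f $ 0 $ 0 \<noteq> (0 :: 'k::field)" "f \<in> graded_part d 0"
  obtains g where "g \<in> graded_part d 0" "f * g = 1"
proof -
  have "f $ 0 * inverse (f $ 0) = 1" using assms(1) by (simp add: inverse_mult_eq_1')
  then have 1: "f * fps_right_inverse f (inverse (f $ 0)) = 1" by (rule fps_right_inverse)
  moreover have "f \<noteq> 0" using assms(1) by auto
  ultimately have "fps_right_inverse f (inverse (f $ 0)) \<in> graded_part d 0"
    using graded_part_cancel[OF assms(2), of "fps_right_inverse f (inverse (f $ 0))" 0] by simp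
  then show ?thesis using 1 that by blast
qed

lemma factor_y_power:
  assumes "f \<noteq> (0 :: 'k::field fps fps)"
  obtains c f' where "f = yv ^ c * f'" "f' $ 0 \<noteq> 0"
proof
  show "f = yv ^ subdegree f * fps_shift (subdegree f) f"
    by (metis mult.commute subdegree_decompose)
  show "fps_shift (subdegree f) f $ 0 \<noteq> 0" using assms by simp
qed

lemma factor_x_power:
  assumes "z \<noteq> (0 :: 'k::field fps)"
  obtains s w where "fps_const z = xv ^ s * w" "w $ 0 $ 0 \<noteq> 0"
proof
  show "fps_const z = xv ^ subdegree z * fps_const (fps_shift (subdegree z) z)"
    by (simp only: fps_const_power fps_const_mult xv_def) (metis mult.commute subdegree_decompose)
  show "fps_const (fps_shift (subdegree z) z) $ 0 $ 0 \<noteq> 0" using assms by simp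
qed


section \<open>The Veronese ring is local\<close>

lemma finite_veronese_exponents:
  assumes "d > 0"
  shows "finite (veronese_exponents d a b)"
proof (rule finite_subset)
  show "veronese_exponents d a b \<subseteq> {\<alpha>. \<forall>i. (i \<in> {..d} \<longrightarrow> \<alpha> i \<in> {..a + b}) \<and> (i \<notin> {..d} \<longrightarrow> \<alpha> i = 0)}"
  proof (intro subsetI CollectI allI conjI impI)
    fix \<alpha> i assume \<alpha>: "\<alpha> \<in> veronese_exponents d a b"
    then show "\<alpha> i = 0" if "i \<notin> {..d}" using that by (auto simp: veronese_exponents_def)
    assume i: "i \<in> {..d}"
    have "(d - i) * \<alpha> i \<le> a" "i * \<alpha> i \<le> b"
      using \<alpha> i member_le_sum[of i "{..d}" "\<lambda>i. (d - i) * \<alpha> i"] member_le_sum[of i "{..d}" "\<lambda>i. i * \<alpha> i"]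
      by (auto simp: veronese_exponents_def)
    moreover have "\<alpha> i \<le> d * \<alpha> i" using assms by simp
    moreover have "d * \<alpha> i = (d - i) * \<alpha> i + i * \<alpha> i"
      using i by (simp flip: distrib_right)
    ultimately show "\<alpha> i \<in> {..a + b}" by simp
  qed
  show "finite {\<alpha>. \<forall>i. (i \<in> {..d} \<longrightarrow> \<alpha> i \<in> {..a + b}) \<and> (i \<notin> {..d} \<longrightarrow> \<alpha> i = (0::nat))}"
    by (rule finite_set_of_finite_funs) auto
qed

lemma degree_veronese_exponents:
  assumes "\<alpha> \<in> veronese_exponents d a b"
  shows "a + b = d * (\<Sum>i\<le>d. \<alpha> i)"
proof -
  have "a + b = (\<Sum>i\<le>d. (d - i) * \<alpha> i + i * \<alpha> i)"
    using assms by (simp add: veronese_exponents_def sum.distrib)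
  also have "\<dots> = (\<Sum>i\<le>d. d * \<alpha> i)"
    by (intro sum.cong) (auto simp flip: distrib_right)
  finally show ?thesis by (simp add: sum_distrib_left)
qed

text \<open>With \<open>b = d q + r\<close> and \<open>r < d\<close>, the monomial \<open>x\<^sup>ay\<^sup>b\<close> is a product of \<open>q\<close> factors \<open>y\<^sup>d\<close>, one factor
  \<open>x\<^sup>d\<^sup>-\<^sup>r y\<^sup>r\<close> if \<open>r > 0\<close>, and factors \<open>x\<^sup>d\<close>.\<close>

lemma veronese_exponents_nonempty:
  assumes "d > 0" "(a + b) mod d = 0"
  shows "veronese_exponents d a b \<noteq> {}"
proof -
  define q r where "q = b div d" and "r = b mod d"
  have b: "b = d * q + r" "r < d" using assms by (simp_all add: q_def r_def)
  have "(a + r) mod d = 0" using assms(2) unfolding b by (metis add.assoc add.commute mod_mult_self2)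
  then obtain p where p: "a + r = d * p" by auto
  define e where "e = (if r = 0 then p else p - 1)"
  have e: "a = d * e + (if r = 0 then 0 else d - r)"
  proof (cases "r = 0")
    case False
    then have "p \<noteq> 0" using p by (metis add_is_0 mult_0_right)
    then obtain p' where "p = Suc p'" by (cases p) auto
    then show ?thesis using p b False by (simp add: e_def)
  qed (use p in \<open>simp add: e_def\<close>)
  define \<alpha> where "\<alpha> i = (if i = 0 then e else 0) + (if i = d then q else 0) + (if i = r then of_bool (r \<noteq> 0) else 0)" for i
  have "(\<Sum>i\<le>d. (d - i) * \<alpha> i) = (\<Sum>i\<le>d. (if i = 0 then d * e else 0) + (if i = r then (d - r) * of_bool (r \<noteq> 0) else 0))"
    by (intro sum.cong) (auto simp: \<alpha>_def algebra_simps)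
  also have "\<dots> = a" unfolding sum.distrib using b(2) by (subst e) simp
  finally have 1: "(\<Sum>i\<le>d. (d - i) * \<alpha> i) = a" .
  have "(\<Sum>i\<le>d. i * \<alpha> i) = (\<Sum>i\<le>d. (if i = d then d * q else 0) + (if i = r then r * of_bool (r \<noteq> 0) else 0))"
    by (intro sum.cong) (auto simp: \<alpha>_def algebra_simps)
  also have "\<dots> = b" unfolding sum.distrib using b by (subst b(1)) simp
  finally have 2: "(\<Sum>i\<le>d. i * \<alpha> i) = b" .
  have "\<forall>i>d. \<alpha> i = 0" using b(2) assms(1) by (auto simp: \<alpha>_def)
  then show ?thesis using 1 2 by (auto simp: veronese_exponents_def)
qed

text \<open>A power series all of whose degrees are divisible by \<open>d\<close> is the value of a series in the generators that uses
  only one chosen exponent for each monomial \<open>x\<^sup>ay\<^sup>b\<close>.\<close>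

lemma carrier_veronese_ring:
  assumes "d > 0"
  shows "carrier (veronese_ring d) = graded_part d 0"
proof (intro equalityI subsetI)
  fix f :: "'k::field fps fps" assume "f \<in> carrier (veronese_ring d)"
  then obtain c where c: "\<And>a b. f $ b $ a = (\<Sum>\<alpha>\<in>veronese_exponents d a b. c \<alpha>)"
    unfolding veronese_ring_def by auto
  show "f \<in> graded_part d 0"
  proof (rule graded_partI)
    fix a b assume "f $ b $ a \<noteq> 0"
    then have "veronese_exponents d a b \<noteq> {}" unfolding c by (metis sum.empty)
    then show "(a + b) mod d = 0 mod d" using degree_veronese_exponents by fastforce
  qed
next
  fix f :: "'k::field fps fps" assume f: "f \<in> graded_part d 0"
  define w where "w a b = (SOME \<alpha>. \<alpha> \<in> veronese_exponents d a b)" for a b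
  define c where "c \<alpha> = (let a = \<Sum>i\<le>d. (d - i) * \<alpha> i; b = \<Sum>i\<le>d. i * \<alpha> i in
    if \<alpha> = w a b then f $ b $ a else 0)" for \<alpha>
  have "f $ b $ a = (\<Sum>\<alpha>\<in>veronese_exponents d a b. c \<alpha>)" for a b
  proof -
    have "(\<Sum>\<alpha>\<in>veronese_exponents d a b. c \<alpha>) = (\<Sum>\<alpha>\<in>veronese_exponents d a b. if \<alpha> = w a b then f $ b $ a else 0)"
      by (intro sum.cong) (auto simp: c_def veronese_exponents_def Let_def)
    also have "\<dots> = (if w a b \<in> veronese_exponents d a b then f $ b $ a else 0)"
      using finite_veronese_exponents[OF assms] by simp
    also have "\<dots> = f $ b $ a"
    proof (cases "f $ b $ a = 0")
      case False
      then have "(a + b) mod d = 0" using graded_partD[OF f, of b a] by simp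
      then have "w a b \<in> veronese_exponents d a b"
        unfolding w_def some_in_eq by (rule veronese_exponents_nonempty[OF assms])
      then show ?thesis by simp
    qed simp
    finally show ?thesis by simp
  qed
  then have "\<exists>c. \<forall>a b. f $ b $ a = (\<Sum>\<alpha>\<in>veronese_exponents d a b. c \<alpha>)" by (intro exI allI)
  then show "f \<in> carrier (veronese_ring d)" unfolding veronese_ring_def by simp
qed

lemma veronese_ring_simps [simp]:
  "f \<otimes>\<^bsub>veronese_ring d\<^esub> g = f * g" "f \<oplus>\<^bsub>veronese_ring d\<^esub> g = f + g"
  "\<one>\<^bsub>veronese_ring d\<^esub> = 1" "\<zero>\<^bsub>veronese_ring d\<^esub> = 0"
  by (simp_all add: veronese_ring_def)

lemma cring_veronese_ring:
  assumes "d > 0"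
  shows "cring (veronese_ring d :: 'k::field fps fps ring)"
proof (rule cringI)
  note [simp] = carrier_veronese_ring[OF assms]
  show "abelian_group (veronese_ring d :: 'k fps fps ring)"
  proof (rule abelian_groupI)
    show "\<exists>y\<in>carrier (veronese_ring d). y \<oplus>\<^bsub>veronese_ring d\<^esub> x = \<zero>\<^bsub>veronese_ring d\<^esub>"
      if "x \<in> carrier (veronese_ring d)" for x :: "'k fps fps"
      using that by (auto intro!: bexI[of _ "- x"] simp: graded_part_uminus)
    fix x y z :: "'k fps fps"
    show "x \<oplus>\<^bsub>veronese_ring d\<^esub> y \<oplus>\<^bsub>veronese_ring d\<^esub> z
        = x \<oplus>\<^bsub>veronese_ring d\<^esub> (y \<oplus>\<^bsub>veronese_ring d\<^esub> z)"
      unfolding veronese_ring_simps by (rule add.assoc)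
    show "x \<oplus>\<^bsub>veronese_ring d\<^esub> y = y \<oplus>\<^bsub>veronese_ring d\<^esub> x"
      unfolding veronese_ring_simps by (rule add.commute)
  qed (simp_all add: graded_part_add)
  show "comm_monoid (veronese_ring d :: 'k fps fps ring)"
  proof (rule comm_monoidI)
    fix x y z :: "'k fps fps"
    show "x \<otimes>\<^bsub>veronese_ring d\<^esub> y \<otimes>\<^bsub>veronese_ring d\<^esub> z
        = x \<otimes>\<^bsub>veronese_ring d\<^esub> (y \<otimes>\<^bsub>veronese_ring d\<^esub> z)"
      unfolding veronese_ring_simps by (rule mult.assoc)
    show "x \<otimes>\<^bsub>veronese_ring d\<^esub> y = y \<otimes>\<^bsub>veronese_ring d\<^esub> x"
      unfolding veronese_ring_simps by (rule mult.commute)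
  qed (simp_all add: graded_part_mult_0)
  show "(x \<oplus>\<^bsub>veronese_ring d\<^esub> y) \<otimes>\<^bsub>veronese_ring d\<^esub> z
      = x \<otimes>\<^bsub>veronese_ring d\<^esub> z \<oplus>\<^bsub>veronese_ring d\<^esub> y \<otimes>\<^bsub>veronese_ring d\<^esub> z" for x y z :: "'k fps fps"
    unfolding veronese_ring_simps by (rule distrib_right)
qed

lemma ideal_veronese_ringI:
  assumes "d > 0" "I \<subseteq> graded_part d 0" "0 \<in> I"
    and "\<And>f g. f \<in> I \<Longrightarrow> g \<in> I \<Longrightarrow> f + g \<in> I"
    and "\<And>r f. r \<in> graded_part d 0 \<Longrightarrow> f \<in> I \<Longrightarrow> r * f \<in> I"
  shows "ideal I (veronese_ring d :: 'k::field fps fps ring)"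
proof -
  interpret cring "veronese_ring d :: 'k fps fps ring" by (rule cring_veronese_ring[OF assms(1)])
  have carr: "carrier (veronese_ring d :: 'k fps fps ring) = graded_part d 0"
    by (rule carrier_veronese_ring[OF assms(1)])
  show ?thesis
  proof (rule idealI)
    show "ring (veronese_ring d :: 'k fps fps ring)" by (rule ring_axioms)
    show "subgroup I (add_monoid (veronese_ring d :: 'k fps fps ring))"
    proof (rule add.subgroupI)
      fix f assume f: "f \<in> I"
      then have "- f \<in> I" using assms(5)[of "- 1" f] by (simp add: graded_part_uminus)
      moreover have "\<ominus>\<^bsub>veronese_ring d\<^esub> f = - f"
        using f assms(2) by (intro minus_equality) (auto simp: carr graded_part_uminus)
      ultimately show "\<ominus>\<^bsub>veronese_ring d\<^esub> f \<in> I" by simp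
    next
      show "I \<subseteq> carrier (veronese_ring d)" using assms(2) carr by simp
      show "I \<noteq> {}" using assms(3) by blast
      show "f \<oplus>\<^bsub>veronese_ring d\<^esub> g \<in> I" if "f \<in> I" "g \<in> I" for f g
        using assms(4)[OF that] by simp
    qed
    fix f r :: "'k fps fps" assume f: "f \<in> I" and "r \<in> carrier (veronese_ring d)"
    then have "r * f \<in> I" using assms(5) carr by blast
    then show "r \<otimes>\<^bsub>veronese_ring d\<^esub> f \<in> I" "f \<otimes>\<^bsub>veronese_ring d\<^esub> r \<in> I"
      by (simp_all only: veronese_ring_simps mult.commute[of f r])
  qed
qed

lemma ideal_veronese_ringD:
  assumes "d > 0" "ideal I (veronese_ring d :: 'k::field fps fps ring)"
  shows "I \<subseteq> graded_part d 0" "0 \<in> I" "f \<in> I \<Longrightarrow> g \<in> I \<Longrightarrow> f + g \<in> I" "f \<in> I \<Longrightarrow> g \<in> I \<Longrightarrow> f - g \<in> I"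
    "r \<in> graded_part d 0 \<Longrightarrow> f \<in> I \<Longrightarrow> r * f \<in> I"
proof -
  interpret ideal I "veronese_ring d :: 'k fps fps ring" by (rule assms(2))
  have carr: "carrier (veronese_ring d :: 'k fps fps ring) = graded_part d 0"
    by (rule carrier_veronese_ring[OF assms(1)])
  show sub: "I \<subseteq> graded_part d 0" using a_subset carr by auto
  show "0 \<in> I" using additive_subgroup.zero_closed[OF ideal.axioms(1)[OF assms(2)]] by simp
  show add: "f + g \<in> I" if "f \<in> I" "g \<in> I" for f g 
    using additive_subgroup.a_closed[OF ideal.axioms(1)[OF assms(2)] that] by (simp only: veronese_ring_simps)
  show mult: "r * f \<in> I" if "r \<in> graded_part d 0" "f \<in> I" for r f
  proof -
    have "r \<otimes>\<^bsub>veronese_ring d\<^esub> f \<in> I" by (rule I_l_closed) (use that carr in auto)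
    then show ?thesis by (simp only: veronese_ring_simps)
  qed
  show "f - g \<in> I" if "f \<in> I" "g \<in> I"
    using add[OF that(1) mult[OF graded_part_uminus[OF graded_part_1] that(2)]]
    by (simp only: mult_minus1 add_uminus_conv_diff)
qed

text \<open>The ring is local: an element with non-zero constant term is invertible.\<close>

lemma maximalideal_veronese_ring:
  assumes "d > 0" "maximalideal m (veronese_ring d :: 'k::field fps fps ring)"
  shows "m = {f \<in> graded_part d 0. f $ 0 $ 0 = 0}"
proof -
  interpret m: maximalideal m "veronese_ring d :: 'k fps fps ring" by (rule assms(2))
  have carr: "carrier (veronese_ring d :: 'k fps fps ring) = graded_part d 0"
    by (rule carrier_veronese_ring[OF assms(1)])
  let ?I = "{f \<in> graded_part d 0. f $ 0 $ 0 = (0 :: 'k)}"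
  have I: "ideal ?I (veronese_ring d)"
    by (rule ideal_veronese_ringI[OF assms(1)])
       (auto simp: graded_part_add graded_part_mult_0 fps_fps_mult_nth)
  have "m \<subseteq> ?I"
  proof
    fix f assume f: "f \<in> m"
    then have f0: "f \<in> graded_part d 0" using m.a_subset carr by auto
    have "f $ 0 $ 0 = 0"
    proof (rule ccontr)
      assume "f $ 0 $ 0 \<noteq> 0"
      then obtain g where "g \<in> graded_part d 0" "f * g = 1" using unit_if_constant_nonzero f0 by blast
      then have "1 \<in> m" using m.I_r_closed[OF f, of g] carr by simp
      then show False using m.one_imp_carrier m.I_notcarr by simp
    qed
    then show "f \<in> ?I" using f0 by simp
  qed
  moreover have "?I \<noteq> carrier (veronese_ring d)"
  proof
    assume "?I = carrier (veronese_ring d)"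
    then have "1 \<in> ?I" using carr by auto
    then show False by simp
  qed
  ultimately show ?thesis using m.I_maximal[OF I] carr by auto
qed

section \<open>Powers modulo \<open>x\<^sup>d\<close> and \<open>y\<^sup>d\<close>\<close>

lemma power_eq_power_plus_diff_mult:
  assumes "u \<in> graded_part d 0" "w \<in> graded_part d 0"
  obtains t where "t \<in> graded_part d 0" "u ^ n = w ^ n + (u - w) * t"
proof
  show "(\<Sum>i<n. w ^ (n - Suc i) * u ^ i) \<in> graded_part d 0"
    using assms by (intro graded_part_sum graded_part_mult_0 graded_part_power_0)
  show "u ^ n = w ^ n + (u - w) * (\<Sum>i<n. w ^ (n - Suc i) * u ^ i)"
    using power_diff_sumr2[of u n w] by (simp only: diff_eq_eq add.commute)
qed

lemma row_part_in: "f \<in> graded_part d j \<Longrightarrow> fps_const (f $ 0) \<in> graded_part d j"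
proof (rule graded_partI)
  fix a b assume f: "f \<in> graded_part d j" and "fps_const (f $ 0) $ b $ a \<noteq> 0"
  then have "b = 0" "f $ 0 $ a \<noteq> 0" by (auto split: if_splits)
  then show "(a + b) mod d = j mod d" using graded_partD[OF f, of 0 a] by simp
qed

text \<open>The cofactor \<open>s\<close> has degree \<open>-1\<close> modulo \<open>d\<close>, so it is in general not in \<open>R\<close>, but \<open>s\<^sup>d\<close> is.\<close>

lemma power_d_of_multiple_of_y:
  assumes "yv * s \<in> graded_part d 0"
  obtains s' where "s' \<in> graded_part d 0" "(yv * s) ^ d = yv ^ d * s'"
proof
  show *: "(yv * s) ^ d = yv ^ d * s ^ d" by (rule power_mult_distrib)
  have "yv ^ d * s ^ d \<in> graded_part d (0 + 0)" unfolding *[symmetric] using graded_part_power_0[OF assms, of d] by simp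
  moreover have "yv ^ d \<noteq> (0 :: 'a fps fps)" by simp
  ultimately show "s ^ d \<in> graded_part d 0" using graded_part_cancel[OF yv_power_d] by blast
qed

lemma xv_nonzero [simp]: "xv \<noteq> 0"
  by (simp add: xv_def)

lemma power_d_of_multiple_of_x:
  assumes "xv * s \<in> graded_part d 0"
  obtains s' where "s' \<in> graded_part d 0" "(xv * s) ^ d = xv ^ d * s'"
proof
  show *: "(xv * s) ^ d = xv ^ d * s ^ d" by (rule power_mult_distrib)
  have "xv ^ d * s ^ d \<in> graded_part d (0 + 0)" unfolding *[symmetric] using graded_part_power_0[OF assms, of d] by simp
  moreover have "xv ^ d \<noteq> (0 :: 'a fps fps)" by simp
  ultimately show "s ^ d \<in> graded_part d 0" using graded_part_cancel[OF xv_power_d] by blast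
qed

text \<open>The constant term \<open>a $ 0\<close> with respect to \<open>y\<close> is the part of \<open>a\<close> in \<open>k\<lbrakk>x\<rbrakk>\<close>; it belongs to \<open>R\<close> with \<open>a\<close>.\<close>

lemma row_power_mod_y:
  fixes a :: "'k::field fps fps"
  assumes a: "a \<in> graded_part d 0"
  obtains s where "s \<in> graded_part d 0" "(a - fps_const (a $ 0)) ^ d = yv ^ d * s"
proof -
  have eq: "a - fps_const (a $ 0) = yv * fps_shift 1 a"
    using split_constant_y[of a] by (metis add_diff_cancel_left')
  have "yv * fps_shift 1 a \<in> graded_part d 0"
    unfolding eq[symmetric] using a row_part_in graded_part_diff by blast
  then show ?thesis using that unfolding eq by (rule power_d_of_multiple_of_y)
qed

lemma power_d_mod_row:
  fixes a :: "'k::field fps fps"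
  assumes a: "a \<in> graded_part d 0"
  obtains s t where "s \<in> graded_part d 0" "t \<in> graded_part d 0" "a ^ d = yv ^ d * s + fps_const (a $ 0) * t"
proof -
  obtain s where s: "s \<in> graded_part d 0" "(a - fps_const (a $ 0)) ^ d = yv ^ d * s"
    using row_power_mod_y[OF a] .
  have "a - fps_const (a $ 0) \<in> graded_part d 0" using a row_part_in graded_part_diff by blast
  from power_eq_power_plus_diff_mult[OF a this, of d]
  obtain t where t: "t \<in> graded_part d 0" "a ^ d = (a - fps_const (a $ 0)) ^ d + (a - (a - fps_const (a $ 0))) * t" .
  have "a ^ d = yv ^ d * s + fps_const (a $ 0) * t" using t(2) unfolding s(2) by (simp only: diff_diff_eq2 add_diff_cancel_left')
  then show ?thesis using that s t by blast
qed

lemma row_power_in_ideal: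
  fixes a :: "'k::field fps fps"
  assumes a: "a \<in> graded_part d 0"
  obtains s t where "s \<in> graded_part d 0" "t \<in> graded_part d 0" "fps_const (a $ 0) ^ d = yv ^ d * s + a * t"
proof -
  let ?r = "fps_const (a $ 0)"
  obtain s where s: "s \<in> graded_part d 0" "(a - ?r) ^ d = yv ^ d * s"
    using row_power_mod_y[OF a] .
  have r: "?r \<in> graded_part d 0" using a by (rule row_part_in)
  have "?r - a \<in> graded_part d 0" using r a graded_part_diff by blast
  from power_eq_power_plus_diff_mult[OF r this, of d]
  obtain t where t: "t \<in> graded_part d 0" "?r ^ d = (?r - a) ^ d + (?r - (?r - a)) * t" .
  have "(?r - a) ^ d = (-1) ^ d * (a - ?r) ^ d"
    by (simp only: power_mult_distrib[symmetric] mult_minus1 minus_diff_eq)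
  then have "?r ^ d = yv ^ d * ((-1) ^ d * s) + a * t"
    using t(2) unfolding s(2) by (simp only: diff_diff_eq2 add_diff_cancel_left' mult.left_commute)
  moreover have "(-1) ^ d * s \<in> graded_part d 0"
    using s by (intro graded_part_mult_0 graded_part_power_0 graded_part_uminus) auto
  ultimately show ?thesis using that t by blast
qed

text \<open>The part of \<open>a\<close> in \<open>k\<lbrakk>x\<rbrakk>\<close> is a power of \<open>x\<close> times a unit, so its \<open>d\<close>-th power is a power of \<open>x\<^sup>d\<close> times a unit of
  \<open>R\<close>. Modulo \<open>y\<^sup>d\<close> that \<open>d\<close>-th power is a multiple of \<open>a\<close>.\<close>

lemma x_power_in_ideal:
  fixes a :: "'k::field fps fps"
  assumes a: "a \<in> graded_part d 0" "a $ 0 \<noteq> 0"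
  obtains e s t where "s \<in> graded_part d 0" "t \<in> graded_part d 0" "(xv ^ d) ^ e = yv ^ d * s + a * t"
proof -
  obtain s t where st: "s \<in> graded_part d 0" "t \<in> graded_part d 0" "fps_const (a $ 0) ^ d = yv ^ d * s + a * t"
    using row_power_in_ideal[OF a(1)] .
  obtain e w where w: "fps_const (a $ 0) = xv ^ e * w" "w $ 0 $ 0 \<noteq> 0"
    using factor_x_power[OF a(2)] .
  have eq: "fps_const (a $ 0) ^ d = (xv ^ d) ^ e * w ^ d"
    unfolding w(1) power_mult_distrib by (simp only: power_mult[symmetric] mult.commute)
  have "(xv ^ d) ^ e \<in> graded_part d 0" by (intro graded_part_power_0 xv_power_d)
  moreover have "(xv ^ d) ^ e * w ^ d \<in> graded_part d (0 + 0)"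
    unfolding eq[symmetric] using graded_part_power_0[OF row_part_in[OF a(1)], of d] by simp
  moreover have "(xv ^ d) ^ e \<noteq> (0 :: 'k fps fps)" by simp
  ultimately have "w ^ d \<in> graded_part d 0" using graded_part_cancel by blast
  moreover have "(w ^ d) $ 0 $ 0 \<noteq> 0" using w(2) by (simp add: fps_power_zeroth)
  ultimately obtain g where g: "g \<in> graded_part d 0" "w ^ d * g = 1" using unit_if_constant_nonzero by blast
  have "(xv ^ d) ^ e = (xv ^ d) ^ e * (w ^ d * g)" by (simp only: g(2) mult_1_right)
  also have "\<dots> = (yv ^ d * s + a * t) * g" by (simp only: mult.assoc[symmetric] eq[symmetric] st(3))
  also have "\<dots> = yv ^ d * (s * g) + a * (t * g)" by (simp only: distrib_right mult.assoc)
  finally show ?thesis using that st g graded_part_mult_0 by blast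
qed

text \<open>Write \<open>b = x s\<^sub>1 + y s\<^sub>2\<close>. The first \<open>d\<close>-th power makes the part with \<open>y\<close> a multiple of \<open>y\<^sup>d\<close>, the second the
  rest a multiple of \<open>x\<^sup>d\<close>.\<close>

lemma power_in_xy_ideal:
  fixes b :: "'k::field fps fps"
  assumes "d > 0" "b \<in> graded_part d 0" "b $ 0 $ 0 = 0"
  obtains s t where "s \<in> graded_part d 0" "t \<in> graded_part d 0" "b ^ (d * d) = xv ^ d * s + yv ^ d * t"
proof -
  have "b \<in> graded_part d (Suc (d - 1))" 
    using assms graded_part_cong[of 0 d d, where 'a = 'k] by simp
  then obtain s1 s2 where s: "s1 \<in> graded_part d (d - 1)" "s2 \<in> graded_part d (d - 1)" "b = xv * s1 + yv * s2"
    using split_xy assms(3) by blast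
  have 0: "graded_part d (1 + (d - 1)) = (graded_part d 0 :: 'k fps fps set)" using assms(1) graded_part_cong[of d d 0] by simp
  have u: "xv * s1 \<in> graded_part d 0" using graded_part_mult[OF xv_part s(1)] unfolding 0 .
  have w: "yv * s2 \<in> graded_part d 0" using graded_part_mult[OF yv_part s(2)] unfolding 0 .
  obtain t1 where t1: "t1 \<in> graded_part d 0" "b ^ d = (yv * s2) ^ d + (b - yv * s2) * t1"
    using power_eq_power_plus_diff_mult[OF assms(2) w] .
  obtain s2' where s2': "s2' \<in> graded_part d 0" "(yv * s2) ^ d = yv ^ d * s2'"
    using power_d_of_multiple_of_y[OF w] .
  have b1: "b - yv * s2 = xv * s1" using s(3) by simp
  have bd: "b ^ d = yv ^ d * s2' + xv * (s1 * t1)" using t1(2) unfolding s2'(2) b1 by (simp only: mult.assoc)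
  have ut: "xv * (s1 * t1) \<in> graded_part d 0" using graded_part_mult_0[OF u t1(1)] by (simp only: mult.assoc)
  obtain t2 where t2: "t2 \<in> graded_part d 0" "(b ^ d) ^ d = (xv * (s1 * t1)) ^ d + (b ^ d - xv * (s1 * t1)) * t2"
    using power_eq_power_plus_diff_mult[OF graded_part_power_0[OF assms(2)] ut] .
  obtain s3 where s3: "s3 \<in> graded_part d 0" "(xv * (s1 * t1)) ^ d = xv ^ d * s3"
    using power_d_of_multiple_of_x[OF ut] .
  have "b ^ (d * d) = xv ^ d * s3 + yv ^ d * (s2' * t2)"
    unfolding power_mult t2(2) s3(2) unfolding bd by (simp only: add_diff_cancel_right' mult.assoc)
  then show ?thesis using that s3 s2' t2 graded_part_mult_0 by blast
qed

section \<open>Finitely generated modules over the Veronese ring\<close>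

text \<open>The maps \<open>p : M \<rightarrow> S\<^sub>j\<close> and \<open>q : S\<^sub>j \<rightarrow> M\<close> are \<open>R\<close>-linear with \<open>p \<circ> q = id\<close>, so that
  \<open>M = q(S\<^sub>j) \<oplus> ker p\<close>. Here \<open>S\<^sub>j\<close> is the set of elements of degree \<open>j\<close> modulo \<open>d\<close>.\<close>

definition split_summand :: "nat \<Rightarrow> ('k::field fps fps, 'm) module \<Rightarrow> nat \<Rightarrow>
    ('m \<Rightarrow> 'k fps fps) \<Rightarrow> ('k fps fps \<Rightarrow> 'm) \<Rightarrow> bool" where
  "split_summand d M j p q \<longleftrightarrow> (\<forall>u\<in>carrier M. p u \<in> graded_part d j) \<and>
    (\<forall>u\<in>carrier M. \<forall>v\<in>carrier M. p (u \<oplus>\<^bsub>M\<^esub> v) = p u + p v) \<and>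
    (\<forall>r\<in>graded_part d 0. \<forall>u\<in>carrier M. p (r \<odot>\<^bsub>M\<^esub> u) = r * p u) \<and>
    (\<forall>s\<in>graded_part d j. q s \<in> carrier M) \<and>
    (\<forall>s\<in>graded_part d j. \<forall>t\<in>graded_part d j. q (s + t) = q s \<oplus>\<^bsub>M\<^esub> q t) \<and>
    (\<forall>r\<in>graded_part d 0. \<forall>s\<in>graded_part d j. q (r * s) = r \<odot>\<^bsub>M\<^esub> q s) \<and>
    (\<forall>s\<in>graded_part d j. p (q s) = s)"

locale veronese_module =
  fixes d :: nat and M :: "('k::field fps fps, 'm) module" (structure)
  assumes d_pos: "d > 0" and module_M: "Module.module (veronese_ring d) M"
begin

sublocale Module.module "veronese_ring d" M by (rule module_M)

abbreviation "C \<equiv> carrier M"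
abbreviation "G0 \<equiv> (graded_part d 0 :: 'k fps fps set)"

lemma carrR: "carrier (veronese_ring d :: 'k fps fps ring) = G0"
  by (rule carrier_veronese_ring[OF d_pos])

lemma sm_closed [simp, intro]: "r \<in> G0 \<Longrightarrow> v \<in> C \<Longrightarrow> r \<odot> v \<in> C"
  using smult_closed[of r v] unfolding carrR .

lemma sm_add: "r \<in> G0 \<Longrightarrow> s \<in> G0 \<Longrightarrow> v \<in> C \<Longrightarrow> (r + s) \<odot> v = r \<odot> v \<oplus> s \<odot> v"
  using smult_l_distr[of r s v] unfolding carrR veronese_ring_simps .

lemma sm_distr: "r \<in> G0 \<Longrightarrow> v \<in> C \<Longrightarrow> w \<in> C \<Longrightarrow> r \<odot> (v \<oplus> w) = r \<odot> v \<oplus> r \<odot> w"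
  using smult_r_distr[of r v w] unfolding carrR .

lemma sm_mult: "r \<in> G0 \<Longrightarrow> s \<in> G0 \<Longrightarrow> v \<in> C \<Longrightarrow> (r * s) \<odot> v = r \<odot> (s \<odot> v)"
  using smult_assoc1[of r s v] unfolding carrR veronese_ring_simps .

lemma sm_commute: "r \<in> G0 \<Longrightarrow> s \<in> G0 \<Longrightarrow> v \<in> C \<Longrightarrow> r \<odot> (s \<odot> v) = s \<odot> (r \<odot> v)"
  using sm_mult[of r s v] sm_mult[of s r v] by (simp only: mult.commute)

lemma sm_1 [simp]: "v \<in> C \<Longrightarrow> 1 \<odot> v = v"
  using smult_one[of v] unfolding veronese_ring_simps .

lemma sm_0 [simp]: "v \<in> C \<Longrightarrow> 0 \<odot> v = \<zero>"
  using smult_l_null[of v] unfolding veronese_ring_simps .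

lemma sm_zero [simp]: "r \<in> G0 \<Longrightarrow> r \<odot> \<zero> = \<zero>"
  using smult_r_null[of r] unfolding carrR .

lemma sm_minus: "r \<in> G0 \<Longrightarrow> v \<in> C \<Longrightarrow> r \<odot> (\<ominus> v) = \<ominus> (r \<odot> v)"
  using smult_r_minus[of r v] unfolding carrR .

lemma sm_minus_left: "r \<in> G0 \<Longrightarrow> v \<in> C \<Longrightarrow> (- r) \<odot> v = \<ominus> (r \<odot> v)"
proof -
  assume r: "r \<in> G0" and v: "v \<in> C"
  have "(- r) \<odot> v \<oplus> r \<odot> v = \<zero>" using sm_add[OF graded_part_uminus[OF r] r v] v by simp
  then show "(- r) \<odot> v = \<ominus> (r \<odot> v)"
    using M.minus_equality[of "(- r) \<odot> v" "r \<odot> v"] r v graded_part_uminus[OF r] by (simp add: sm_closed)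
qed

lemma sm_diff: "r \<in> G0 \<Longrightarrow> v \<in> C \<Longrightarrow> w \<in> C \<Longrightarrow> r \<odot> (v \<ominus> w) = r \<odot> v \<ominus> r \<odot> w"
  unfolding a_minus_def by (simp add: sm_distr sm_minus)

lemma sm_cancel_power:
  assumes "\<And>v. v \<in> C \<Longrightarrow> a \<odot> v = \<zero> \<Longrightarrow> v = \<zero>" "a \<in> G0" "v \<in> C" "a ^ n \<odot> v = \<zero>"
  shows "v = \<zero>"
  using assms(4)
proof (induction n)
  case 0 then show ?case using assms(3) by simp
next
  case (Suc n)
  then have "a \<odot> (a ^ n \<odot> v) = \<zero>" using sm_mult[OF assms(2) graded_part_power_0[OF assms(2), of n] assms(3)] by simp
  then have "a ^ n \<odot> v = \<zero>" using assms(1,2,3) graded_part_power_0 by blast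
  then show ?case by (rule Suc.IH)
qed

lemma sm_cancel:
  assumes "\<And>v. v \<in> C \<Longrightarrow> a \<odot> v = \<zero> \<Longrightarrow> v = \<zero>" "a \<in> G0" "v \<in> C" "w \<in> C" "a \<odot> v = a \<odot> w"
  shows "v = w"
proof -
  have "a \<odot> (v \<ominus> w) = \<zero>" 
    using assms(2-5) M.r_neg[of "a \<odot> w"] sm_diff[of a v w] by (simp add: a_minus_def)
  then have "v \<oplus> \<ominus> w = \<zero>" using assms(1)[of "v \<ominus> w"] assms(3,4) by (simp add: a_minus_def)
  then show ?thesis using assms(3,4) by (metis M.minus_equality M.minus_minus M.a_inv_closed M.add.m_comm)
qed

lemma finsum_sm: "finite A \<Longrightarrow> r \<in> G0 \<Longrightarrow> f \<in> A \<rightarrow> C \<Longrightarrow> r \<odot> (\<Oplus>i\<in>A. f i) = (\<Oplus>i\<in>A. r \<odot> f i)"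
  using finsum_smult_ldistr[of A r f] unfolding carrR .

definition finitely_generated :: bool where
  "finitely_generated \<longleftrightarrow> (\<exists>S\<subseteq>C. finite S \<and> linear_span (veronese_ring d) M S = C)"

lemma finite_generators:
  assumes finitely_generated
  shows "\<exists>S\<subseteq>C. finite S \<and>
    (\<forall>v\<in>C. \<exists>a. (\<forall>s. a s \<in> G0) \<and> (\<forall>s. s \<notin> S \<longrightarrow> a s = 0) \<and> v = (\<Oplus>s\<in>S. a s \<odot> s))"
proof -
  obtain S where S: "S \<subseteq> C" "finite S" "linear_span (veronese_ring d) M S = C"
    using assms unfolding finitely_generated_def by blast
  have "\<exists>a. (\<forall>s. a s \<in> G0) \<and> (\<forall>s. s \<notin> S \<longrightarrow> a s = 0) \<and> v = (\<Oplus>s\<in>S. a s \<odot> s)" if v: "v \<in> C" for v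
  proof -
    obtain F a where F: "finite F" "F \<subseteq> S" "a \<in> F \<rightarrow> G0" "v = (\<Oplus>s\<in>F. a s \<odot> s)"
      using v unfolding S(3)[symmetric] linear_span_def carrR mem_Collect_eq
      by (elim exE conjE) (rule that; assumption)
    define a' where "a' s = (if s \<in> F then a s else 0)" for s
    have a': "a' s \<in> G0" for s using F(3) by (auto simp: a'_def)
    have "(\<Oplus>s\<in>F. a s \<odot> s) = (\<Oplus>s\<in>S. a' s \<odot> s)"
    proof (rule M.add.finprod_mono_neutral_cong_left)
      show "(\<lambda>s. a' s \<odot> s) \<in> S \<rightarrow> C" using a' S(1) by blast
    qed (use F S(1,2) in \<open>auto simp: a'_def\<close>)
    then have "v = (\<Oplus>s\<in>S. a' s \<odot> s)" using F(4) by (simp only:)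
    moreover have "s \<notin> S \<longrightarrow> a' s = 0" for s using F(2) by (auto simp: a'_def)
    ultimately show ?thesis using a' by blast
  qed
  then show ?thesis using S(1,2) by (intro exI[of _ S] conjI ballI)
qed

text \<open>With respect to a finite generating set \<open>S\<close>, families of elements of \<open>M\<close> indexed by \<open>I\<close> lift to vectors
  over \<open>k\<lbrakk>x,y\<rbrakk>\<close> indexed by \<open>I \<times> S\<close>. Finitely many lifts generate the others over \<open>k\<lbrakk>x,y\<rbrakk>\<close>. As all lifts have
  entries in \<open>R\<close>, the components of degree \<open>0\<close> of the coefficients do so over \<open>R\<close>.\<close>

lemma noetherian_families:
  fixes I :: "'i set"
  assumes fg: finitely_generated and I: "finite I" and W: "\<And>w i. w \<in> W \<Longrightarrow> i \<in> I \<Longrightarrow> w i \<in> C"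
  shows "\<exists>W0\<subseteq>W. finite W0 \<and>
    (\<forall>w\<in>W. \<exists>c. (\<forall>h. c h \<in> G0) \<and> (\<forall>i\<in>I. w i = (\<Oplus>h\<in>W0. c h \<odot> h i)))"
proof -
  obtain S where S: "S \<subseteq> C" "finite S" and gen0: "\<forall>v\<in>C. \<exists>a. (\<forall>s. a s \<in> G0) \<and> (\<forall>s. s \<notin> S \<longrightarrow> a s = 0) \<and> v = (\<Oplus>s\<in>S. a s \<odot> s)"
    using finite_generators[OF fg] by (elim exE conjE) (rule that; assumption)
  note gen = bspec[OF gen0]
  define co where "co v = (SOME a. (\<forall>s. a s \<in> G0) \<and> (\<forall>s. s \<notin> S \<longrightarrow> a s = 0) \<and> v = (\<Oplus>s\<in>S. a s \<odot> s))" for v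
  have co: "co v s \<in> G0" "s \<notin> S \<Longrightarrow> co v s = 0" "v = (\<Oplus>s\<in>S. co v s \<odot> s)" if "v \<in> C" for v s
  proof -
    note co = someI_ex[OF gen[OF that], folded co_def]
    show "co v s \<in> G0" by (rule co[THEN conjunct1, THEN spec])
    show "s \<notin> S \<Longrightarrow> co v s = 0" by (rule co[THEN conjunct2, THEN conjunct1, THEN spec, THEN mp])
    show "v = (\<Oplus>s\<in>S. co v s \<odot> s)" by (rule co[THEN conjunct2, THEN conjunct2])
  qed
  define L where "L w = (\<lambda>(i, s). if i \<in> I then co (w i) s else 0)" for w
  define ev where "ev u i = (\<Oplus>s\<in>S. u (i, s) \<odot> s)" for u and i :: 'i
  have L_G0: "L w z \<in> G0" if "w \<in> W" for w z
    using co(1) W[OF that] by (cases z) (auto simp: L_def)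
  have ev_L: "ev (L w) i = w i" if "w \<in> W" "i \<in> I" for w i
    unfolding ev_def L_def using co(3)[OF W[OF that]] that(2) by simp
  have "\<exists>F\<subseteq>L ` W. finite F \<and> L ` W \<subseteq> fun_span.span F"
  proof (rule noetherian_vectors[OF _ finite_cartesian_product[OF I S(2)]])
    show "noetherian TYPE('k fps fps)"
      by (intro noetherian_fps noetherian_field)
    fix g z assume "g \<in> L ` W" "z \<notin> I \<times> S"
    then show "g z = 0" using co(2) W by (cases z) (auto simp: L_def)
  qed
  then obtain F where F: "F \<subseteq> L ` W" "finite F" "L ` W \<subseteq> fun_span.span F" by metis
  obtain W0 where W0: "W0 \<subseteq> W" "inj_on L W0" "F = L ` W0" using F(1) unfolding subset_image_inj by metis
  have fW0: "finite W0" using F(2) W0 finite_imageD by blast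
  have "\<exists>c. (\<forall>h. c h \<in> G0) \<and> (\<forall>i\<in>I. w i = (\<Oplus>h\<in>W0. c h \<odot> h i))" if w: "w \<in> W" for w
  proof -
    obtain u where u: "L w = (\<Sum>f\<in>F. (\<lambda>z. u f * f z))"
      using F(3) w unfolding fun_span.span_finite[OF F(2)] by blast
    define c where "c h = graded_proj d 0 (u (L h))" for h
    have c: "c h \<in> G0" for h by (simp add: c_def)
    have Lw: "L w z = (\<Sum>h\<in>W0. c h * L h z)" for z
    proof -
      have "L w z = (\<Sum>f\<in>F. u f * f z)" unfolding u by (induction F rule: infinite_finite_induct) simp_all
      also have "\<dots> = (\<Sum>h\<in>W0. L h z * u (L h))"
        unfolding W0(3) by (subst sum.reindex[OF W0(2)]) (simp add: mult.commute)
      finally have "graded_proj d 0 (L w z) = (\<Sum>h\<in>W0. graded_proj d 0 (L h z * u (L h)))"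
        by (simp add: graded_proj_sum)
      also have "\<dots> = (\<Sum>h\<in>W0. c h * L h z)"
      proof (rule sum.cong[OF refl])
        fix h assume "h \<in> W0"
        then have "L h z \<in> G0" using L_G0 W0(1) by blast
        then show "graded_proj d 0 (L h z * u (L h)) = c h * L h z"
          using graded_proj_mult_0[of "L h z" d 0 "u (L h)"] by (simp only: c_def mult.commute)
      qed
      finally show ?thesis using graded_proj_id[OF L_G0[OF w]] by simp
    qed
    have "ev (\<lambda>z. \<Sum>h\<in>X. c h * L h z) i = (\<Oplus>h\<in>X. c h \<odot> h i)" if "finite X" "X \<subseteq> W0" "i \<in> I" for X i
      using that(1,2)
    proof (induction X)
      case empty
      have "(\<Oplus>s\<in>S. (0 :: 'k fps fps) \<odot> s) = (\<Oplus>s\<in>S. \<zero>)"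
        by (rule M.finsum_cong') (use S in auto)
      then show ?case by (simp add: ev_def)
    next
      case (insert h X)
      have hW: "h \<in> W" and XW: "X \<subseteq> W" using insert W0(1) by auto
      have sum_G0: "(\<Sum>h\<in>X. c h * L h z) \<in> G0" for z
        by (intro graded_part_sum graded_part_mult_0 c) (use XW L_G0 in blast)
      have t_G0: "c h * L h z \<in> G0" for z using graded_part_mult_0[OF c L_G0[OF hW]] .
      have "ev (\<lambda>z. \<Sum>h\<in>insert h X. c h * L h z) i
          = (\<Oplus>s\<in>S. (c h * L h (i, s)) \<odot> s \<oplus> (\<Sum>h\<in>X. c h * L h (i, s)) \<odot> s)"
        unfolding ev_def
      proof (rule M.finsum_cong'[OF refl])
        fix s assume "s \<in> S"
        then have "s \<in> C" using S(1) by auto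
        then show "(\<Sum>h\<in>insert h X. c h * L h (i, s)) \<odot> s
            = (c h * L h (i, s)) \<odot> s \<oplus> (\<Sum>h\<in>X. c h * L h (i, s)) \<odot> s"
          using insert(1,2) sm_add[OF t_G0 sum_G0] by simp
      qed (use S(1) sum_G0 t_G0 in auto)
      also have "\<dots> = (\<Oplus>s\<in>S. (c h * L h (i, s)) \<odot> s) \<oplus> ev (\<lambda>z. \<Sum>h\<in>X. c h * L h z) i"
        unfolding ev_def by (rule M.finsum_addf) (use S(1) sum_G0 t_G0 in auto)
      also have "(\<Oplus>s\<in>S. (c h * L h (i, s)) \<odot> s) = (\<Oplus>s\<in>S. c h \<odot> (L h (i, s) \<odot> s))"
        by (rule M.finsum_cong'[OF refl]) (use S(1) c L_G0[OF hW] sm_mult in auto)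
      also have "\<dots> = c h \<odot> ev (L h) i"
        unfolding ev_def by (rule finsum_sm[symmetric]) (use S c L_G0[OF hW] in auto)
      also have "\<dots> = c h \<odot> h i" using ev_L[OF hW that(3)] by simp
      also have "ev (\<lambda>z. \<Sum>h\<in>X. c h * L h z) i = (\<Oplus>h\<in>X. c h \<odot> h i)" using insert by blast
      also have "c h \<odot> h i \<oplus> (\<Oplus>h\<in>X. c h \<odot> h i) = (\<Oplus>h\<in>insert h X. c h \<odot> h i)"
        by (rule M.finsum_insert[symmetric]) (use insert hW XW W that(3) c in auto)
      finally show ?case .
    qed
    from this[OF fW0 order_refl] have "w i = (\<Oplus>h\<in>W0. c h \<odot> h i)" if "i \<in> I" for i
      using ev_L[OF w that] that unfolding Lw[abs_def, symmetric] by simp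
    then show ?thesis using c by blast
  qed
  then show ?thesis using W0(1) fW0 by (intro exI[of _ W0] conjI ballI)
qed


text \<open>An element that can be divided by a non-unit again and again inside a Noetherian module is
  zero: the submodule generated by the successive quotients is generated by one of them.\<close>

lemma infinitely_divisible_zero:
  assumes fg: finitely_generated and c: "c \<in> G0" "c $ 0 $ 0 = 0"
    and v: "\<And>n. v n \<in> C" "\<And>n. v n = c \<odot> v (Suc n)"
  shows "v 0 = \<zero>"
proof -
  obtain W0 where W0: "W0 \<subseteq> range (\<lambda>n (i :: unit). v n)" "finite W0"
    "\<forall>w\<in>range (\<lambda>n (i :: unit). v n).
      \<exists>a. (\<forall>h. a h \<in> G0) \<and> (\<forall>i\<in>{()}. w i = (\<Oplus>h\<in>W0. a h \<odot> h i))"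
  proof -
    have "w i \<in> C" if "w \<in> range (\<lambda>n (i :: unit). v n)" for w i using that v(1) by auto
    then show ?thesis
      using noetherian_families[OF fg, of "{()}" "range (\<lambda>n (i :: unit). v n)"]
      using that by auto
  qed
  obtain K where K: "finite K" "W0 = (\<lambda>n (i :: unit). v n) ` K"
    using finite_subset_image[OF W0(2,1)] by metis
  obtain N where N: "\<And>n. n \<in> K \<Longrightarrow> n \<le> N" using K(1) finite_nat_set_iff_bounded_le by metis
  have mult: "\<exists>r\<in>G0. v n = r \<odot> v N" if "n \<le> N" for n
    using that
  proof (induction rule: inc_induct)
    case base
    show ?case using v(1) by (intro bexI[of _ 1]) auto
  next
    case (step n)
    then obtain r where r: "r \<in> G0" "v (Suc n) = r \<odot> v N" by metis
    have "v n = (c * r) \<odot> v N" using v r c by (metis sm_mult)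
    then show ?case using graded_part_mult_0[OF c(1) r(1)] by blast
  qed
  define U where "U = (\<lambda>r. r \<odot> v N) ` G0"
  have U_add: "u \<oplus> u' \<in> U" if u: "u \<in> U" "u' \<in> U" for u u'
  proof -
    obtain r r' where r: "r \<in> G0" "u = r \<odot> v N" "r' \<in> G0" "u' = r' \<odot> v N" using u unfolding U_def by auto
    then have "u \<oplus> u' = (r + r') \<odot> v N" using sm_add v(1) by simp
    then show ?thesis using graded_part_add[OF r(1,3)] unfolding U_def by blast
  qed
  have U_sm: "a \<odot> u \<in> U" if u: "u \<in> U" "a \<in> G0" for u a
  proof -
    obtain r where r: "r \<in> G0" "u = r \<odot> v N" using u unfolding U_def by auto
    then have "a \<odot> u = (a * r) \<odot> v N" using sm_mult v(1) u by simp
    then show ?thesis using graded_part_mult_0[OF u(2) r(1)] unfolding U_def by blast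
  qed
  have U_0: "\<zero> \<in> U" unfolding U_def using v(1) by (intro image_eqI[of _ _ 0]) auto
  have U_C: "U \<subseteq> C" using v(1) unfolding U_def by auto
  obtain a where a: "\<And>h. a h \<in> G0" "v (Suc N) = (\<Oplus>h\<in>W0. a h \<odot> h ())"
    using W0(3)[THEN bspec, of "\<lambda>i. v (Suc N)"] by auto
  have W0_U: "h () \<in> U" if "h \<in> W0" for h
    using that K(2) mult N unfolding U_def by fastforce
  have "(\<Oplus>h\<in>X. a h \<odot> h ()) \<in> U" if "finite X" "X \<subseteq> W0" for X
    using that
  proof (induction X)
    case empty then show ?case using U_0 by simp
  next
    case (insert h X)
    have "(\<lambda>h. a h \<odot> h ()) \<in> X \<rightarrow> C" "a h \<odot> h () \<in> C" using insert(4) a(1) W0_U U_C by blast+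
    then have "(\<Oplus>h\<in>insert h X. a h \<odot> h ()) = a h \<odot> h () \<oplus> (\<Oplus>h\<in>X. a h \<odot> h ())"
      using insert(1,2) by (intro M.finsum_insert)
    moreover have "a h \<odot> h () \<in> U" using insert(4) a(1) W0_U U_sm by blast
    ultimately show ?case using U_add insert by simp
  qed
  from this[OF W0(2) order_refl] obtain r where r: "r \<in> G0" "v (Suc N) = r \<odot> v N"
    unfolding a(2)[symmetric] U_def by auto
  have rc: "r * c \<in> G0" using r(1) c(1) by (rule graded_part_mult_0)
  have "1 - r * c \<in> G0" using rc by (intro graded_part_diff) auto
  moreover have "(1 - r * c) $ 0 $ 0 \<noteq> 0" using c(2) by (simp add: fps_fps_mult_nth)
  ultimately obtain g where g: "g \<in> G0" "(1 - r * c) * g = 1" using unit_if_constant_nonzero by blast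
  have "(r * c) \<odot> v (Suc N) = v (Suc N)" using r v(1) v(2)[of N] c(1) sm_mult by simp
  then have "(1 - r * c) \<odot> v (Suc N) = \<zero>"
    using sm_add[OF graded_part_1 graded_part_uminus[OF rc] v(1)[of "Suc N"]] sm_minus_left[OF rc v(1)[of "Suc N"]]
      M.r_neg[OF v(1)[of "Suc N"]] v(1)[of "Suc N"] by simp
  then have "g \<odot> ((1 - r * c) \<odot> v (Suc N)) = \<zero>" using g by simp
  then have "v (Suc N) = \<zero>"
    using sm_mult[OF g(1) \<open>1 - r * c \<in> G0\<close> v(1)[of "Suc N"]] g(2) v(1)[of "Suc N"] by (simp add: mult.commute)
  then have "v N = \<zero>" using v(2)[of N] c(1) by simp
  then show ?thesis using mult[of 0] by auto
qed

section \<open>From a regular pair to the regular pair \<open>y\<^sup>d, x\<^sup>d\<close>\<close>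

definition regular_pair :: "'k fps fps \<Rightarrow> 'k fps fps \<Rightarrow> bool" where
  "regular_pair a b \<longleftrightarrow> a \<in> G0 \<and> b \<in> G0 \<and> a $ 0 $ 0 = 0 \<and> b $ 0 $ 0 = 0 \<and>
     (\<forall>v\<in>C. a \<odot> v = \<zero> \<longrightarrow> v = \<zero>) \<and> (\<forall>v\<in>C. \<forall>w\<in>C. b \<odot> v = a \<odot> w \<longrightarrow> (\<exists>u\<in>C. v = a \<odot> u))"

context
  fixes a b
  assumes fg: finitely_generated and reg: "regular_pair a b"
begin

lemma ab: "a \<in> G0" "b \<in> G0" "a $ 0 $ 0 = 0" "b $ 0 $ 0 = 0"
  and a_regular: "v \<in> C \<Longrightarrow> a \<odot> v = \<zero> \<Longrightarrow> v = \<zero>"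
  using reg unfolding regular_pair_def by simp_all

lemma b_regular: "v \<in> C \<Longrightarrow> w \<in> C \<Longrightarrow> b \<odot> v = a \<odot> w \<Longrightarrow> \<exists>u\<in>C. v = a \<odot> u"
proof -
  have "\<forall>v\<in>C. \<forall>w\<in>C. b \<odot> v = a \<odot> w \<longrightarrow> (\<exists>u\<in>C. v = a \<odot> u)"
    using reg unfolding regular_pair_def by (elim conjE)
  then show "v \<in> C \<Longrightarrow> w \<in> C \<Longrightarrow> b \<odot> v = a \<odot> w \<Longrightarrow> \<exists>u\<in>C. v = a \<odot> u" by blast
qed

lemma b_regular_power:
  assumes "v \<in> C" "w \<in> C" "b ^ n \<odot> v = a ^ k \<odot> w"
  shows "\<exists>u\<in>C. v = a ^ k \<odot> u"
proof -
  have one: "\<exists>u\<in>C. v = a ^ k \<odot> u" if "v \<in> C" "w \<in> C" "b \<odot> v = a ^ k \<odot> w" for v w k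
    using that
  proof (induction k arbitrary: v w)
    case 0
    then show ?case by (intro bexI[of _ v]) auto
  next
    case (Suc k)
    have "b \<odot> v = a \<odot> (a ^ k \<odot> w)"
      using Suc.prems sm_mult[OF ab(1) graded_part_power_0[OF ab(1), of k] Suc.prems(2)] by simp
    from b_regular[OF Suc.prems(1) sm_closed[OF graded_part_power_0[OF ab(1)] Suc.prems(2)] this]
    obtain v' where v': "v' \<in> C" "v = a \<odot> v'" by blast
    have "a \<odot> (b \<odot> v') = a \<odot> (a ^ k \<odot> w)"
      using \<open>b \<odot> v = a \<odot> (a ^ k \<odot> w)\<close> v' ab sm_commute by simp
    then have "b \<odot> v' = a ^ k \<odot> w"
      using sm_cancel[OF a_regular ab(1)] v' Suc.prems ab graded_part_power_0[OF ab(1)] by blast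
    then obtain u where u: "u \<in> C" "v' = a ^ k \<odot> u" using Suc.IH v' Suc.prems by blast
    then have "v = a ^ Suc k \<odot> u" using v' sm_mult[OF ab(1) graded_part_power_0[OF ab(1), of k] u(1)] by simp
    then show ?case using u by blast
  qed
  show ?thesis using assms
  proof (induction n arbitrary: v w)
    case 0
    then show ?case by auto
  next
    case (Suc n)
    have "b \<odot> (b ^ n \<odot> v) = a ^ k \<odot> w"
      using Suc.prems sm_mult[OF ab(2) graded_part_power_0[OF ab(2), of n] Suc.prems(1)] by simp
    from one[OF sm_closed[OF graded_part_power_0[OF ab(2)] Suc.prems(1)] Suc.prems(2) this]
    obtain u where u: "u \<in> C" "b ^ n \<odot> v = a ^ k \<odot> u" by blast
    show ?case by (rule Suc.IH[OF Suc.prems(1) u])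
  qed
qed

text \<open>The submodule \<open>N\<close> killed by \<open>y\<^sup>d\<close> satisfies \<open>N = a N\<close>: modulo \<open>y\<^sup>d\<close>, powers of \<open>b\<close> are multiples
  of \<open>x\<^sup>d\<close>, and \<open>x\<^sup>d\<close> has a power divisible by \<open>a\<close>, so \<open>b\<close>-powers push \<open>N\<close> into \<open>a M\<close>.\<close>

lemma yd_regular:
  assumes v: "v \<in> C" "yv ^ d \<odot> v = \<zero>"
  shows "v = \<zero>"
proof -
  have kill: "(r + yv ^ d * s) \<odot> v = r \<odot> v" "(yv ^ d * s + r) \<odot> v = r \<odot> v"
    if "v \<in> C" "yv ^ d \<odot> v = \<zero>" "s \<in> G0" "r \<in> G0" for r s v
  proof -
    have ys: "yv ^ d * s \<in> G0" using that(3) by (intro graded_part_mult_0) auto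
    have "(yv ^ d * s) \<odot> v = \<zero>"
      using sm_mult[OF that(3) yv_power_d that(1)] that by (simp add: mult.commute)
    then show "(r + yv ^ d * s) \<odot> v = r \<odot> v" "(yv ^ d * s + r) \<odot> v = r \<odot> v"
      using sm_add[OF that(4) ys that(1)] that by (simp_all add: add.commute)
  qed
  show ?thesis
  proof (cases "a $ 0 = 0")
    case True
    obtain s t where st: "s \<in> G0" "t \<in> G0" "a ^ d = yv ^ d * s + fps_const (a $ 0) * t"
      using power_d_mod_row[OF ab(1)] .
    \<comment> \<open>Here \<open>a\<close> is nilpotent modulo \<open>y\<^sup>d\<close>.\<close>
    have "a ^ d \<odot> v = \<zero>" using kill(2)[OF v st(1), of 0] v True unfolding st(3) by simp
    then show ?thesis using sm_cancel_power[OF a_regular ab(1) v(1)] by blast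
  next
    case False
    obtain e s t where st: "s \<in> G0" "t \<in> G0" "(xv ^ d) ^ e = yv ^ d * s + a * t"
      using x_power_in_ideal[OF ab(1) False] .
    obtain s' t' where st': "s' \<in> G0" "t' \<in> G0" "b ^ (d * d) = xv ^ d * s' + yv ^ d * t'"
      using power_in_xy_ideal[OF d_pos ab(2,4)] .
    have step: "\<exists>w\<in>C. yv ^ d \<odot> w = \<zero> \<and> v = a \<odot> w" if v: "v \<in> C" "yv ^ d \<odot> v = \<zero>" for v
    proof -
      have xs: "xv ^ d * s' \<in> G0" using st' by (intro graded_part_mult_0) auto
      have "(b ^ (d * d)) ^ n \<odot> v = (xv ^ d * s') ^ n \<odot> v" for n
      proof (induction n)
        case (Suc n)
        have xsn: "(xv ^ d * s') ^ n \<in> G0" and bn: "(b ^ (d * d)) ^ n \<in> G0" and b1: "b ^ (d * d) \<in> G0"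
          using graded_part_power_0 xs ab(2) by blast+
        have "(b ^ (d * d)) ^ Suc n \<odot> v = b ^ (d * d) \<odot> ((xv ^ d * s') ^ n \<odot> v)"
          using sm_mult[OF b1 bn v(1)] Suc by simp
        also have "\<dots> = (xv ^ d * s') ^ n \<odot> (b ^ (d * d) \<odot> v)" using sm_commute[OF b1 xsn v(1)] .
        also have "b ^ (d * d) \<odot> v = (xv ^ d * s') \<odot> v" unfolding st'(3) using kill(1)[OF v st'(2) xs] .
        also have "(xv ^ d * s') ^ n \<odot> ((xv ^ d * s') \<odot> v) = (xv ^ d * s') ^ Suc n \<odot> v"
          using sm_mult[OF xs xsn v(1)] sm_commute[OF xs xsn v(1)] by simp
        finally show ?case .
      qed simp
      from this[of e] have "b ^ (d * d * e) \<odot> v = ((xv ^ d) ^ e * s' ^ e) \<odot> v"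
        by (simp only: power_mult power_mult_distrib)
      also have "\<dots> = s' ^ e \<odot> ((xv ^ d) ^ e \<odot> v)"
        using sm_mult[OF graded_part_power_0[OF st'(1)] graded_part_power_0[OF xv_power_d] v(1), of e e]
        by (simp only: mult.commute)
      also have "(xv ^ d) ^ e \<odot> v = (a * t) \<odot> v" unfolding st(3) using kill(2)[OF v st(1) graded_part_mult_0[OF ab(1) st(2)]] .
      also have "\<dots> = a \<odot> (t \<odot> v)" using sm_mult[OF ab(1) st(2) v(1)] .
      also have "s' ^ e \<odot> (a \<odot> (t \<odot> v)) = a ^ 1 \<odot> (s' ^ e \<odot> (t \<odot> v))"
        using sm_commute[OF graded_part_power_0[OF st'(1)] ab(1) sm_closed[OF st(2) v(1)]] by simp
      finally have eq: "b ^ (d * d * e) \<odot> v = a ^ 1 \<odot> (s' ^ e \<odot> (t \<odot> v))" .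
      have "s' ^ e \<odot> (t \<odot> v) \<in> C" using graded_part_power_0[OF st'(1)] st(2) v(1) by simp
      from b_regular_power[OF v(1) this eq] obtain w where w: "w \<in> C" "v = a \<odot> w" by auto
      have "a \<odot> (yv ^ d \<odot> w) = \<zero>" using v(2) w sm_commute[OF ab(1) yv_power_d w(1)] by simp
      then have "yv ^ d \<odot> w = \<zero>" using a_regular w(1) yv_power_d by blast
      then show ?thesis using w by blast
    qed
    have "\<exists>f. \<forall>n. (f n \<in> C \<and> yv ^ d \<odot> f n = \<zero> \<and> (n = 0 \<longrightarrow> f n = v)) \<and> f n = a \<odot> f (Suc n)"
      by (rule dependent_nat_choice) (use v step in auto)
    then obtain f where f: "\<forall>n. (f n \<in> C \<and> yv ^ d \<odot> f n = \<zero> \<and> (n = 0 \<longrightarrow> f n = v)) \<and> f n = a \<odot> f (Suc n)"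
      by (elim exE)
    have "f 0 = \<zero>"
    proof (rule infinitely_divisible_zero[OF fg ab(1,3)])
      show "f n \<in> C" for n by (rule f[THEN spec, THEN conjunct1, THEN conjunct1])
      show "f n = a \<odot> f (Suc n)" for n by (rule f[THEN spec, THEN conjunct2])
    qed
    moreover have "f 0 = v" using f[THEN spec, of 0] by (elim conjE) simp
    ultimately show ?thesis by simp
  qed
qed

text \<open>If \<open>x\<^sup>d v \<in> y\<^sup>d M\<close>, then some power of the maximal ideal moves \<open>v\<close> into \<open>y\<^sup>d M\<close>; comparing what
  powers of \<open>a\<close> and \<open>b\<close> do gives \<open>v \<in> y\<^sup>d M\<close>.\<close>

lemma xd_regular_mod_yd:
  assumes v: "v \<in> C" "w \<in> C" "xv ^ d \<odot> v = yv ^ d \<odot> w"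
  shows "\<exists>u\<in>C. v = yv ^ d \<odot> u"
proof -
  have into: "\<exists>u\<in>C. c ^ (d * d) \<odot> v = yv ^ d \<odot> u" if c: "c \<in> G0" "c $ 0 $ 0 = 0" for c
  proof -
    obtain s t where st: "s \<in> G0" "t \<in> G0" "c ^ (d * d) = xv ^ d * s + yv ^ d * t"
      using power_in_xy_ideal[OF d_pos c] .
    have xs: "xv ^ d * s \<in> G0" and yt: "yv ^ d * t \<in> G0" using st by (intro graded_part_mult_0; simp)+
    have "(xv ^ d * s) \<odot> v = s \<odot> (yv ^ d \<odot> w)"
      using sm_mult[OF xv_power_d st(1) v(1)] sm_commute[OF xv_power_d st(1) v(1)] v(3) by simp
    also have "\<dots> = yv ^ d \<odot> (s \<odot> w)" using sm_commute[OF st(1) yv_power_d v(2)] .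
    finally have "c ^ (d * d) \<odot> v = yv ^ d \<odot> (s \<odot> w) \<oplus> yv ^ d \<odot> (t \<odot> v)"
      unfolding st(3) using sm_add[OF xs yt v(1)] sm_mult[OF yv_power_d st(2) v(1)] by simp
    also have "\<dots> = yv ^ d \<odot> (s \<odot> w \<oplus> t \<odot> v)" using sm_distr st v by simp
    finally show ?thesis using st v by blast
  qed
  obtain w1 where w1: "w1 \<in> C" "a ^ (d * d) \<odot> v = yv ^ d \<odot> w1" using into ab by blast
  obtain w2 where w2: "w2 \<in> C" "b ^ (d * d) \<odot> v = yv ^ d \<odot> w2" using into ab by blast
  have pa: "a ^ (d * d) \<in> G0" and pb: "b ^ (d * d) \<in> G0" using ab graded_part_power_0 by blast+
  have "yv ^ d \<odot> (b ^ (d * d) \<odot> w1) = b ^ (d * d) \<odot> (a ^ (d * d) \<odot> v)"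
    using sm_commute[OF yv_power_d pb w1(1)] w1(2) by simp
  also have "\<dots> = a ^ (d * d) \<odot> (b ^ (d * d) \<odot> v)" using sm_commute[OF pb pa v(1)] .
  also have "\<dots> = yv ^ d \<odot> (a ^ (d * d) \<odot> w2)" using sm_commute[OF yv_power_d pa w2(1)] w2(2) by simp
  finally have "b ^ (d * d) \<odot> w1 = a ^ (d * d) \<odot> w2"
    using sm_cancel[OF yd_regular yv_power_d] pa pb w1(1) w2(1) by blast
  from b_regular_power[OF w1(1) w2(1) this] obtain u where u: "u \<in> C" "w1 = a ^ (d * d) \<odot> u" by blast
  have "a ^ (d * d) \<odot> v = a ^ (d * d) \<odot> (yv ^ d \<odot> u)"
    using w1(2) u sm_commute[OF yv_power_d pa u(1)] by simp
  then have "v = yv ^ d \<odot> u"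
  proof (rule sm_cancel[rotated -1])
    show "v' = \<zero>" if "v' \<in> C" "a ^ (d * d) \<odot> v' = \<zero>" for v'
      using sm_cancel_power[OF a_regular ab(1) that] by blast
  qed (use v(1) u(1) pa in auto)
  then show ?thesis using u by blast
qed

end

end

section \<open>A basis of \<open>Hom\<^sub>R(k\<lbrakk>x,y\<rbrakk>, M)\<close>\<close>

context veronese_module
begin

text \<open>The product of \<open>s\<close> and \<open>\<phi>\<close> in this \<open>k\<lbrakk>x,y\<rbrakk>\<close>-module is \<open>\<lambda>t. \<phi> (s * t)\<close>.\<close>

definition hom_space :: "('k fps fps \<Rightarrow> 'm) set" where
  "hom_space = {\<phi>. (\<forall>t. \<phi> t \<in> C) \<and> (\<forall>t t'. \<phi> (t + t') = \<phi> t \<oplus> \<phi> t') \<and>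
     (\<forall>r\<in>G0. \<forall>t. \<phi> (r * t) = r \<odot> \<phi> t)}"

lemma homI:
  assumes "\<And>t. \<phi> t \<in> C" "\<And>t t'. \<phi> (t + t') = \<phi> t \<oplus> \<phi> t'" "\<And>r t. r \<in> G0 \<Longrightarrow> \<phi> (r * t) = r \<odot> \<phi> t"
  shows "\<phi> \<in> hom_space"
  using assms unfolding hom_space_def by blast

lemma hom_closed [simp, intro]: "\<phi> \<in> hom_space \<Longrightarrow> \<phi> t \<in> C"
  unfolding hom_space_def by blast

lemma hom_add: "\<phi> \<in> hom_space \<Longrightarrow> \<phi> (t + t') = \<phi> t \<oplus> \<phi> t'"
  unfolding hom_space_def by blast

lemma hom_sm: "\<phi> \<in> hom_space \<Longrightarrow> r \<in> G0 \<Longrightarrow> \<phi> (r * t) = r \<odot> \<phi> t"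
  unfolding hom_space_def by blast

lemma hom_0 [simp]: "\<phi> \<in> hom_space \<Longrightarrow> \<phi> 0 = \<zero>"
  using hom_sm[of \<phi> 0 0] by simp

lemma hom_minus: "\<phi> \<in> hom_space \<Longrightarrow> \<phi> (- t) = \<ominus> \<phi> t"
  using hom_sm[of \<phi> "- 1" t] sm_minus_left[of 1 "\<phi> t"] by (simp add: graded_part_uminus)

lemma hom_sum: "\<phi> \<in> hom_space \<Longrightarrow> \<phi> (\<Sum>i\<in>A. f i) = (\<Oplus>i\<in>A. \<phi> (f i))"
proof (induction A rule: infinite_finite_induct)
  case (insert x F)
  then show ?case by (simp add: hom_add Pi_def)
qed simp_all

lemma hom_scale: "\<phi> \<in> hom_space \<Longrightarrow> (\<lambda>t. \<phi> (s * t)) \<in> hom_space"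
  by (rule homI) (simp_all add: distrib_left hom_add hom_sm mult.left_commute[of s])

lemma hom_plus:
  assumes "\<phi> \<in> hom_space" "\<psi> \<in> hom_space"
  shows "(\<lambda>t. \<phi> t \<oplus> \<psi> t) \<in> hom_space"
proof (rule homI)
  fix t t'
  show "\<phi> (t + t') \<oplus> \<psi> (t + t') = \<phi> t \<oplus> \<psi> t \<oplus> (\<phi> t' \<oplus> \<psi> t')"
    using assms by (simp add: hom_add M.a_ac)
qed (use assms in \<open>simp_all add: hom_sm sm_distr\<close>)

lemma hom_zero: "(\<lambda>t. \<zero>) \<in> hom_space"
  by (rule homI) simp_all

lemma hom_finsum:
  assumes "\<And>i. i \<in> A \<Longrightarrow> f i \<in> hom_space"
  shows "(\<lambda>t. \<Oplus>i\<in>A. f i t) \<in> hom_space"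
  using assms
proof (induction A rule: infinite_finite_induct)
  case (insert x F)
  have "(\<lambda>t. \<Oplus>i\<in>insert x F. f i t) = (\<lambda>t. f x t \<oplus> (\<Oplus>i\<in>F. f i t))"
    by (rule ext, rule M.finsum_insert) (use insert in auto)
  then show ?case using hom_plus[of "f x" "\<lambda>t. \<Oplus>i\<in>F. f i t"] insert by simp
qed (simp_all add: hom_zero)

lemma hom_graded: "\<phi> \<in> hom_space \<Longrightarrow> (\<lambda>t. \<phi> (graded_proj d j t)) \<in> hom_space"
  by (rule homI) (simp_all add: hom_add hom_sm graded_proj_add graded_proj_mult_0)

text \<open>The ring \<open>k\<lbrakk>x,y\<rbrakk>\<close> is generated over \<open>R\<close> by the monomials \<open>x\<^sup>a y\<^sup>b\<close> with \<open>a + b < d\<close>.\<close>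

lemma hom_eqI:
  assumes \<phi>: "\<phi> \<in> hom_space" and \<psi>: "\<psi> \<in> hom_space"
    and eq: "\<And>a b. a < d \<Longrightarrow> b < d \<Longrightarrow> \<phi> (xv ^ a * yv ^ b) = \<psi> (xv ^ a * yv ^ b)"
  shows "\<phi> t = \<psi> t"
proof -
  have part: "\<phi> (xv ^ a * yv ^ b * s) = \<psi> (xv ^ a * yv ^ b * s)" if "s \<in> graded_part d j" "a + b + j < d" for s a b j
    using that
  proof (induction j arbitrary: s a b)
    case 0
    have "\<phi> (s * (xv ^ a * yv ^ b)) = \<psi> (s * (xv ^ a * yv ^ b))"
      using hom_sm[OF \<phi> 0(1)] hom_sm[OF \<psi> 0(1)] eq[of a b] 0(2) by simp
    then show ?case by (simp only: mult.commute)
  next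
    case (Suc j)
    have "s $ 0 $ 0 = 0"
      using graded_partD[OF Suc.prems(1), of 0 0] Suc.prems(2) by force
    then obtain s' s'' where s: "s' \<in> graded_part d j" "s'' \<in> graded_part d j" "s = xv * s' + yv * s''"
      using split_xy[OF Suc.prems(1)] by blast
    have eq: "xv ^ a * yv ^ b * s = xv ^ Suc a * yv ^ b * s' + xv ^ a * yv ^ Suc b * s''"
      unfolding s(3) by (simp only: distrib_left power_Suc mult_ac)
    show ?case unfolding eq hom_add[OF \<phi>] hom_add[OF \<psi>]
      using Suc.IH[OF s(1), of "Suc a" b] Suc.IH[OF s(2), of a "Suc b"] Suc.prems(2) by simp
  qed
  have "\<phi> (graded_proj d j t) = \<psi> (graded_proj d j t)" if "j < d" for j
    using part[of "graded_proj d j t" j 0 0] that by simp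
  then have "(\<Oplus>j\<in>{..<d}. \<phi> (graded_proj d j t)) = (\<Oplus>j\<in>{..<d}. \<psi> (graded_proj d j t))"
    using \<psi> by (intro M.finsum_cong') auto
  then show ?thesis
    unfolding hom_sum[OF \<phi>, symmetric] hom_sum[OF \<psi>, symmetric] sum_graded_proj[OF d_pos] .
qed

definition lin_comb :: "('k fps fps \<Rightarrow> 'm) set \<Rightarrow> (('k fps fps \<Rightarrow> 'm) \<Rightarrow> 'k fps fps) \<Rightarrow> 'k fps fps \<Rightarrow> 'm" where
  "lin_comb E s t = (\<Oplus>e\<in>E. e (s e * t))"

lemma lin_comb_hom: "E \<subseteq> hom_space \<Longrightarrow> lin_comb E s \<in> hom_space"
  unfolding lin_comb_def[abs_def] by (rule hom_finsum) (use hom_scale in blast)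

lemma lin_comb_add:
  assumes "E \<subseteq> hom_space"
  shows "lin_comb E (\<lambda>e. s e + s' e) t = lin_comb E s t \<oplus> lin_comb E s' t"
proof -
  have "lin_comb E (\<lambda>e. s e + s' e) t = (\<Oplus>e\<in>E. e (s e * t) \<oplus> e (s' e * t))"
    unfolding lin_comb_def using assms by (intro M.finsum_cong') (auto simp: distrib_right hom_add)
  also have "\<dots> = lin_comb E s t \<oplus> lin_comb E s' t"
    unfolding lin_comb_def using assms by (intro M.finsum_addf) auto
  finally show ?thesis .
qed

lemma lin_comb_mult: "lin_comb E (\<lambda>e. r * s e) t = lin_comb E s (r * t)"
  unfolding lin_comb_def by (simp only: mult.assoc mult.left_commute)

lemma lin_comb_minus:
  assumes "E \<subseteq> hom_space"
  shows "lin_comb E (\<lambda>e. - s e) t = \<ominus> lin_comb E s t"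
  using lin_comb_mult[of E "- 1" s t] hom_minus[OF lin_comb_hom[OF assms], of s t] by simp

lemma lin_comb_0:
  assumes "E \<subseteq> hom_space"
  shows "lin_comb E (\<lambda>e. 0) t = \<zero>"
  using lin_comb_mult[of E 0 "\<lambda>e. 0" t] hom_0[OF lin_comb_hom[OF assms]] by simp

lemma lin_comb_single:
  assumes "E \<subseteq> hom_space" "finite E" "e0 \<in> E"
  shows "lin_comb E (\<lambda>e. if e = e0 then r else 0) t = e0 (r * t)"
proof -
  have "lin_comb E (\<lambda>e. if e = e0 then r else 0) t = (\<Oplus>e\<in>E. if e0 = e then e (r * t) else \<zero>)"
    unfolding lin_comb_def using assms by (intro M.finsum_cong') auto
  also have "\<dots> = e0 (r * t)"
    using assms by (intro M.finsum_singleton) auto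
  finally show ?thesis .
qed

definition generates :: "('k fps fps \<Rightarrow> 'm) set \<Rightarrow> bool" where
  "generates E \<longleftrightarrow> (\<forall>\<phi>\<in>hom_space. \<exists>s. \<phi> = lin_comb E s)"

text \<open>The maps that factor through the component of degree \<open>j\<close>. Multiplication by an element of degree \<open>i\<close> turns them
  into maps that factor through the component of degree \<open>j - i\<close>.\<close>

definition homogeneous :: "nat \<Rightarrow> ('k fps fps \<Rightarrow> 'm) \<Rightarrow> bool" where
  "homogeneous j \<phi> \<longleftrightarrow> \<phi> \<in> hom_space \<and> (\<forall>t. \<phi> (graded_proj d j t) = \<phi> t)"

definition comb_span :: "('k fps fps \<Rightarrow> 'm) set \<Rightarrow> ('k fps fps \<Rightarrow> 'm) set" where
  "comb_span E = range (lin_comb E)"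

lemma comb_span_plus:
  assumes "E \<subseteq> hom_space" "\<phi> \<in> comb_span E" "\<psi> \<in> comb_span E"
  shows "(\<lambda>t. \<phi> t \<oplus> \<psi> t) \<in> comb_span E"
proof -
  obtain s s' where "\<phi> = lin_comb E s" "\<psi> = lin_comb E s'" using assms unfolding comb_span_def by blast
  then have "(\<lambda>t. \<phi> t \<oplus> \<psi> t) = lin_comb E (\<lambda>e. s e + s' e)"
    using lin_comb_add[OF assms(1)] by (simp add: fun_eq_iff)
  then show ?thesis unfolding comb_span_def by blast
qed

lemma comb_span_scale:
  assumes "\<phi> \<in> comb_span E"
  shows "(\<lambda>t. \<phi> (r * t)) \<in> comb_span E"
proof -
  obtain s where "\<phi> = lin_comb E s" using assms unfolding comb_span_def by blast
  then have "(\<lambda>t. \<phi> (r * t)) = lin_comb E (\<lambda>e. r * s e)" using lin_comb_mult by (simp add: fun_eq_iff)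
  then show ?thesis unfolding comb_span_def by blast
qed

lemma comb_span_zero: "E \<subseteq> hom_space \<Longrightarrow> (\<lambda>t. \<zero>) \<in> comb_span E"
  using lin_comb_0 unfolding comb_span_def by (intro image_eqI[of _ _ "\<lambda>e. 0"]) (auto simp: fun_eq_iff)

lemma comb_span_base:
  assumes "E \<subseteq> hom_space" "finite E" "e \<in> E"
  shows "e \<in> comb_span E"
  using lin_comb_single[OF assms, of 1] unfolding comb_span_def
  by (intro image_eqI[of _ _ "\<lambda>e'. if e' = e then 1 else 0"]) (auto simp: fun_eq_iff)

lemma comb_span_hom: "E \<subseteq> hom_space \<Longrightarrow> comb_span E \<subseteq> hom_space"
  unfolding comb_span_def using lin_comb_hom by blast

lemma comb_span_finsum:
  assumes "E \<subseteq> hom_space" "\<And>i. i \<in> A \<Longrightarrow> f i \<in> comb_span E"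
  shows "(\<lambda>t. \<Oplus>i\<in>A. f i t) \<in> comb_span E"
  using assms(2)
proof (induction A rule: infinite_finite_induct)
  case (insert x F)
  have hom: "f i \<in> hom_space" if "i \<in> insert x F" for i using insert(4)[OF that] comb_span_hom[OF assms(1)] by blast
  have "(\<lambda>t. \<Oplus>i\<in>insert x F. f i t) = (\<lambda>t. f x t \<oplus> (\<Oplus>i\<in>F. f i t))"
    by (rule ext, rule M.finsum_insert) (use insert(1,2) hom in auto)
  then show ?case using comb_span_plus[OF assms(1), of "f x" "\<lambda>t. \<Oplus>i\<in>F. f i t"] insert by simp
qed (simp_all add: comb_span_zero[OF assms(1)])

lemma generates_iff: "generates E \<longleftrightarrow> hom_space \<subseteq> comb_span E"
  unfolding generates_def comb_span_def by blast

lemma comb_span_trans: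
  assumes "E \<subseteq> hom_space" "E' \<subseteq> comb_span E"
  shows "comb_span E' \<subseteq> comb_span E"
proof
  fix \<phi> assume "\<phi> \<in> comb_span E'"
  then obtain s where s: "\<phi> = lin_comb E' s" unfolding comb_span_def by blast
  show "\<phi> \<in> comb_span E" unfolding s lin_comb_def[abs_def]
    by (rule comb_span_finsum[OF assms(1)], rule comb_span_scale) (use assms(2) in blast)
qed

text \<open>By the Noetherian property finitely many maps generate \<open>Hom\<^sub>R(k\<lbrakk>x,y\<rbrakk>, M)\<close>, and so do
  their homogeneous components.\<close>

lemma finite_homogeneous_generators:
  assumes fg: finitely_generated
  shows "\<exists>E. finite E \<and> E \<subseteq> {e. \<exists>j<d. homogeneous j e} \<and> generates E"
proof -
  define ev where "ev \<phi> = (\<lambda>(a, b). \<phi> (xv ^ a * yv ^ b))" for \<phi> :: "'k fps fps \<Rightarrow> 'm"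
  obtain W0 where W0: "W0 \<subseteq> ev ` hom_space" "finite W0"
    and gen: "\<forall>w\<in>ev ` hom_space. \<exists>c. (\<forall>h. c h \<in> G0) \<and> (\<forall>i\<in>{..<d} \<times> {..<d}. w i = (\<Oplus>h\<in>W0. c h \<odot> h i))"
  proof -
    have "\<exists>W0\<subseteq>ev ` hom_space. finite W0 \<and>
      (\<forall>w\<in>ev ` hom_space. \<exists>c. (\<forall>h. c h \<in> G0) \<and> (\<forall>i\<in>{..<d} \<times> {..<d}. w i = (\<Oplus>h\<in>W0. c h \<odot> h i)))"
    proof (rule noetherian_families[OF fg])
      show "finite ({..<d} \<times> {..<d})" by simp
      show "w i \<in> C" if "w \<in> ev ` hom_space" for w i using that by (cases i) (auto simp: ev_def)
    qed
    then show thesis by (elim exE conjE) (rule that)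
  qed
  obtain P where P: "P \<subseteq> hom_space" "inj_on ev P" "W0 = ev ` P" using W0(1) unfolding subset_image_inj by metis
  have fP: "finite P" using W0(2) P finite_imageD by blast
  define E where "E = (\<lambda>(j, \<phi>) t. \<phi> (graded_proj d j t)) ` ({..<d} \<times> P)"
  have E_hom: "E \<subseteq> hom_space" unfolding E_def using P(1) hom_graded by auto
  have fE: "finite E" unfolding E_def using fP by simp
  have P_E: "\<phi> \<in> comb_span E" if "\<phi> \<in> P" for \<phi>
  proof -
    have \<phi>: "\<phi> \<in> hom_space" using that P by blast
    have "\<phi> t = (\<Oplus>j\<in>{..<d}. \<phi> (graded_proj d j t))" for t
      unfolding hom_sum[OF \<phi>, symmetric] sum_graded_proj[OF d_pos] ..
    then have "\<phi> = (\<lambda>t. \<Oplus>j\<in>{..<d}. \<phi> (graded_proj d j t))" by (rule ext)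
    moreover have "(\<lambda>t. \<Oplus>j\<in>{..<d}. \<phi> (graded_proj d j t)) \<in> comb_span E"
    proof (rule comb_span_finsum[OF E_hom])
      fix j assume "j \<in> {..<d}"
      then have "(\<lambda>t. \<phi> (graded_proj d j t)) \<in> E" unfolding E_def using that by (intro image_eqI[of _ _ "(j, \<phi>)"]) auto
      then show "(\<lambda>t. \<phi> (graded_proj d j t)) \<in> comb_span E" by (rule comb_span_base[OF E_hom fE])
    qed
    ultimately show ?thesis by (simp only:)
  qed
  have "hom_space \<subseteq> comb_span E"
  proof
    fix \<phi> assume \<phi>: "\<phi> \<in> hom_space"
    obtain c where c: "\<And>h. c h \<in> G0" "\<And>i. i \<in> {..<d} \<times> {..<d} \<Longrightarrow> ev \<phi> i = (\<Oplus>h\<in>W0. c h \<odot> h i)"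
      using bspec[OF gen imageI[OF \<phi>]] by (elim exE conjE) (rule that, erule spec, erule bspec)
    define \<psi> where "\<psi> t = (\<Oplus>\<theta>\<in>P. \<theta> (c (ev \<theta>) * t))" for t
    have "\<psi> \<in> comb_span E" unfolding \<psi>_def[abs_def]
      by (rule comb_span_finsum[OF E_hom], rule comb_span_scale, rule P_E)
    moreover have "\<phi> t = \<psi> t" for t
    proof (rule hom_eqI[OF \<phi>])
      show "\<psi> \<in> hom_space" using calculation comb_span_hom[OF E_hom] by blast
      fix a b assume ab: "a < d" "b < d"
      have "\<phi> (xv ^ a * yv ^ b) = (\<Oplus>h\<in>ev ` P. c h \<odot> h (a, b))"
        using c(2)[of "(a, b)"] ab unfolding P(3) by (simp add: ev_def)
      also have "\<dots> = (\<Oplus>\<theta>\<in>P. c (ev \<theta>) \<odot> ev \<theta> (a, b))"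
        by (rule M.finsum_reindex) (use P c(1) in \<open>auto simp: ev_def\<close>)
      also have "\<dots> = \<psi> (xv ^ a * yv ^ b)" unfolding \<psi>_def
        by (rule M.finsum_cong'[OF refl]) (use P c(1) hom_sm in \<open>auto simp: ev_def\<close>)
      finally show "\<phi> (xv ^ a * yv ^ b) = \<psi> (xv ^ a * yv ^ b)" .
    qed
    ultimately show "\<phi> \<in> comb_span E" by (metis ext)
  qed
  moreover have "\<exists>j<d. homogeneous j e" if e_E: "e \<in> E" for e
  proof -
    obtain j \<phi> where e: "j < d" "\<phi> \<in> P" "e = (\<lambda>t. \<phi> (graded_proj d j t))"
      using e_E unfolding E_def by auto
    have "homogeneous j e"
      unfolding homogeneous_def using e_E E_hom by (auto simp: e(3) graded_proj_id)
    then show ?thesis using e by blast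
  qed
  ultimately show ?thesis using fE unfolding generates_iff by blast
qed

end

context veronese_module
begin

context
  assumes fg: finitely_generated
    and y_reg: "\<And>v. v \<in> C \<Longrightarrow> yv ^ d \<odot> v = \<zero> \<Longrightarrow> v = \<zero>"
    and x_reg: "\<And>v w. v \<in> C \<Longrightarrow> w \<in> C \<Longrightarrow> xv ^ d \<odot> v = yv ^ d \<odot> w \<Longrightarrow> \<exists>u\<in>C. v = yv ^ d \<odot> u"
begin

lemma power_d_split: "z ^ d * t = z * (z ^ (d - 1) * t)" for z t :: "'k fps fps"
  using d_pos by (cases d) (simp_all add: mult_ac)

text \<open>\<open>y \<phi> = 0\<close> implies \<open>y\<^sup>d \<phi>(t) = (y \<phi>)(y\<^sup>d\<^sup>-\<^sup>1 t) = 0\<close>.\<close>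

lemma hom_y_regular:
  assumes \<phi>: "\<phi> \<in> hom_space" and "\<And>t. \<phi> (yv * t) = \<zero>"
  shows "\<phi> t = \<zero>"
proof (rule y_reg)
  show "yv ^ d \<odot> \<phi> t = \<zero>"
    unfolding hom_sm[OF \<phi> yv_power_d, symmetric] power_d_split by (rule assms(2))
qed (use \<phi> in auto)

text \<open>If \<open>x \<phi> = y \<psi>\<close>, then \<open>x\<^sup>d \<phi>(y\<^sup>d\<^sup>-\<^sup>1 t) = y\<^sup>d \<psi>(x\<^sup>d\<^sup>-\<^sup>1 t)\<close>, so that \<open>\<phi>(y\<^sup>d\<^sup>-\<^sup>1 t)\<close> is divisible by \<open>y\<^sup>d\<close> in \<open>M\<close>. The
  quotient is the value at \<open>t\<close> of the map \<open>\<chi>\<close> with \<open>\<phi> = y \<chi>\<close>.\<close>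

lemma hom_x_regular_mod_y:
  assumes \<phi>: "\<phi> \<in> hom_space" and \<psi>: "\<psi> \<in> hom_space" and eq: "\<And>t. \<phi> (xv * t) = \<psi> (yv * t)"
  shows "\<exists>\<chi>\<in>hom_space. \<forall>t. \<phi> t = \<chi> (yv * t)"
proof -
  have ex: "\<exists>u\<in>C. \<phi> (yv ^ (d - 1) * t) = yv ^ d \<odot> u" for t
  proof (rule x_reg)
    have "xv ^ d \<odot> \<phi> (yv ^ (d - 1) * t) = \<phi> (xv * (xv ^ (d - 1) * (yv ^ (d - 1) * t)))"
      unfolding hom_sm[OF \<phi> xv_power_d, symmetric] power_d_split ..
    also have "\<dots> = \<psi> (yv * (yv ^ (d - 1) * (xv ^ (d - 1) * t)))"
      unfolding eq by (simp only: mult.left_commute)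
    also have "\<dots> = yv ^ d \<odot> \<psi> (xv ^ (d - 1) * t)"
      unfolding hom_sm[OF \<psi> yv_power_d, symmetric] power_d_split ..
    finally show "xv ^ d \<odot> \<phi> (yv ^ (d - 1) * t) = yv ^ d \<odot> \<psi> (xv ^ (d - 1) * t)" .
  qed (use \<phi> \<psi> in auto)
  define \<chi> where "\<chi> t = (SOME u. u \<in> C \<and> \<phi> (yv ^ (d - 1) * t) = yv ^ d \<odot> u)" for t
  have \<chi>: "\<chi> t \<in> C" "\<phi> (yv ^ (d - 1) * t) = yv ^ d \<odot> \<chi> t" for t
  proof -
    have "\<exists>u. u \<in> C \<and> \<phi> (yv ^ (d - 1) * t) = yv ^ d \<odot> u" using ex[of t] by blast
    note * = someI_ex[OF this, folded \<chi>_def]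
    show "\<chi> t \<in> C" by (rule *[THEN conjunct1])
    show "\<phi> (yv ^ (d - 1) * t) = yv ^ d \<odot> \<chi> t" by (rule *[THEN conjunct2])
  qed
  have cancel: "u = w" if "u \<in> C" "w \<in> C" "yv ^ d \<odot> u = yv ^ d \<odot> w" for u w
    by (rule sm_cancel[OF y_reg yv_power_d that])
  have "\<chi> \<in> hom_space"
  proof (rule homI)
    show "\<chi> t \<in> C" for t by (rule \<chi>(1))
    show "\<chi> (t + t') = \<chi> t \<oplus> \<chi> t'" for t t'
    proof (rule cancel)
      show "yv ^ d \<odot> \<chi> (t + t') = yv ^ d \<odot> (\<chi> t \<oplus> \<chi> t')"
        unfolding sm_distr[OF yv_power_d \<chi>(1) \<chi>(1)] \<chi>(2)[symmetric] distrib_left hom_add[OF \<phi>] ..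
    qed (use \<chi>(1) in auto)
    show "\<chi> (r * t) = r \<odot> \<chi> t" if r: "r \<in> G0" for r t
    proof (rule cancel)
      show "yv ^ d \<odot> \<chi> (r * t) = yv ^ d \<odot> (r \<odot> \<chi> t)"
        unfolding sm_commute[OF yv_power_d r \<chi>(1)] \<chi>(2)[symmetric] hom_sm[OF \<phi> r, symmetric]
        by (simp only: mult.left_commute)
    qed (use \<chi>(1) r in auto)
  qed
  moreover have "\<phi> t = \<chi> (yv * t)" for t
  proof (rule cancel)
    show "yv ^ d \<odot> \<phi> t = yv ^ d \<odot> \<chi> (yv * t)"
      unfolding \<chi>(2)[symmetric] hom_sm[OF \<phi> yv_power_d, symmetric] power_d_split by (simp only: mult.left_commute)
  qed (use \<chi>(1) \<phi> in auto)
  ultimately show ?thesis by blast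
qed

text \<open>As over a local ring, a homogeneous generating set of minimal size has no relation with a unit coefficient.
  Regularity of \<open>y, x\<close> strengthens this to independence over \<open>k\<lbrakk>x,y\<rbrakk>\<close>.\<close>

context
  fixes E
  assumes fE: "finite E" and hE: "E \<subseteq> {e. \<exists>j<d. homogeneous j e}" and gE: "generates E"
    and min: "\<And>E'. finite E' \<Longrightarrow> E' \<subseteq> {e. \<exists>j<d. homogeneous j e} \<Longrightarrow> generates E' \<Longrightarrow> card E \<le> card E'"
begin

lemma E_hom: "E \<subseteq> hom_space"
  using hE unfolding homogeneous_def by blast

text \<open>A coefficient that is a unit would make its generator redundant.\<close>

lemma no_unit_coefficient:
  assumes s: "\<And>t. lin_comb E s t = \<chi> (yv * t)" and \<chi>: "\<chi> \<in> hom_space" and e0: "e0 \<in> E"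
  shows "s e0 $ 0 $ 0 = 0"
proof (rule ccontr)
  assume ne: "s e0 $ 0 $ 0 \<noteq> 0"
  obtain u where u: "\<chi> = lin_comb E u" using gE \<chi> unfolding generates_def by blast
  define w where "w e = s e + - (yv * u e)" for e
  have w0: "lin_comb E w t = \<zero>" for t
  proof -
    have "lin_comb E w t = lin_comb E s t \<oplus> \<ominus> lin_comb E u (yv * t)"
      unfolding w_def[abs_def] lin_comb_add[OF E_hom] lin_comb_minus[OF E_hom] lin_comb_mult ..
    then show ?thesis unfolding s u using lin_comb_hom[OF E_hom] by (simp add: M.r_neg)
  qed
  have wne: "w e0 $ 0 \<noteq> 0" "w e0 $ 0 $ 0 \<noteq> 0" using ne by (auto simp: w_def)
  then have "w e0 $ 0 * inverse (w e0 $ 0) = 1" by (simp add: inverse_mult_eq_1')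
  then obtain g where g: "w e0 * g = 1" using fps_right_inverse by blast
  let ?F = "E - {e0}"
  have F_hom: "?F \<subseteq> hom_space" using E_hom by blast
  have "e0 t = lin_comb ?F (\<lambda>e. - (g * w e)) t" for t
  proof -
    have "\<zero> = lin_comb E w (g * t)" using w0 by simp
    also have "\<dots> = e0 (w e0 * (g * t)) \<oplus> lin_comb ?F w (g * t)"
      unfolding lin_comb_def using fE e0 E_hom
      by (subst insert_Diff[OF e0, symmetric], subst M.finsum_insert) auto
    also have "w e0 * (g * t) = t" using g by (simp only: mult.assoc[symmetric] mult_1)
    finally have "e0 t \<oplus> lin_comb ?F w (g * t) = \<zero>" by simp
    then have "e0 t = \<ominus> lin_comb ?F w (g * t)"
      using M.minus_equality[of "e0 t" "lin_comb ?F w (g * t)"] e0 E_hom lin_comb_hom[OF F_hom] by auto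
    then show ?thesis unfolding lin_comb_minus[OF F_hom] lin_comb_mult .
  qed
  then have eq: "lin_comb ?F (\<lambda>e. - (g * w e)) = e0" by (intro ext) (rule sym)
  have "lin_comb ?F (\<lambda>e. - (g * w e)) \<in> comb_span ?F" unfolding comb_span_def by (rule rangeI)
  then have "e0 \<in> comb_span ?F" unfolding eq .
  moreover have "e \<in> comb_span ?F" if "e \<in> ?F" for e
    by (rule comb_span_base[OF F_hom _ that]) (use fE in simp)
  ultimately have "E \<subseteq> comb_span ?F" by blast
  then have "generates ?F" using gE comb_span_trans[OF F_hom] unfolding generates_iff by blast
  then have "card E \<le> card ?F" using fE hE by (intro min) auto
  then show False using fE e0 by (metis card_Diff1_less not_le)
qed

text \<open>Without unit coefficients, \<open>s\<^sub>e = x s'\<^sub>e + y s''\<^sub>e\<close>, and a combination with coefficients \<open>s\<^sub>e\<close> that is divisible by \<open>y\<close>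
  yields one with coefficients \<open>s'\<^sub>e\<close> by regularity. So the part of \<open>s\<^sub>e\<close> in \<open>k\<lbrakk>x\<rbrakk>\<close> vanishes to every order.\<close>

lemma coefficients_divisible_by_y:
  assumes "\<chi> \<in> hom_space" "\<And>t. lin_comb E s t = \<chi> (yv * t)" "e \<in> E"
  shows "s e $ 0 $ n = 0"
  using assms
proof (induction n arbitrary: s \<chi> e)
  case 0
  then show ?case using no_unit_coefficient by blast
next
  case (Suc n)
  let ?s' = "\<lambda>e. fps_const (fps_shift 1 (s e $ 0))" and ?s'' = "\<lambda>e. fps_shift 1 (s e)"
  have split: "s e = xv * ?s' e + yv * ?s'' e" if "e \<in> E" for e
  proof -
    have "s e $ 0 $ 0 = 0" using no_unit_coefficient[OF Suc.prems(2,1) that] .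
    then have "s e $ 0 = fps_X * fps_shift 1 (s e $ 0)" by (intro fps_ext) auto
    then show ?thesis using split_constant_y[of "s e"] by (simp only: fps_const_mult xv_def)
  qed
  define \<chi>' where "\<chi>' t = \<chi> t \<oplus> lin_comb E (\<lambda>e. - ?s'' e) t" for t
  have \<chi>': "\<chi>' \<in> hom_space" unfolding \<chi>'_def[abs_def] by (rule hom_plus[OF Suc.prems(1) lin_comb_hom[OF E_hom]])
  have "lin_comb E ?s' (xv * t) = \<chi>' (yv * t)" for t
  proof -
    have "\<chi> (yv * t) = lin_comb E (\<lambda>e. xv * ?s' e + yv * ?s'' e) t"
      unfolding Suc.prems(2)[symmetric] lin_comb_def using E_hom split
      by (intro M.finsum_cong') auto
    also have "\<dots> = lin_comb E ?s' (xv * t) \<oplus> lin_comb E ?s'' (yv * t)"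
      unfolding lin_comb_add[OF E_hom] lin_comb_mult ..
    finally show ?thesis unfolding \<chi>'_def lin_comb_minus[OF E_hom]
      using lin_comb_hom[OF E_hom] by (simp add: M.a_assoc M.r_neg)
  qed
  from hom_x_regular_mod_y[OF lin_comb_hom[OF E_hom] \<chi>' this]
  obtain \<chi>'' where "\<chi>'' \<in> hom_space" "\<And>t. lin_comb E ?s' t = \<chi>'' (yv * t)" by blast
  then have "?s' e $ 0 $ n = 0" using Suc.IH Suc.prems(3) by blast
  then show ?case by simp
qed

lemma independent:
  assumes "\<And>t. lin_comb E s t = \<zero>" "e \<in> E"
  shows "s e = 0"
proof -
  have "s e $ n = 0" for n
    using assms
  proof (induction n arbitrary: s e)
    case 0
    show ?case by (rule fps_ext) (use coefficients_divisible_by_y[OF hom_zero 0] in simp)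
  next
    case (Suc n)
    have "s e = yv * fps_shift 1 (s e)" if "e \<in> E" for e
    proof -
      have "s e $ 0 = 0" by (rule fps_ext) (use coefficients_divisible_by_y[OF hom_zero Suc.prems(1) that] in simp)
      then show ?thesis using split_constant_y[of "s e"] by simp
    qed
    then have "lin_comb E s t = lin_comb E (\<lambda>e. yv * fps_shift 1 (s e)) t" for t
      unfolding lin_comb_def using E_hom by (intro M.finsum_cong') auto
    then have "lin_comb E (\<lambda>e. fps_shift 1 (s e)) (yv * t) = \<zero>" for t
      using Suc.prems(1) lin_comb_mult by simp
    then have "lin_comb E (\<lambda>e. fps_shift 1 (s e)) t = \<zero>" for t
      using hom_y_regular[OF lin_comb_hom[OF E_hom]] by blast
    then show ?case using Suc.IH[of "\<lambda>e. fps_shift 1 (s e)" e] Suc.prems(2) by simp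
  qed
  then show ?thesis by (intro fps_ext) simp
qed

lemma coefficients_unique:
  assumes "\<And>t. lin_comb E s t = lin_comb E s' t" "e \<in> E"
  shows "s e = s' e"
proof -
  have "lin_comb E (\<lambda>e. s e + - s' e) t = \<zero>" for t
    unfolding lin_comb_add[OF E_hom] lin_comb_minus[OF E_hom] assms(1)
    using lin_comb_hom[OF E_hom] by (simp add: M.r_neg)
  from independent[OF this assms(2)] show ?thesis by simp
qed

text \<open>An element \<open>u\<close> of \<open>M\<close> corresponds to the map \<open>\<Phi> u\<close> of degree \<open>0\<close> with \<open>\<Phi> u 1 = u\<close>. The projection takes its
  coefficient at \<open>e0\<close>, and the section sends \<open>s\<close> to \<open>e0 s\<close>, the element that corresponds to \<open>s e0\<close>.\<close>

lemma split_surjection_from_basis: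
  assumes e0: "e0 \<in> E" and j0: "homogeneous j0 e0"
  shows "\<exists>p q. split_summand d M j0 p q"
proof -
  define \<Phi> where "\<Phi> u t = graded_proj d 0 t \<odot> u" for u t
  have \<Phi>: "\<Phi> u \<in> hom_space" if "u \<in> C" for u
    by (rule homI) (use that in \<open>simp_all add: \<Phi>_def graded_proj_add graded_proj_mult_0 sm_add sm_mult\<close>)
  define S where "S u = (SOME s. \<Phi> u = lin_comb E s)" for u
  have S: "\<Phi> u t = lin_comb E (S u) t" if "u \<in> C" for u t
  proof -
    have "\<exists>s. \<Phi> u = lin_comb E s" using gE \<Phi>[OF that] unfolding generates_def by blast
    from someI_ex[OF this, folded S_def] show ?thesis by (rule fun_cong)
  qed
  have hom0: "e0 \<in> hom_space" using e0 E_hom by blast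
  have deg: "e (graded_proj d j t) = e t" if "homogeneous j e" for j e t using that unfolding homogeneous_def by blast
  \<comment> \<open>Replacing every coefficient by its component in the degree of its generator represents the same map of
    degree \<open>0\<close>, so uniqueness shows that the coefficients are homogeneous.\<close>
  have 1: "S u e0 \<in> graded_part d j0" if u: "u \<in> C" for u
  proof -
    define D where "D e = (if e = e0 then j0 else (SOME j. homogeneous j e))" for e
    have D: "homogeneous (D e) e" if "e \<in> E" for e
    proof (cases "e = e0")
      case False
      have ex: "\<exists>j. homogeneous j e" using that hE by blast
      show ?thesis unfolding D_def if_not_P[OF False] by (rule someI_ex[OF ex])
    qed (simp add: D_def j0)
    have "lin_comb E (S u) t = lin_comb E (\<lambda>e. graded_proj d (D e) (S u e)) t" for t
    proof -
      have "\<Phi> u t = \<Phi> u (graded_proj d 0 t)" by (simp add: \<Phi>_def graded_proj_id)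
      then have "lin_comb E (S u) t = lin_comb E (S u) (graded_proj d 0 t)" using S[OF u] by simp
      also have "\<dots> = lin_comb E (\<lambda>e. graded_proj d (D e) (S u e)) t"
        unfolding lin_comb_def
      proof (rule M.finsum_cong'[OF refl])
        fix e assume e: "e \<in> E"
        let ?g = "graded_proj d (D e) (S u e)"
        have "e (S u e * graded_proj d 0 t) = e (graded_proj d (D e) (graded_proj d 0 t * S u e))"
          unfolding deg[OF D[OF e]] by (simp only: mult.commute)
        also have "\<dots> = e (?g * graded_proj d 0 t)"
          unfolding graded_proj_mult_0[OF graded_proj_in] by (simp only: mult.commute)
        also have "\<dots> = e (graded_proj d (D e + 0) (?g * t))"
          unfolding graded_proj_mult[OF graded_proj_in] ..
        also have "\<dots> = e (?g * t)" using deg[OF D[OF e]] by simp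
        finally show "e (S u e * graded_proj d 0 t) = e (?g * t)" .
      qed (use E_hom in auto)
      finally show ?thesis .
    qed
    from coefficients_unique[OF this e0] have "S u e0 = graded_proj d j0 (S u e0)" by (simp add: D_def)
    then show ?thesis by (metis graded_proj_in)
  qed
  have 2: "S (u \<oplus> v) e0 = S u e0 + S v e0" if uv: "u \<in> C" "v \<in> C" for u v
  proof (rule coefficients_unique[OF _ e0])
    show "lin_comb E (S (u \<oplus> v)) t = lin_comb E (\<lambda>e. S u e + S v e) t" for t
      unfolding lin_comb_add[OF E_hom] S[OF uv(1), symmetric] S[OF uv(2), symmetric]
      using uv S[of "u \<oplus> v"] by (simp add: \<Phi>_def sm_distr)
  qed
  have 3: "S (r \<odot> u) e0 = r * S u e0" if ru: "r \<in> G0" "u \<in> C" for r u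
  proof (rule coefficients_unique[OF _ e0])
    show "lin_comb E (S (r \<odot> u)) t = lin_comb E (\<lambda>e. r * S u e) t" for t
      unfolding lin_comb_mult S[OF ru(2), symmetric] S[OF sm_closed[OF ru], symmetric] \<Phi>_def
      unfolding graded_proj_mult_0[OF ru(1)] using sm_mult[OF ru(1) _ ru(2)] sm_commute[OF ru(1) _ ru(2)] by simp
  qed
  have 4: "S (e0 s) e0 = s" if s: "s \<in> graded_part d j0" for s
  proof -
    have "lin_comb E (S (e0 s)) t = lin_comb E (\<lambda>e. if e = e0 then s else 0) t" for t
    proof -
      have "lin_comb E (S (e0 s)) t = e0 (graded_proj d 0 t * s)"
        using S[of "e0 s" t] hom_sm[OF hom0, of "graded_proj d 0 t" s] hom0 by (simp add: \<Phi>_def)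
      also have "\<dots> = e0 (graded_proj d (j0 + 0) (s * t))"
        unfolding graded_proj_mult[OF s] by (simp only: mult.commute)
      also have "\<dots> = e0 (s * t)" using deg[OF j0] by simp
      also have "\<dots> = lin_comb E (\<lambda>e. if e = e0 then s else 0) t" using lin_comb_single[OF E_hom fE e0] by simp
      finally show ?thesis .
    qed
    from coefficients_unique[OF this e0] show ?thesis by simp
  qed
  show ?thesis unfolding split_summand_def
    by (rule exI[of _ "\<lambda>u. S u e0"], rule exI[of _ e0])
       (use 1 2 3 4 hom0 hom_add[OF hom0] hom_sm[OF hom0] in auto)
qed

end

lemma split_surjection:
  assumes nz: "C \<noteq> {\<zero>}"
  shows "\<exists>j<d. \<exists>p q. split_summand d M j p q"
proof -
  let ?P = "\<lambda>E. finite E \<and> E \<subseteq> {e. \<exists>j<d. homogeneous j e} \<and> generates E"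
  obtain E0 where "?P E0" using finite_homogeneous_generators[OF fg] by (elim exE)
  from ex_has_least_nat[of ?P, OF this, of card]
  obtain E where E: "?P E" "\<forall>E'. ?P E' \<longrightarrow> card E \<le> card E'" by (elim exE conjE) (rule that; blast)
  have "E \<noteq> {}"
  proof
    assume "E = {}"
    then have *: "\<phi> = (\<lambda>t. \<zero>)" if "\<phi> \<in> hom_space" for \<phi>
      using E(1) that unfolding generates_def lin_comb_def[abs_def] by auto
    have "u = \<zero>" if u: "u \<in> C" for u
    proof -
      have "(\<lambda>t. graded_proj d 0 t \<odot> u) \<in> hom_space"
        by (rule homI) (use u in \<open>simp_all add: graded_proj_add graded_proj_mult_0 sm_add sm_mult\<close>)
      from fun_cong[OF *[OF this], of 1] show ?thesis using u by (simp add: graded_proj_id)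
    qed
    then show False using nz by auto
  qed
  then obtain e0 where e0: "e0 \<in> E" by blast
  then obtain j where j: "j < d" "homogeneous j e0" using E(1) by blast
  show ?thesis
    by (rule exI[of _ j], rule conjI[OF j(1)], rule split_surjection_from_basis[OF _ _ _ _ e0 j(2)])
       (use E in blast)+
qed

end

end

section \<open>Functionals and the test ideal\<close>

lemma keys_diff_subset:
  "Poly_Mapping.keys u \<subseteq> S \<Longrightarrow> Poly_Mapping.keys v \<subseteq> S \<Longrightarrow> Poly_Mapping.keys (u - v :: 'a \<Rightarrow>\<^sub>0 int) \<subseteq> S"
  using keys_diff[of u v] by blast

locale tensor_factors = M: Module.module R M + B: Module.module R B
  for R :: "('r, 'a) ring_scheme" and M :: "('r, 'm, 'c) module_scheme" and B :: "('r, 'b, 'e) module_scheme"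
begin

abbreviation "FG \<equiv> free_Abelian_group (carrier M \<times> carrier B)"
abbreviation "T \<equiv> tensor_relations R M B"
abbreviation "tensor \<equiv> simple_tensor R M B"

lemma tensor_relations_subgroup: "subgroup T FG"
  unfolding tensor_relations_def
  by (rule group.generate_is_subgroup[OF group_free_Abelian_group])
     (intro Un_least subsetI; elim CollectE exE conjE; simp only: carrier_free_Abelian_group_iff;
      intro keys_diff_subset; simp)

lemma tensor_relations_normal: "T \<lhd> FG"
  by (rule comm_group.subgroup_imp_normal[OF abelian_free_Abelian_group tensor_relations_subgroup])

lemma tensor_relations_carrier: "T \<subseteq> carrier FG"
  by (rule subgroup.subset[OF tensor_relations_subgroup])

lemma coset_eqI:
  assumes "u \<in> carrier FG" "v \<in> carrier FG" "v - u \<in> T"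
  shows "T #>\<^bsub>FG\<^esub> u = T #>\<^bsub>FG\<^esub> v"
proof (rule group.repr_independence[OF group_free_Abelian_group])
  show "v \<in> T #>\<^bsub>FG\<^esub> u" unfolding r_coset_def using assms(3) by (auto intro!: bexI[of _ "v - u"])
qed (use assms tensor_relations_subgroup in auto)

lemma tensor_in_carrier:
  assumes "u \<in> carrier FG"
  shows "T #>\<^bsub>FG\<^esub> u \<in> carrier (tensor_product R M B)"
  unfolding tensor_product_def FactGroup_def using assms
  by (simp add: group.rcosetsI[OF group_free_Abelian_group tensor_relations_carrier])

lemma tensor_add_left:
  assumes "x \<in> carrier M" "x' \<in> carrier M" "b \<in> carrier B"
  shows "tensor (x \<oplus>\<^bsub>M\<^esub> x') b = tensor x b \<otimes>\<^bsub>tensor_product R M B\<^esub> tensor x' b"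
proof -
  have f: "frag_of (x, b) \<in> carrier FG" "frag_of (x', b) \<in> carrier FG" "frag_of (x \<oplus>\<^bsub>M\<^esub> x', b) \<in> carrier FG"
    using assms by auto
  have "frag_of (x \<oplus>\<^bsub>M\<^esub> x', b) - frag_of (x, b) - frag_of (x', b) \<in> T"
    unfolding tensor_relations_def by (rule generate.incl) (use assms in blast)
  then have "frag_of (x \<oplus>\<^bsub>M\<^esub> x', b) - (frag_of (x, b) + frag_of (x', b)) \<in> T" by (simp only: diff_diff_eq)
  moreover have "frag_of (x, b) + frag_of (x', b) \<in> carrier FG"
    using monoid.m_closed[OF group.is_monoid[OF group_free_Abelian_group] f(1,2)]
    by (simp only: mult_free_Abelian_group)
  ultimately have "T #>\<^bsub>FG\<^esub> (frag_of (x, b) + frag_of (x', b)) = T #>\<^bsub>FG\<^esub> frag_of (x \<oplus>\<^bsub>M\<^esub> x', b)"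
    using f by (intro coset_eqI)
  then show ?thesis
    unfolding simple_tensor_def tensor_product_def mult_FactGroup
      normal.rcos_sum[OF tensor_relations_normal f(1,2)] mult_free_Abelian_group by (rule sym)
qed

lemma tensor_move_scalar:
  assumes "r \<in> carrier R" "x \<in> carrier M" "b \<in> carrier B"
  shows "tensor (r \<odot>\<^bsub>M\<^esub> x) b = tensor x (r \<odot>\<^bsub>B\<^esub> b)"
proof -
  have "frag_of (r \<odot>\<^bsub>M\<^esub> x, b) - frag_of (x, r \<odot>\<^bsub>B\<^esub> b) \<in> T"
    unfolding tensor_relations_def by (rule generate.incl) (use assms in blast)
  then have "T #>\<^bsub>FG\<^esub> frag_of (x, r \<odot>\<^bsub>B\<^esub> b) = T #>\<^bsub>FG\<^esub> frag_of (r \<odot>\<^bsub>M\<^esub> x, b)"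
    using assms by (intro coset_eqI) auto
  then show ?thesis unfolding simple_tensor_def by (rule sym)
qed

text \<open>A functional \<open>f : M \<rightarrow> R\<close> induces \<open>f \<otimes> B : M \<otimes> B \<rightarrow> B\<close>, which sends \<open>x \<otimes> b\<close> to \<open>f x b\<close> and the image
  of \<open>M \<otimes> A\<close> into \<open>A\<close>.\<close>

lemma functional_closure:
  assumes f: "\<And>x. x \<in> carrier M \<Longrightarrow> f x \<in> carrier R"
    and f_add: "\<And>x x'. x \<in> carrier M \<Longrightarrow> x' \<in> carrier M \<Longrightarrow> f (x \<oplus>\<^bsub>M\<^esub> x') = f x \<oplus>\<^bsub>R\<^esub> f x'"
    and f_smult: "\<And>r x. r \<in> carrier R \<Longrightarrow> x \<in> carrier M \<Longrightarrow> f (r \<odot>\<^bsub>M\<^esub> x) = r \<otimes>\<^bsub>R\<^esub> f x"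
    and A: "submodule A R B" and b: "b \<in> module_closure R M A B" and v: "v \<in> carrier M"
  shows "f v \<odot>\<^bsub>B\<^esub> b \<in> A"
proof -
  have bB: "b \<in> carrier B" using b unfolding module_closure_def by blast
  have "(\<lambda>(x, b). f x \<odot>\<^bsub>B\<^esub> b) ` (carrier M \<times> carrier B) \<subseteq> carrier (add_monoid B)" using f by auto
  from comm_group.free_Abelian_group_universal[OF B.a_comm_group this]
  obtain h where h: "h \<in> hom FG (add_monoid B)"
    and h_frag0: "\<And>z. z \<in> carrier M \<times> carrier B \<Longrightarrow> h (frag_of z) = (case z of (x, b) \<Rightarrow> f x \<odot>\<^bsub>B\<^esub> b)" by blast
  have h_frag: "h (frag_of (x, b)) = f x \<odot>\<^bsub>B\<^esub> b" if "x \<in> carrier M" "b \<in> carrier B" for x b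
    using h_frag0[of "(x, b)"] that by simp
  interpret h: group_hom FG "add_monoid B" h
    using h B.a_comm_group unfolding group_hom_def group_hom_axioms_def comm_group_def by simp
  have h_add: "h (u + w) = h u \<oplus>\<^bsub>B\<^esub> h w" if "u \<in> carrier FG" "w \<in> carrier FG" for u w
    using h.hom_mult[OF that] by simp
  have h_closed: "h u \<in> carrier B" if "u \<in> carrier FG" for u
    using h.hom_closed[OF that] by simp
  have h_minus: "h (- u) = \<ominus>\<^bsub>B\<^esub> h u" if "u \<in> carrier FG" for u
    using h.hom_inv[OF that] that by (simp add: a_inv_def)
  have carrier_minus: "- u \<in> carrier FG" if "u \<in> carrier FG" for u using that by simp
  have h_diff: "h (u - w) = h u \<ominus>\<^bsub>B\<^esub> h w" if "u \<in> carrier FG" "w \<in> carrier FG" for u w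
    using h_add[OF that(1) carrier_minus[OF that(2)]] h_minus[OF that(2)] by (simp add: a_minus_def)
  have carrier_diff: "u - w \<in> carrier FG" if "u \<in> carrier FG" "w \<in> carrier FG" for u w
    using that unfolding carrier_free_Abelian_group_iff by (rule keys_diff_subset)
  have fr: "frag_of (x, b) \<in> carrier FG" if "x \<in> carrier M" "b \<in> carrier B" for x b using that by simp
  have cancel: "u \<oplus>\<^bsub>B\<^esub> w \<ominus>\<^bsub>B\<^esub> u \<ominus>\<^bsub>B\<^esub> w = \<zero>\<^bsub>B\<^esub>" if "u \<in> carrier B" "w \<in> carrier B" for u w
  proof -
    have "u \<oplus>\<^bsub>B\<^esub> w \<ominus>\<^bsub>B\<^esub> u = w" 
      using that by (simp add: a_minus_def B.a_assoc B.a_comm[of w "\<ominus>\<^bsub>B\<^esub> u"] B.r_neg2)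
    then show ?thesis using that by (simp add: a_minus_def B.r_neg)
  qed
  have "T \<subseteq> kernel FG (add_monoid B) h"
    unfolding tensor_relations_def
  proof (rule h.generate_subgroup_incl[OF _ h.subgroup_kernel], intro Un_least subsetI)
    fix z assume "z \<in> {frag_of (x \<oplus>\<^bsub>M\<^esub> x', b) - frag_of (x, b) - frag_of (x', b) |x x' b.
      x \<in> carrier M \<and> x' \<in> carrier M \<and> b \<in> carrier B}"
    then obtain x x' b where z: "z = frag_of (x \<oplus>\<^bsub>M\<^esub> x', b) - frag_of (x, b) - frag_of (x', b)"
      and x: "x \<in> carrier M" "x' \<in> carrier M" "b \<in> carrier B" by auto
    have c: "frag_of (x \<oplus>\<^bsub>M\<^esub> x', b) - frag_of (x, b) \<in> carrier FG" using x by (intro carrier_diff fr) auto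
    have "h z = f x \<odot>\<^bsub>B\<^esub> b \<oplus>\<^bsub>B\<^esub> f x' \<odot>\<^bsub>B\<^esub> b \<ominus>\<^bsub>B\<^esub> f x \<odot>\<^bsub>B\<^esub> b \<ominus>\<^bsub>B\<^esub> f x' \<odot>\<^bsub>B\<^esub> b"
      unfolding z h_diff[OF c fr[OF x(2,3)]]
      using x h_diff[OF fr fr, of "x \<oplus>\<^bsub>M\<^esub> x'" b x b] f by (simp add: h_frag f_add B.smult_l_distr)
    also have "\<dots> = \<zero>\<^bsub>B\<^esub>" using x f by (intro cancel) auto
    finally show "z \<in> kernel FG (add_monoid B) h"
      using carrier_diff[OF c fr[OF x(2,3)]] unfolding kernel_def z[symmetric] by simp
  next
    fix z assume "z \<in> {frag_of (x, b \<oplus>\<^bsub>B\<^esub> b') - frag_of (x, b) - frag_of (x, b') |x b b'.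
      x \<in> carrier M \<and> b \<in> carrier B \<and> b' \<in> carrier B}"
    then obtain x b b' where z: "z = frag_of (x, b \<oplus>\<^bsub>B\<^esub> b') - frag_of (x, b) - frag_of (x, b')"
      and x: "x \<in> carrier M" "b \<in> carrier B" "b' \<in> carrier B" by auto
    have c: "frag_of (x, b \<oplus>\<^bsub>B\<^esub> b') - frag_of (x, b) \<in> carrier FG" using x by (intro carrier_diff fr) auto
    have "h z = f x \<odot>\<^bsub>B\<^esub> b \<oplus>\<^bsub>B\<^esub> f x \<odot>\<^bsub>B\<^esub> b' \<ominus>\<^bsub>B\<^esub> f x \<odot>\<^bsub>B\<^esub> b \<ominus>\<^bsub>B\<^esub> f x \<odot>\<^bsub>B\<^esub> b'"
      unfolding z h_diff[OF c fr[OF x(1,3)]]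
      using x h_diff[OF fr fr, of x "b \<oplus>\<^bsub>B\<^esub> b'" x b] f by (simp add: h_frag B.smult_r_distr)
    also have "\<dots> = \<zero>\<^bsub>B\<^esub>" using x f by (intro cancel) auto
    finally show "z \<in> kernel FG (add_monoid B) h"
      using carrier_diff[OF c fr[OF x(1,3)]] unfolding kernel_def z[symmetric] by simp
  next
    fix z assume "z \<in> {frag_of (r \<odot>\<^bsub>M\<^esub> x, b) - frag_of (x, r \<odot>\<^bsub>B\<^esub> b) |r x b.
      r \<in> carrier R \<and> x \<in> carrier M \<and> b \<in> carrier B}"
    then obtain r x b where z: "z = frag_of (r \<odot>\<^bsub>M\<^esub> x, b) - frag_of (x, r \<odot>\<^bsub>B\<^esub> b)"
      and x: "r \<in> carrier R" "x \<in> carrier M" "b \<in> carrier B" by auto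
    have "(r \<otimes>\<^bsub>R\<^esub> f x) \<odot>\<^bsub>B\<^esub> b = f x \<odot>\<^bsub>B\<^esub> (r \<odot>\<^bsub>B\<^esub> b)"
      using x f by (simp add: B.smult_assoc1[symmetric] M.R.m_comm)
    then have "h z = \<zero>\<^bsub>B\<^esub>"
      unfolding z using x f h_diff[OF fr fr, of "r \<odot>\<^bsub>M\<^esub> x" b x "r \<odot>\<^bsub>B\<^esub> b"]
      by (simp add: h_frag f_smult a_minus_def B.r_neg)
    moreover have "z \<in> carrier FG" unfolding z using x by (intro carrier_diff fr) auto
    ultimately show "z \<in> kernel FG (add_monoid B) h" unfolding kernel_def by simp
  qed
  then have h_T: "h t = \<zero>\<^bsub>B\<^esub>" if "t \<in> T" for t using that unfolding kernel_def by auto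
  \<comment> \<open>It suffices to show \<open>P\<close> for all cosets in the tensor image: \<open>tensor v b\<close> is one of them and contains
    \<open>frag_of (v, b)\<close>, whose image under \<open>h\<close> is \<open>f v b\<close>.\<close>
  define P where "P U \<longleftrightarrow> (\<forall>u\<in>U. u \<in> carrier FG \<and> h u \<in> A)" for U
  have AB: "A \<subseteq> carrier B" and A0: "\<zero>\<^bsub>B\<^esub> \<in> A"
    and A_add: "\<And>a a'. a \<in> A \<Longrightarrow> a' \<in> A \<Longrightarrow> a \<oplus>\<^bsub>B\<^esub> a' \<in> A" and A_inv: "\<And>a. a \<in> A \<Longrightarrow> \<ominus>\<^bsub>B\<^esub> a \<in> A"
    and A_smult: "\<And>r a. r \<in> carrier R \<Longrightarrow> a \<in> A \<Longrightarrow> r \<odot>\<^bsub>B\<^esub> a \<in> A"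
    using B.submoduleE[OF A] subgroup.one_closed[OF submodule.axioms(1)[OF A]] by simp_all
  have add_carrier: "u + w \<in> carrier FG" if "u \<in> carrier FG" "w \<in> carrier FG" for u w
    using h.m_closed[OF that] by (simp only: mult_free_Abelian_group)
  have P_coset: "P (T #>\<^bsub>FG\<^esub> u)" if u: "u \<in> carrier FG" "h u \<in> A" for u
    unfolding P_def
  proof
    fix w assume "w \<in> T #>\<^bsub>FG\<^esub> u"
    then obtain t where t: "t \<in> T" "w = t + u" unfolding r_coset_def by auto
    then have tc: "t \<in> carrier FG" using tensor_relations_carrier by blast
    have "h w = h u" using h_add[OF tc u(1)] h_T[OF t(1)] h_closed[OF u(1)] t(2) by simp
    then show "w \<in> carrier FG \<and> h w \<in> A" using add_carrier[OF tc u(1)] u(2) t(2) by simp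
  qed
  have "P U" if "U \<in> tensor_image R M A B" for U
    using that unfolding tensor_image_def
  proof (induction rule: generate.induct)
    case one
    have "P T" unfolding P_def
    proof (intro ballI conjI)
      show "u \<in> carrier FG" if "u \<in> T" for u using that tensor_relations_carrier by blast
      show "h u \<in> A" if "u \<in> T" for u using h_T[OF that] A0 by simp
    qed
    then show ?case by (simp add: tensor_product_def)
  next
    case (incl U)
    then obtain x a where xa: "U = tensor x a" "x \<in> carrier M" "a \<in> A" by blast
    then show ?case unfolding xa(1) simple_tensor_def
      using AB f A_smult h_frag by (intro P_coset fr) auto
  next
    case (inv U)
    then obtain x a where xa: "U = tensor x a" "x \<in> carrier M" "a \<in> A" by blast
    then have c: "frag_of (x, a) \<in> carrier FG" and ha: "h (frag_of (x, a)) \<in> A" using AB f A_smult h_frag by auto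
    have "inv\<^bsub>tensor_product R M B\<^esub> U = T #>\<^bsub>FG\<^esub> (- frag_of (x, a))"
      unfolding xa(1) simple_tensor_def tensor_product_def
      using normal.inv_FactGroup[OF tensor_relations_normal tensor_in_carrier[OF c, unfolded tensor_product_def]]
        normal.rcos_inv[OF tensor_relations_normal c] c by simp
    then show ?case using P_coset[OF carrier_minus[OF c]] h_minus[OF c] A_inv[OF ha] by simp
  next
    case (eng U U')
    show ?case unfolding P_def tensor_product_def mult_FactGroup
    proof
      fix w assume "w \<in> U <#>\<^bsub>FG\<^esub> U'"
      then obtain u u' where u: "u \<in> U" "u' \<in> U'" "w = u + u'" unfolding set_mult_def by auto
      then have "u \<in> carrier FG" "h u \<in> A" "u' \<in> carrier FG" "h u' \<in> A" using eng unfolding P_def by blast+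
      then show "w \<in> carrier FG \<and> h w \<in> A" using h_add add_carrier A_add u(3) by simp
    qed
  qed
  moreover have "tensor v b \<in> tensor_image R M A B" using b v unfolding module_closure_def by blast
  ultimately have "P (tensor v b)" .
  moreover have "frag_of (v, b) \<in> tensor v b"
    unfolding simple_tensor_def by (rule group.rcos_self[OF group_free_Abelian_group fr[OF v bB] tensor_relations_subgroup])
  ultimately show ?thesis unfolding P_def using h_frag[OF v bB] by auto
qed

end

lemma functional_value_in_test_ideal:
  fixes R :: "('r, 'a) ring_scheme" and M :: "('r, 'm, 'c) module_scheme"
  assumes M: "Module.module R M" and f: "\<And>x. x \<in> carrier M \<Longrightarrow> f x \<in> carrier R"
    and f_add: "\<And>x x'. x \<in> carrier M \<Longrightarrow> x' \<in> carrier M \<Longrightarrow> f (x \<oplus>\<^bsub>M\<^esub> x') = f x \<oplus>\<^bsub>R\<^esub> f x'"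
    and f_smult: "\<And>r x. r \<in> carrier R \<Longrightarrow> x \<in> carrier M \<Longrightarrow> f (r \<odot>\<^bsub>M\<^esub> x) = r \<otimes>\<^bsub>R\<^esub> f x"
    and v: "v \<in> carrier M"
  shows "f v \<in> test_ideal R M"
  unfolding test_ideal_def
proof (intro CollectI conjI allI impI ballI)
  show "f v \<in> carrier R" using f v by blast
  fix B :: "('r, (nat \<Rightarrow> 'r) set) module" and A b
  assume B: "Module.module R B \<and> submodule A R B" and b: "b \<in> module_closure R M A B"
  interpret tensor_factors R M B
    unfolding tensor_factors_def using M B by blast
  show "f v \<odot>\<^bsub>B\<^esub> b \<in> A"
    by (rule functional_closure[OF f f_add f_smult _ b v]) (use B in auto)
qed

lemma test_ideal_add:
  fixes R :: "('r, 'a) ring_scheme" and M :: "('r, 'm, 'c) module_scheme"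
  assumes "cring R" "r \<in> test_ideal R M" "s \<in> test_ideal R M"
  shows "r \<oplus>\<^bsub>R\<^esub> s \<in> test_ideal R M"
proof -
  interpret cring R by (rule assms(1))
  have rs: "r \<in> carrier R" "s \<in> carrier R" using assms(2,3) unfolding test_ideal_def by auto
  show ?thesis unfolding test_ideal_def
  proof (intro CollectI conjI allI impI ballI)
    show "r \<oplus>\<^bsub>R\<^esub> s \<in> carrier R" using rs by simp
    fix B :: "('r, (nat \<Rightarrow> 'r) set) module" and A b
    assume B: "Module.module R B \<and> submodule A R B" and b: "b \<in> module_closure R M A B"
    then have "r \<odot>\<^bsub>B\<^esub> b \<in> A" "s \<odot>\<^bsub>B\<^esub> b \<in> A" using assms(2,3) unfolding test_ideal_def by auto
    moreover have "b \<in> carrier B" using b unfolding module_closure_def by auto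
    ultimately show "(r \<oplus>\<^bsub>R\<^esub> s) \<odot>\<^bsub>B\<^esub> b \<in> A"
      using module.smult_l_distr[of R B r s b] module.submoduleE(5)[of R B A] B rs by simp
  qed
qed

section \<open>The modules of elements of one degree\<close>

text \<open>An injection into the type from which the modules in \<open>test_ideal\<close> and \<open>MCM_test_ideal\<close> take their
  elements.\<close>

definition enc :: "'r \<Rightarrow> (nat \<Rightarrow> 'r) set" where
  "enc s = {\<lambda>_. s}"

definition dec :: "(nat \<Rightarrow> 'r) set \<Rightarrow> 'r" where
  "dec u = the_elem u 0"

lemma dec_enc [simp]: "dec (enc s) = s"
  by (simp add: dec_def enc_def)

lemma enc_eq_iff [simp]: "enc s = enc t \<longleftrightarrow> s = t"
  by (metis dec_enc)

definition graded_module :: "nat \<Rightarrow> nat \<Rightarrow> ('k::field fps fps, (nat \<Rightarrow> 'k fps fps) set) module" where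
  "graded_module d j = \<lparr>carrier = enc ` graded_part d j, monoid.mult = (\<lambda>u v. u), monoid.one = enc 0,
     ring.zero = enc 0, ring.add = (\<lambda>u v. enc (dec u + dec v)), module.smult = (\<lambda>r u. enc (r * dec u))\<rparr>"

lemma graded_module_simps [simp]:
  "carrier (graded_module d j) = enc ` graded_part d j" "\<zero>\<^bsub>graded_module d j\<^esub> = enc 0"
  "enc s \<oplus>\<^bsub>graded_module d j\<^esub> enc t = enc (s + t)" "r \<odot>\<^bsub>graded_module d j\<^esub> enc s = enc (r * s)"
  by (simp_all add: graded_module_def)

lemma module_graded_module:
  assumes "d > 0"
  shows "Module.module (veronese_ring d :: 'k::field fps fps ring) (graded_module d j)"
proof (rule moduleI)
  show "cring (veronese_ring d :: 'k fps fps ring)" by (rule cring_veronese_ring[OF assms])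
  show "abelian_group (graded_module d j :: ('k fps fps, (nat \<Rightarrow> 'k fps fps) set) module)"
  proof (rule abelian_groupI)
    fix u :: "(nat \<Rightarrow> 'k fps fps) set" assume "u \<in> carrier (graded_module d j)"
    then obtain s where "s \<in> graded_part d j" "u = enc s" by auto
    then show "\<exists>v\<in>carrier (graded_module d j). v \<oplus>\<^bsub>graded_module d j\<^esub> u = \<zero>\<^bsub>graded_module d j\<^esub>"
      by (intro bexI[of _ "enc (- s)"]) (auto simp: graded_part_uminus)
  qed (auto simp: graded_part_add add_ac)
qed (auto simp: carrier_veronese_ring[OF assms] graded_part_mult_0 graded_part_add distrib_left distrib_right mult.assoc)

context veronese_module
begin

text \<open>Since \<open>S\<^sub>d\<^sub>-\<^sub>i\<cdot>S\<^sub>i\<close> consists of values of functionals, descending induction on \<open>k\<close> shows that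
  \<open>S\<^sub>k\<cdot>S\<^sub>d\<^sub>-\<^sub>k\<close> is in the test ideal for \<open>1 \<le> k \<le> d - i\<close>: the second factor has the form \<open>x s' + y s''\<close>, and
  \<open>x\<close> and \<open>y\<close> can be moved to the first one. The case \<open>k = 1\<close> gives the maximal ideal.\<close>

lemma test_ideal_contains_maximal:
  assumes i: "i < d" and p_part: "\<And>u. u \<in> C \<Longrightarrow> p u \<in> graded_part d i"
    and p_add: "\<And>u v. u \<in> C \<Longrightarrow> v \<in> C \<Longrightarrow> p (u \<oplus> v) = p u + p v"
    and p_smult: "\<And>r u. r \<in> G0 \<Longrightarrow> u \<in> C \<Longrightarrow> p (r \<odot> u) = r * p u"
    and q: "\<And>s. s \<in> graded_part d i \<Longrightarrow> q s \<in> C" "\<And>s. s \<in> graded_part d i \<Longrightarrow> p (q s) = s"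
    and r: "r \<in> G0" "r $ 0 $ 0 = 0"
  shows "r \<in> test_ideal (veronese_ring d) M"
proof -
  let ?TI = "test_ideal (veronese_ring d) M"
  have TI_add: "a + b \<in> ?TI" if "a \<in> ?TI" "b \<in> ?TI" for a b
    using test_ideal_add[OF cring_veronese_ring[OF d_pos] that] by simp
  have claim: "t * s \<in> ?TI" if "k \<le> d - i" "1 \<le> k" "t \<in> graded_part d k" "s \<in> graded_part d (d - k)" for k t s
    using that
  proof (induction k arbitrary: t s rule: inc_induct)
    case base
    have s: "s \<in> graded_part d i" using base(3) i by simp
    have d0: "graded_part d (d - i + i) = G0" using i graded_part_cong[of d d 0] by simp
    have "t * p (q s) \<in> ?TI"
    proof (rule functional_value_in_test_ideal[OF module_M, of "\<lambda>u. t * p u"])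
      show "t * p u \<in> carrier (veronese_ring d)" if "u \<in> C" for u
        using graded_part_mult[OF base(2) p_part[OF that]] unfolding carrR d0 .
      show "t * p (u \<oplus> v) = t * p u \<oplus>\<^bsub>veronese_ring d\<^esub> t * p v" if "u \<in> C" "v \<in> C" for u v
        using p_add[OF that] by (simp add: distrib_left)
      show "t * p (r \<odot> u) = r \<otimes>\<^bsub>veronese_ring d\<^esub> (t * p u)" if "r \<in> carrier (veronese_ring d)" "u \<in> C" for r u
        using p_smult[of r u] that by (simp add: carrR mult.left_commute)
      show "q s \<in> C" using q(1) s by blast
    qed
    then show ?case using q(2)[OF s] by simp
  next
    case (step k)
    have dk: "d - k = Suc (d - Suc k)" using step(2) by simp
    have "s $ 0 $ 0 = 0"
      using graded_partD[OF step(6), of 0 0] step(2,4) i by force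
    then obtain s' s'' where s: "s' \<in> graded_part d (d - Suc k)" "s'' \<in> graded_part d (d - Suc k)" "s = xv * s' + yv * s''"
      using split_xy[of s d "d - Suc k"] step(6) unfolding dk by blast
    have "t * xv * s' \<in> ?TI" "t * yv * s'' \<in> ?TI"
      using step(3)[OF _ _ s(1), of "t * xv"] step(3)[OF _ _ s(2), of "t * yv"]
        graded_part_mult[OF step(5) xv_part] graded_part_mult[OF step(5) yv_part] by simp_all
    then have "t * xv * s' + t * yv * s'' \<in> ?TI" by (rule TI_add)
    then show ?case unfolding s(3) by (simp only: distrib_left mult.assoc)
  qed
  have "r \<in> graded_part d (Suc (d - 1))" using r(1) d_pos graded_part_cong[of 0 d d, where 'a = 'k] by simp
  then obtain s' s'' where s: "s' \<in> graded_part d (d - 1)" "s'' \<in> graded_part d (d - 1)" "r = xv * s' + yv * s''"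
    using split_xy r(2) by blast
  show ?thesis unfolding s(3)
    using claim[OF _ _ xv_part s(1)] claim[OF _ _ yv_part s(2)] i TI_add by simp
qed

text \<open>For \<open>B = S\<^sub>d\<^sub>-\<^sub>2\<close> and \<open>A = (x\<^sup>d, y\<^sup>d) B\<close>, the element \<open>b = x\<^sup>d\<^sup>-\<^sup>1 y\<^sup>d\<^sup>-\<^sup>1\<close> is in the closure of \<open>A\<close> but not in \<open>A\<close>.
  A unit in the test ideal would multiply \<open>b\<close> into \<open>A\<close>.\<close>

lemma test_ideal_proper:
  assumes i: "1 \<le> i" "i < d"
    and q: "\<And>s. s \<in> graded_part d i \<Longrightarrow> q s \<in> C" "C \<subseteq> q ` graded_part d i"
    and q_add: "\<And>s t. s \<in> graded_part d i \<Longrightarrow> t \<in> graded_part d i \<Longrightarrow> q (s + t) = q s \<oplus> q t"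
    and q_smult: "\<And>r s. r \<in> G0 \<Longrightarrow> s \<in> graded_part d i \<Longrightarrow> q (r * s) = r \<odot> q s"
    and r: "r \<in> test_ideal (veronese_ring d) M"
  shows "r \<in> G0" "r $ 0 $ 0 = 0"
proof -
  let ?B = "graded_module d (d - 2) :: ('k fps fps, (nat \<Rightarrow> 'k fps fps) set) module"
  let ?P = "graded_part d (d - 2) :: 'k fps fps set"
  define A where "A = {enc (xv ^ d * s + yv ^ d * t) | s t. s \<in> ?P \<and> t \<in> ?P}"
  have modB: "Module.module (veronese_ring d) ?B" by (rule module_graded_module[OF d_pos])
  interpret tensor_factors "veronese_ring d" M ?B
    unfolding tensor_factors_def using module_M modB by blast
  have inP: "xv ^ d * s + yv ^ d * t \<in> ?P" if "s \<in> ?P" "t \<in> ?P" for s t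
    using that by (intro graded_part_add graded_part_mult_0) auto
  have A_I: "enc (xv ^ d * s + yv ^ d * t) \<in> A" if "s \<in> ?P" "t \<in> ?P" for s t
    unfolding A_def using that by blast
  have subA: "submodule A (veronese_ring d) ?B"
  proof (rule B.submoduleI)
    show "A \<subseteq> carrier ?B" unfolding A_def using inP by auto
    show "\<zero>\<^bsub>?B\<^esub> \<in> A" using A_I[of 0 0] by simp
    show add: "u \<oplus>\<^bsub>?B\<^esub> v \<in> A" if "u \<in> A" "v \<in> A" for u v
    proof -
      obtain s t s' t' where st: "s \<in> ?P" "t \<in> ?P" "u = enc (xv ^ d * s + yv ^ d * t)"
        "s' \<in> ?P" "t' \<in> ?P" "v = enc (xv ^ d * s' + yv ^ d * t')" using \<open>u \<in> A\<close> \<open>v \<in> A\<close> unfolding A_def by blast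
      have "u \<oplus>\<^bsub>?B\<^esub> v = enc (xv ^ d * (s + s') + yv ^ d * (t + t'))"
        unfolding st(3,6) graded_module_simps by (simp only: distrib_left add_ac)
      then show ?thesis using A_I[OF graded_part_add[OF st(1,4)] graded_part_add[OF st(2,5)]] by simp
    qed
    show smult: "r \<odot>\<^bsub>?B\<^esub> u \<in> A" if "r \<in> carrier (veronese_ring d)" "u \<in> A" for r u
    proof -
      obtain s t where st: "s \<in> ?P" "t \<in> ?P" "u = enc (xv ^ d * s + yv ^ d * t)" using \<open>u \<in> A\<close> unfolding A_def by blast
      have "r \<odot>\<^bsub>?B\<^esub> u = enc (xv ^ d * (r * s) + yv ^ d * (r * t))"
        unfolding st(3) graded_module_simps by (simp only: distrib_left mult.left_commute)
      then show ?thesis using A_I graded_part_mult_0[of r d] st(1,2) \<open>r \<in> carrier (veronese_ring d)\<close> by (simp add: carrR)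
    qed
    show "\<ominus>\<^bsub>?B\<^esub> u \<in> A" if "u \<in> A" for u
    proof -
      have u: "u \<in> carrier ?B" using that inP unfolding A_def by auto
      then obtain s where s: "s \<in> ?P" "u = enc s" by auto
      have "enc (- s) = \<ominus>\<^bsub>?B\<^esub> u"
        by (rule B.minus_equality[symmetric]) (use s in \<open>auto simp: graded_part_uminus\<close>)
      moreover have "enc (- s) = (- 1) \<odot>\<^bsub>?B\<^esub> u" using s by simp
      ultimately show ?thesis using smult[of "- 1" u] that by (simp add: carrR graded_part_uminus)
    qed
  qed
  define b :: "'k fps fps" where "b = xv ^ (d - 1) * yv ^ (d - 1)"
  have bP: "b \<in> ?P"
  proof -
    have "b \<in> graded_part d (d - 1 + (d - 1))" unfolding b_def by (intro graded_part_mult xv_power_part yv_power_part)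
    moreover have "(d - 1 + (d - 1)) mod d = (d - 2) mod d"
    proof -
      have "d - 1 + (d - 1) = (d - 2) + d" using i by simp
      then show ?thesis by simp
    qed
    ultimately show ?thesis using graded_part_cong[of "d - 1 + (d - 1)" d "d - 2", where 'a = 'k] by simp
  qed
  have bA: "enc b \<notin> A"
  proof
    assume "enc b \<in> A"
    then obtain s t where "b = xv ^ d * s + yv ^ d * t" unfolding A_def by auto
    then have "b $ (d - 1) $ (d - 1) = (xv ^ d * s) $ (d - 1) $ (d - 1) + (yv ^ d * t) $ (d - 1) $ (d - 1)" by simp
    moreover have "b $ (d - 1) $ (d - 1) = 1"
      by (simp add: b_def xv_def fps_X_power_mult_right_nth fps_const_power)
    moreover have "(xv ^ d * s) $ (d - 1) $ (d - 1) = 0"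
      using d_pos by (simp add: xv_def fps_const_power fps_X_power_mult_nth)
    moreover have "(yv ^ d * t) $ (d - 1) $ (d - 1) = 0"
      using d_pos by (simp add: fps_X_power_mult_nth)
    ultimately show False by simp
  qed
  have d2: "d = Suc (Suc (d - 2))" using i by simp
  define TI where "TI = tensor_image (veronese_ring d) M A ?B"
  have gen: "tensor v (enc (xv ^ d * s + yv ^ d * t)) \<in> TI" if "v \<in> C" "s \<in> ?P" "t \<in> ?P" for v s t
    unfolding TI_def tensor_image_def by (rule generate.incl) (use that A_I in blast)
  have factor1: "z ^ (d - 1) * w ^ (d - 1) = (z ^ (d - 1) * w) * w ^ (d - 2)" for z w :: "'k fps fps"
    using d2 by (metis diff_Suc_1 mult.assoc power_Suc)
  have factor2: "z ^ (d - 1) * w * (z * s) = z ^ d * (w * s)" for z w s :: "'k fps fps"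
  proof -
    have "z ^ d = z ^ (d - 1) * z" using d_pos by (cases d) (simp_all add: mult.commute)
    then show ?thesis by (simp only: mult_ac)
  qed
  have "tensor v (enc b) \<in> TI" if v: "v \<in> C" for v
  proof -
    obtain s where s: "s \<in> graded_part d i" "v = q s" using q(2) v by blast
    obtain i' where i': "i = Suc i'" using i by (cases i) auto
    have "s $ 0 $ 0 = 0" using graded_partD[OF s(1), of 0 0] i by force
    then obtain s' s'' where ss: "s' \<in> graded_part d i'" "s'' \<in> graded_part d i'" "s = xv * s' + yv * s''"
      using split_xy s(1) unfolding i' by blast
    have parts: "xv * s' \<in> graded_part d i" "yv * s'' \<in> graded_part d i" "yv * s' \<in> graded_part d i" "xv * s'' \<in> graded_part d i"
      using graded_part_mult[OF xv_part ss(1)] graded_part_mult[OF yv_part ss(2)]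
        graded_part_mult[OF yv_part ss(1)] graded_part_mult[OF xv_part ss(2)] unfolding i' by simp_all
    have r0: "xv ^ (d - 1) * yv \<in> G0" "yv ^ (d - 1) * xv \<in> G0"
      using graded_part_mult[OF xv_power_part[of "d - 1" d] yv_part] graded_part_mult[OF yv_power_part[of "d - 1" d] xv_part]
        graded_part_cong[of d d 0, where 'a = 'k] d_pos by auto
    have bx: "enc b = (xv ^ (d - 1) * yv) \<odot>\<^bsub>?B\<^esub> enc (yv ^ (d - 2))"
      unfolding b_def graded_module_simps factor1 ..
    have bY: "enc b = (yv ^ (d - 1) * xv) \<odot>\<^bsub>?B\<^esub> enc (xv ^ (d - 2))"
      unfolding b_def graded_module_simps factor1[symmetric] by (simp only: mult.commute)
    have eB: "enc (yv ^ (d - 2)) \<in> carrier ?B" "enc (xv ^ (d - 2)) \<in> carrier ?B"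
      by (simp_all add: imageI yv_power_part xv_power_part)
    have "tensor (q (xv * s')) (enc b) = tensor ((xv ^ (d - 1) * yv) \<odot> q (xv * s')) (enc (yv ^ (d - 2)))"
      unfolding bx using tensor_move_scalar[of "xv ^ (d - 1) * yv" "q (xv * s')" "enc (yv ^ (d - 2))"] r0 parts q(1) eB
      by (simp only: carrR)
    also have "(xv ^ (d - 1) * yv) \<odot> q (xv * s') = xv ^ d \<odot> q (yv * s')"
      unfolding q_smult[OF r0(1) parts(1), symmetric] q_smult[OF xv_power_d parts(3), symmetric] factor2 ..
    also have "tensor (xv ^ d \<odot> q (yv * s')) (enc (yv ^ (d - 2))) = tensor (q (yv * s')) (xv ^ d \<odot>\<^bsub>?B\<^esub> enc (yv ^ (d - 2)))"
      by (rule tensor_move_scalar) (use parts q(1) eB carrR in auto)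
    also have "xv ^ d \<odot>\<^bsub>?B\<^esub> enc (yv ^ (d - 2)) = enc (xv ^ d * yv ^ (d - 2) + yv ^ d * 0)" by simp
    finally have 1: "tensor (q (xv * s')) (enc b) \<in> TI"
      using gen[of "q (yv * s')" "yv ^ (d - 2)" 0] parts q(1) by (simp add: yv_power_part)
    have "tensor (q (yv * s'')) (enc b) = tensor ((yv ^ (d - 1) * xv) \<odot> q (yv * s'')) (enc (xv ^ (d - 2)))"
      unfolding bY using tensor_move_scalar[of "yv ^ (d - 1) * xv" "q (yv * s'')" "enc (xv ^ (d - 2))"] r0 parts q(1) eB
      by (simp only: carrR)
    also have "(yv ^ (d - 1) * xv) \<odot> q (yv * s'') = yv ^ d \<odot> q (xv * s'')"
      unfolding q_smult[OF r0(2) parts(2), symmetric] q_smult[OF yv_power_d parts(4), symmetric] factor2 ..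
    also have "tensor (yv ^ d \<odot> q (xv * s'')) (enc (xv ^ (d - 2))) = tensor (q (xv * s'')) (yv ^ d \<odot>\<^bsub>?B\<^esub> enc (xv ^ (d - 2)))"
      by (rule tensor_move_scalar) (use parts q(1) eB carrR in auto)
    also have "yv ^ d \<odot>\<^bsub>?B\<^esub> enc (xv ^ (d - 2)) = enc (xv ^ d * 0 + yv ^ d * xv ^ (d - 2))" by simp
    finally have 2: "tensor (q (yv * s'')) (enc b) \<in> TI"
      using gen[of "q (xv * s'')" 0 "xv ^ (d - 2)"] parts q(1) by (simp add: xv_power_part)
    have "v = q (xv * s') \<oplus> q (yv * s'')" using q_add[OF parts(1,2)] s(2) ss(3) by simp
    then have "tensor v (enc b) = tensor (q (xv * s')) (enc b) \<otimes>\<^bsub>tensor_product (veronese_ring d) M ?B\<^esub> tensor (q (yv * s'')) (enc b)"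
      using tensor_add_left[of "q (xv * s')" "q (yv * s'')" "enc b"] q(1) parts bP by simp
    then show ?thesis using generate.eng[OF 1[unfolded TI_def tensor_image_def] 2[unfolded TI_def tensor_image_def]]
      unfolding TI_def tensor_image_def by simp
  qed
  then have "enc b \<in> module_closure (veronese_ring d) M A ?B"
    unfolding module_closure_def TI_def using bP by simp
  moreover have "\<forall>b\<in>module_closure (veronese_ring d) M A ?B. r \<odot>\<^bsub>?B\<^esub> b \<in> A"
    using r modB subA unfolding test_ideal_def by blast
  ultimately have rb: "r \<odot>\<^bsub>?B\<^esub> enc b \<in> A" by blast
  show r0: "r \<in> G0" using r carrR unfolding test_ideal_def by blast
  show "r $ 0 $ 0 = 0"
  proof (rule ccontr)
    assume "r $ 0 $ 0 \<noteq> 0"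
    then obtain g where g: "g \<in> G0" "r * g = 1" using unit_if_constant_nonzero r0 by blast
    have "g \<odot>\<^bsub>?B\<^esub> (r \<odot>\<^bsub>?B\<^esub> enc b) \<in> A"
      using B.submoduleE(4)[OF subA _ rb] g(1) carrR by simp
    moreover have "g * (r * b) = (r * g) * b" by (simp only: mult_ac)
    then have "g * (r * b) = b" unfolding g(2) by simp
    ultimately show False using bA by simp
  qed
qed

end

section \<open>Elimination\<close>

text \<open>The quotient in Weierstrass division of \<open>r\<close> by \<open>f\<close>, coefficient by coefficient in \<open>y\<close>: the coefficient of
  \<open>y\<^sup>n\<close> that is left after the earlier steps is divided by \<open>f $ 0\<close>, which is \<open>x\<close> to the power
  \<open>subdegree (f $ 0)\<close> times a unit of \<open>k\<lbrakk>x\<rbrakk>\<close>.\<close>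

function weierstrass_quotient :: "'k::field fps fps \<Rightarrow> 'k fps fps \<Rightarrow> nat \<Rightarrow> 'k fps" where
  "weierstrass_quotient f r n =
     fps_shift (subdegree (f $ 0)) (r $ n - (\<Sum>i<n. f $ (n - i) * weierstrass_quotient f r i))
       * inverse (fps_shift (subdegree (f $ 0)) (f $ 0))"
  by auto
termination by (relation "measure (\<lambda>(f, r, n). n)") auto

declare weierstrass_quotient.simps [simp del]

lemma weierstrass_division:
  fixes f r :: "'k::field fps fps"
  assumes "f $ 0 \<noteq> 0"
  obtains q rem where "r = rem + f * q" "\<And>n a. a \<ge> subdegree (f $ 0) \<Longrightarrow> rem $ n $ a = 0"
proof
  define q where "q = Abs_fps (weierstrass_quotient f r)"
  let ?s = "subdegree (f $ 0)"
  show "r = (r - f * q) + f * q" by simp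
  show "(r - f * q) $ n $ a = 0" if a: "a \<ge> ?s" for n a
  proof -
    define z where "z = r $ n - (\<Sum>i<n. f $ (n - i) * q $ i)"
    have "(f * q) $ n = (\<Sum>i\<in>{0..n}. f $ (n - i) * q $ i)"
      unfolding fps_mult_nth by (rule sum.reindex_bij_witness[of _ "\<lambda>i. n - i" "\<lambda>i. n - i"]) auto
    also have "{0..n} = insert n {..<n}" by auto
    finally have fq: "(r - f * q) $ n = z - f $ 0 * q $ n" by (simp add: z_def)
    have "q $ n = fps_shift ?s z * inverse (fps_shift ?s (f $ 0))"
      unfolding q_def z_def by (simp, subst weierstrass_quotient.simps, simp)
    then have "f $ 0 * q $ n = fps_X ^ ?s * fps_shift ?s (f $ 0) * (fps_shift ?s z * inverse (fps_shift ?s (f $ 0)))"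
      by (metis mult.commute subdegree_decompose)
    also have "\<dots> = fps_X ^ ?s * fps_shift ?s z * (inverse (fps_shift ?s (f $ 0)) * fps_shift ?s (f $ 0))"
      by (simp only: mult_ac)
    also have "inverse (fps_shift ?s (f $ 0)) * fps_shift ?s (f $ 0) = 1"
      by (rule inverse_mult_eq_1) (use assms in simp)
    finally have "(r - f * q) $ n $ a = z $ a - (fps_X ^ ?s * fps_shift ?s z) $ a" unfolding fq by simp
    then show ?thesis using a by (simp add: fps_X_power_mult_nth)
  qed
qed

text \<open>By Weierstrass division the powers of \<open>g\<close> modulo \<open>f\<close> lie in a finitely generated module over \<open>k\<lbrakk>y\<rbrakk>\<close>, so
  some power of \<open>g\<close> is a combination of earlier ones. Taking components of degree \<open>0\<close> gives a monic equation with
  coefficients in \<open>k\<lbrakk>y\<^sup>d\<rbrakk>\<close>, whose lowest non-zero coefficient is a unit times a power of \<open>y\<^sup>d\<close>. The term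
  of that coefficient is \<open>g\<^sup>i\<close> times it, and \<open>g\<^sup>i\<^sup>+\<^sup>1\<close> divides the remaining terms.\<close>

lemma elimination:
  fixes f g :: "'k::field fps fps"
  assumes d: "d > 0" and f: "f \<in> graded_part d 0" "f $ 0 \<noteq> 0" and g: "g \<in> graded_part d 0"
  obtains i e u h where "u \<in> graded_part d 0" "h \<in> graded_part d 0" "g ^ i * ((yv ^ d) ^ e + g * u) = f * h"
proof -
  let ?s = "subdegree (f $ 0)"
  have "\<exists>q rem. g ^ j = rem + f * q \<and> (\<forall>n a. a \<ge> ?s \<longrightarrow> rem $ n $ a = 0)" for j
    using weierstrass_division[OF f(2), of "g ^ j"] by metis
  then obtain q rem where qr: "\<And>j. g ^ j = rem j + f * q j" "\<And>j n a. a \<ge> ?s \<Longrightarrow> rem j $ n $ a = 0"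
    by metis
  \<comment> \<open>The remainder of \<open>g ^ j\<close> as a vector of coefficients in \<open>k\<lbrakk>y\<rbrakk>\<close>, indexed by the powers of \<open>x\<close>.\<close>
  define v where "v j a = Abs_fps (\<lambda>n. rem j $ n $ a)" for j a
  have "\<exists>F\<subseteq>range v. finite F \<and> range v \<subseteq> fun_span.span F"
  proof (rule noetherian_vectors[OF noetherian_fps[OF noetherian_field], where I = "{..<?s}"])
    fix w a assume "w \<in> range v" "a \<notin> {..<?s}"
    then show "w a = 0" using qr(2) by (auto simp: v_def fps_eq_iff)
  qed simp
  then obtain F where F: "F \<subseteq> range v" "finite F" "range v \<subseteq> fun_span.span F" by (elim exE conjE)
  obtain J where J: "finite J" "inj_on v J" "F = v ` J"
    using F(1,2) unfolding subset_image_inj by (metis finite_imageD)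
  obtain N where N: "\<And>j. j \<in> J \<Longrightarrow> j < N" using J(1) by (metis finite_nat_iff_bounded lessThan_iff subsetD)
  have "v N \<in> fun_span.span F" using F(3) by blast
  then obtain c0 where c0: "v N = (\<Sum>w\<in>F. (\<lambda>a. c0 w * w a))"
    unfolding fun_span.span_finite[OF F(2)] by blast
  have c0': "v N a = (\<Sum>j\<in>J. c0 (v j) * v j a)" for a
  proof -
    have "v N a = (\<Sum>w\<in>F. c0 w * w a)" unfolding c0 by (induction F rule: infinite_finite_induct) simp_all
    then show ?thesis unfolding J(3) sum.reindex[OF J(2)] by simp
  qed
  define c where "c j = Abs_fps (\<lambda>n. fps_const (c0 (v j) $ n))" for j
  have "rem N = (\<Sum>j\<in>J. c j * rem j)"
  proof (rule fps_fps_ext)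
    fix a n
    have cj: "(c j * rem j) $ n $ a = (c0 (v j) * v j a) $ n" for j
      unfolding fps_mult_nth[of "c j"] fps_mult_nth[of "c0 (v j)"] fps_sum_nth by (simp add: c_def v_def)
    have "rem N $ n $ a = v N a $ n" by (simp add: v_def)
    also have "\<dots> = (\<Sum>j\<in>J. (c0 (v j) * v j a) $ n)" unfolding c0' fps_sum_nth ..
    also have "\<dots> = (\<Sum>j\<in>J. c j * rem j) $ n $ a" unfolding fps_sum_nth cj ..
    finally show "rem N $ n $ a = (\<Sum>j\<in>J. c j * rem j) $ n $ a" .
  qed
  moreover have "(\<Sum>j\<in>J. c j * g ^ j) = (\<Sum>j\<in>J. c j * rem j) + f * (\<Sum>j\<in>J. c j * q j)"
    unfolding qr(1) by (simp only: distrib_left sum.distrib sum_distrib_left mult.left_commute)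
  ultimately have "g ^ N = (\<Sum>j\<in>J. c j * g ^ j) + f * (q N - (\<Sum>j\<in>J. c j * q j))"
    using qr(1)[of N] by (simp add: right_diff_distrib)
  then have "graded_proj d 0 (g ^ N) = (\<Sum>j\<in>J. graded_proj d 0 (g ^ j * c j)) + graded_proj d 0 (f * (q N - (\<Sum>j\<in>J. c j * q j)))"
    by (simp only: graded_proj_add graded_proj_sum mult.commute)
  then have gN: "g ^ N = (\<Sum>j\<in>J. g ^ j * graded_proj d 0 (c j)) + f * graded_proj d 0 (q N - (\<Sum>j\<in>J. c j * q j))"
    by (simp only: graded_proj_mult_0[OF f(1)] graded_proj_mult_0[OF graded_part_power_0[OF g]] graded_proj_id[OF graded_part_power_0[OF g]])
  define h where "h = graded_proj d 0 (q N - (\<Sum>j\<in>J. c j * q j))"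
  define z where "z j = (if j = N then 1 else if j \<in> J then - graded_proj d 0 (c j) else 0)" for j
  have z0: "z j \<in> graded_part d 0" for j by (simp add: z_def graded_part_uminus)
  have z_y: "z j $ n $ a = 0" if "a \<noteq> 0" for j n a using that by (simp add: z_def c_def graded_proj_nth fps_one_nth)
  have NJ: "N \<notin> J" using N by blast
  have sum: "(\<Sum>j\<le>N. g ^ j * z j) = f * h"
  proof -
    have "(\<Sum>j\<le>N. g ^ j * z j) = (\<Sum>j\<in>insert N J. g ^ j * z j)"
      by (rule sum.mono_neutral_right) (use N in \<open>auto simp: z_def intro: less_imp_le\<close>)
    also have "\<dots> = g ^ N * z N + (\<Sum>j\<in>J. g ^ j * z j)" using J(1) NJ by simp
    also have "(\<Sum>j\<in>J. g ^ j * z j) = - (\<Sum>j\<in>J. g ^ j * graded_proj d 0 (c j))"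
      unfolding sum_negf[symmetric] using NJ by (intro sum.cong) (auto simp: z_def)
    also have "g ^ N * z N = g ^ N" by (simp add: z_def)
    finally show ?thesis using gN by (simp add: h_def)
  qed
  define i where "i = (LEAST j. z j \<noteq> 0)"
  have zN: "z N \<noteq> 0" by (simp add: z_def)
  have zi: "z i \<noteq> 0" unfolding i_def using zN by (rule LeastI)
  have iN: "i \<le> N" unfolding i_def using zN by (rule Least_le)
  have zlow: "z j = 0" if "j < i" for j using not_less_Least[of j "\<lambda>j. z j \<noteq> 0"] that i_def by blast
  define u where "u = (\<Sum>j\<in>{Suc i..N}. g ^ (j - Suc i) * z j)"
  have u0: "u \<in> graded_part d 0"
    unfolding u_def by (intro graded_part_sum graded_part_mult_0 graded_part_power_0 g z0)
  have "(\<Sum>j\<le>N. g ^ j * z j) = (\<Sum>j\<in>{i..N}. g ^ j * z j)"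
    by (rule sum.mono_neutral_right) (use zlow in auto)
  also have "{i..N} = insert i {Suc i..N}" using iN by auto
  also have "(\<Sum>j\<in>insert i {Suc i..N}. g ^ j * z j) = g ^ i * z i + (\<Sum>j\<in>{Suc i..N}. g ^ j * z j)" by simp
  also have "(\<Sum>j\<in>{Suc i..N}. g ^ j * z j) = (\<Sum>j\<in>{Suc i..N}. g ^ i * (g * (g ^ (j - Suc i) * z j)))"
  proof (rule sum.cong[OF refl])
    fix j assume "j \<in> {Suc i..N}"
    then have "g ^ j = g ^ i * (g * g ^ (j - Suc i))" by (simp flip: power_Suc power_add)
    then show "g ^ j * z j = g ^ i * (g * (g ^ (j - Suc i) * z j))" by (simp only: mult.assoc)
  qed
  also have "\<dots> = g ^ i * (g * u)" unfolding u_def sum_distrib_left ..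
  finally have fh: "g ^ i * (z i + g * u) = f * h" unfolding sum by (simp only: distrib_left)
  obtain m w where w: "z i = yv ^ m * w" "w $ 0 \<noteq> 0" using factor_y_power[OF zi] .
  have "w $ 0 $ a = z i $ m $ a" for a unfolding w(1) by (simp add: fps_X_power_mult_nth)
  moreover from this have "w $ 0 $ a = 0" if "a \<noteq> 0" for a using z_y[OF that] by simp
  ultimately have w00: "w $ 0 $ 0 \<noteq> 0" "z i $ m $ 0 \<noteq> 0" using w(2) by (metis fps_ext fps_zero_nth)+
  have "m mod d = 0" using graded_partD[OF z0 w00(2)] by simp
  then obtain e where e: "m = d * e" by auto
  have ym: "yv ^ m = (yv ^ d :: 'k fps fps) ^ e" unfolding e by (rule power_mult)
  have yp: "(yv ^ d) ^ e \<in> graded_part d 0" "(yv ^ d) ^ e \<noteq> (0 :: 'k fps fps)"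
    by (auto intro: graded_part_power_0)
  have "w \<in> graded_part d 0"
    by (rule graded_part_cancel[OF yp]) (use z0[of i] w(1) ym in simp)
  then obtain w' where w': "w' \<in> graded_part d 0" "w * w' = 1" using unit_if_constant_nonzero w00 by blast
  have "g ^ i * ((yv ^ d) ^ e + g * (u * w')) = g ^ i * ((yv ^ d) ^ e * (w * w') + g * (u * w'))"
    unfolding w'(2) by simp
  also have "\<dots> = g ^ i * (z i + g * u) * w'" unfolding w(1) ym by (simp only: distrib_left distrib_right mult.assoc)
  also have "\<dots> = f * (h * w')" unfolding fh by (rule mult.assoc)
  finally have eq: "g ^ i * ((yv ^ d) ^ e + g * (u * w')) = f * (h * w')" .
  have h0: "h \<in> graded_part d 0" by (simp add: h_def)
  show ?thesis
    by (rule that[OF graded_part_mult_0[OF u0 w'(1)] graded_part_mult_0[OF h0 w'(1)] eq])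
qed

section \<open>Krull dimension\<close>

lemma primeideal_power:
  fixes P :: "'k::field fps fps set"
  assumes d: "d > 0" and P: "primeideal P (veronese_ring d)" and f: "f \<in> graded_part d 0" "f ^ n \<in> P"
  shows "f \<in> P"
  using f(2)
proof (induction n)
  case 0
  interpret P: primeideal P "veronese_ring d :: 'k fps fps ring" by (rule P)
  have "1 \<in> P" using 0 by simp
  then have "P = carrier (veronese_ring d)" using P.one_imp_carrier by simp
  then show ?case using f(1) carrier_veronese_ring[OF d] by blast
next
  case (Suc n)
  have "f \<otimes>\<^bsub>veronese_ring d\<^esub> f ^ n \<in> P" using Suc.prems by simp
  then have "f \<in> P \<or> f ^ n \<in> P"
    by (rule primeideal.I_prime[OF P, rotated 2]) (use f(1) graded_part_power_0[OF f(1)] carrier_veronese_ring[OF d] in auto)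
  then show ?case using Suc.IH by blast
qed

lemma primeideal_mult:
  fixes P :: "'k::field fps fps set"
  assumes d: "d > 0" and P: "primeideal P (veronese_ring d)"
    and "f \<in> graded_part d 0" "g \<in> graded_part d 0" "f * g \<in> P"
  shows "f \<in> P \<or> g \<in> P"
  using primeideal.I_prime[OF P, of f g] assms(3-5) by (simp add: carrier_veronese_ring[OF d])

lemma proper_ideal_constant_zero:
  fixes P :: "'k::field fps fps set"
  assumes d: "d > 0" and P: "ideal P (veronese_ring d)" "P \<noteq> graded_part d 0" and f: "f \<in> P"
  shows "f $ 0 $ 0 = 0"
proof (rule ccontr)
  assume "f $ 0 $ 0 \<noteq> 0"
  moreover have f0: "f \<in> graded_part d 0" using ideal_veronese_ringD(1)[OF d P(1)] f by blast
  ultimately obtain g where g: "g \<in> graded_part d 0" "f * g = 1" using unit_if_constant_nonzero by blast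
  have "g * f \<in> P" by (rule ideal_veronese_ringD(5)[OF d P(1) g(1) f])
  then have "1 \<in> P" using g(2) by (simp only: mult.commute)
  then have "r \<in> P" if "r \<in> graded_part d 0" for r
    using ideal_veronese_ringD(5)[OF d P(1) that, of 1] by simp
  then show False using P(2) ideal_veronese_ringD(1)[OF d P(1)] by blast
qed

lemma maximal_if_contains_xy:
  fixes P :: "'k::field fps fps set"
  assumes d: "d > 0" and P: "primeideal P (veronese_ring d)"
    and x: "xv ^ d \<in> P" and y: "yv ^ d \<in> P" and f: "f \<in> graded_part d 0" "f $ 0 $ 0 = 0"
  shows "f \<in> P"
proof -
  note I = ideal_veronese_ringD[OF d primeideal.axioms(1)[OF P]]
  obtain s t where st: "s \<in> graded_part d 0" "t \<in> graded_part d 0" "f ^ (d * d) = xv ^ d * s + yv ^ d * t"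
    using power_in_xy_ideal[OF d f] .
  have "s * xv ^ d + t * yv ^ d \<in> P" using I(3)[OF I(5)[OF st(1) x] I(5)[OF st(2) y]] .
  then have "f ^ (d * d) \<in> P" unfolding st(3) by (simp only: mult.commute)
  then show ?thesis by (rule primeideal_power[OF d P f(1)])
qed

text \<open>Up to a power of \<open>y\<close>, a non-zero element of \<open>P\<close> does not vanish at \<open>y = 0\<close>, so \<open>P\<close> contains \<open>y\<^sup>d\<close> or an element
  that does not vanish there. In the first case, an element \<open>g\<close> of \<open>Q\<close> outside \<open>P\<close> does not vanish at \<open>y = 0\<close>. In the
  second case, elimination shows that \<open>Q\<close> contains a power of \<open>y\<^sup>d\<close>. A power of \<open>x\<^sup>d\<close> is in \<open>Q\<close> in both cases.\<close>

lemma prime_above_nonzero_prime: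
  fixes P Q :: "'k::field fps fps set"
  assumes d: "d > 0" and P: "primeideal P (veronese_ring d)" and Q: "primeideal Q (veronese_ring d)"
    and PQ: "P \<subset> Q" and nz: "f \<in> P" "f \<noteq> 0"
  shows "xv ^ d \<in> Q" "yv ^ d \<in> Q"
proof -
  note IP = ideal_veronese_ringD[OF d primeideal.axioms(1)[OF P]]
  note IQ = ideal_veronese_ringD[OF d primeideal.axioms(1)[OF Q]]
  obtain g where g: "g \<in> Q" "g \<notin> P" using PQ by blast
  have g0: "g \<in> graded_part d 0" using g(1) IQ(1) by blast
  have f0: "f \<in> graded_part d 0" using nz(1) IP(1) by blast
  obtain c f' where f': "f = yv ^ c * f'" "f' $ 0 \<noteq> 0" using factor_y_power[OF nz(2)] .
  have fd: "f ^ d = (yv ^ d) ^ c * f' ^ d" unfolding f'(1) power_mult_distrib by (simp only: power_mult[symmetric] mult.commute)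
  have yp: "(yv ^ d) ^ c \<in> graded_part d 0" "(yv ^ d) ^ c \<noteq> (0 :: 'k fps fps)" by (auto intro: graded_part_power_0)
  have f'd: "f' ^ d \<in> graded_part d 0"
    by (rule graded_part_cancel[OF yp]) (use graded_part_power_0[OF f0, of d] fd in simp)
  have "xv ^ d \<in> Q \<and> yv ^ d \<in> Q"
  proof (cases "yv ^ d \<in> P")
    case True
    obtain s where s: "s \<in> graded_part d 0" "(g - fps_const (g $ 0)) ^ d = yv ^ d * s" using row_power_mod_y[OF g0] .
    have "s * yv ^ d \<in> P" using IP(5)[OF s(1) True] .
    then have "(g - fps_const (g $ 0)) ^ d \<in> P" unfolding s(2) by (simp only: mult.commute)
    then have "g - fps_const (g $ 0) \<in> P"
      using primeideal_power[OF d P graded_part_diff[OF g0 row_part_in[OF g0]]] by blast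
    then have "g $ 0 \<noteq> 0" using g(2) by auto
    obtain e s t where st: "s \<in> graded_part d 0" "t \<in> graded_part d 0" "(xv ^ d) ^ e = yv ^ d * s + g * t"
      using x_power_in_ideal[OF g0 \<open>g $ 0 \<noteq> 0\<close>] .
    have yQ: "yv ^ d \<in> Q" using True PQ by blast
    have "s * yv ^ d + t * g \<in> Q" using IQ(3)[OF IQ(5)[OF st(1) yQ] IQ(5)[OF st(2) g(1)]] .
    then have "(xv ^ d) ^ e \<in> Q" unfolding st(3) by (simp only: mult.commute)
    then show ?thesis using primeideal_power[OF d Q xv_power_d] yQ by blast
  next
    case False
    let ?F = "f' ^ d"
    have "(yv ^ d) ^ c * ?F \<in> P"
    proof -
      have "f ^ (d - 1) * f \<in> P" by (rule IP(5)[OF graded_part_power_0[OF f0] nz(1)])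
      then show ?thesis unfolding fd[symmetric] using d by (cases d) (simp_all add: mult.commute)
    qed
    moreover have "(yv ^ d) ^ c \<notin> P" using False primeideal_power[OF d P yv_power_d] by blast
    ultimately have FP: "?F \<in> P" using primeideal_mult[OF d P yp(1) f'd] by blast
    have F0: "?F $ 0 \<noteq> 0" using f'(2) by (simp add: fps_power_zeroth)
    obtain i e u h where el: "u \<in> graded_part d 0" "h \<in> graded_part d 0" "g ^ i * ((yv ^ d) ^ e + g * u) = ?F * h"
      using elimination[OF d f'd F0 g0] .
    have ye: "(yv ^ d) ^ e \<in> graded_part d 0" by (intro graded_part_power_0 yv_power_d)
    have "h * ?F \<in> P" using IP(5)[OF el(2) FP] .
    then have "g ^ i * ((yv ^ d) ^ e + g * u) \<in> P" unfolding el(3) by (simp only: mult.commute)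
    moreover have "g ^ i \<notin> P" using g(2) primeideal_power[OF d P g0] by blast
    ultimately have "(yv ^ d) ^ e + g * u \<in> P"
      using primeideal_mult[OF d P graded_part_power_0[OF g0] graded_part_add[OF ye graded_part_mult_0[OF g0 el(1)]]] by blast
    then have "(yv ^ d) ^ e + g * u \<in> Q" using PQ by blast
    moreover have "g * u \<in> Q" using IQ(5)[OF el(1) g(1)] by (simp only: mult.commute)
    ultimately have "((yv ^ d) ^ e + g * u) - g * u \<in> Q" by (rule IQ(4))
    then have yQ: "yv ^ d \<in> Q" using primeideal_power[OF d Q yv_power_d] by simp
    have FQ: "?F \<in> Q" using FP PQ by blast
    obtain e' s t where st: "s \<in> graded_part d 0" "t \<in> graded_part d 0" "(xv ^ d) ^ e' = yv ^ d * s + ?F * t"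
      using x_power_in_ideal[OF f'd F0] .
    have "s * yv ^ d + t * ?F \<in> Q" using IQ(3)[OF IQ(5)[OF st(1) yQ] IQ(5)[OF st(2) FQ]] .
    then have "(xv ^ d) ^ e' \<in> Q" unfolding st(3) by (simp only: mult.commute)
    then show ?thesis using primeideal_power[OF d Q xv_power_d] yQ by blast
  qed
  then show "xv ^ d \<in> Q" "yv ^ d \<in> Q" by blast+
qed

lemma prime_chain_length_le_2:
  fixes P :: "nat \<Rightarrow> 'k::field fps fps set"
  assumes d: "d > 0" and prime: "\<And>i. i \<le> n \<Longrightarrow> primeideal (P i) (veronese_ring d)"
    and chain: "\<And>i. i < n \<Longrightarrow> P i \<subset> P (Suc i)"
  shows "n \<le> 2"
proof (rule ccontr)
  assume n: "\<not> n \<le> 2"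
  note p = prime[of 0] prime[of 1] prime[of 2] prime[of 3]
  have 01: "P 0 \<subset> P 1" and 12: "P 1 \<subset> P 2" and 23: "P 2 \<subset> P 3"
    using chain[of 0] chain[of 1] chain[of 2] n by (simp_all add: numeral_2_eq_2 numeral_3_eq_3)
  have p1: "primeideal (P 1) (veronese_ring d)" and p2: "primeideal (P 2) (veronese_ring d)" and p3: "primeideal (P 3) (veronese_ring d)"
    and p0: "primeideal (P 0) (veronese_ring d)" using p n by simp_all
  have "0 \<in> P 0" using ideal_veronese_ringD(2)[OF d primeideal.axioms(1)[OF p0]] .
  then obtain f where f: "f \<in> P 1" "f \<noteq> 0" using 01 by blast
  note xy = prime_above_nonzero_prime[OF d p1 p2 12 f]
  obtain g where g: "g \<in> P 3" "g \<notin> P 2" using 23 by blast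
  have g0: "g \<in> graded_part d 0" using ideal_veronese_ringD(1)[OF d primeideal.axioms(1)[OF p3]] g(1) by blast
  have "P 3 \<noteq> graded_part d 0" using primeideal.I_notcarr[OF p3] carrier_veronese_ring[OF d, where 'a = 'k] by metis
  then have "g $ 0 $ 0 = 0" using proper_ideal_constant_zero[OF d primeideal.axioms(1)[OF p3]] g(1) by blast
  then show False using maximal_if_contains_xy[OF d p2 xy g0] g(2) by blast
qed

lemma primeideal_veronese_ringI:
  fixes P :: "'k::field fps fps set"
  assumes "d > 0" "ideal P (veronese_ring d)" "1 \<notin> P"
    and "\<And>f g. f \<in> graded_part d 0 \<Longrightarrow> g \<in> graded_part d 0 \<Longrightarrow> f * g \<in> P \<Longrightarrow> f \<in> P \<or> g \<in> P"
  shows "primeideal P (veronese_ring d)"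
proof (rule primeidealI[OF assms(2) cring_veronese_ring[OF assms(1)]])
  show "carrier (veronese_ring d) \<noteq> P" using assms(3) carrier_veronese_ring[OF assms(1)] graded_part_1 by blast
qed (use assms(4) carrier_veronese_ring[OF assms(1)] in auto)

lemma krull_dim_veronese_ring:
  assumes d: "d > 0"
  shows "krull_dim (veronese_ring d :: 'k::field fps fps ring) = 2"
proof (rule antisym)
  show "krull_dim (veronese_ring d :: 'k fps fps ring) \<le> 2"
    unfolding krull_dim_def
  proof (rule Sup_least)
    fix e assume "e \<in> {enat n |n. \<exists>P :: nat \<Rightarrow> 'k fps fps set.
      (\<forall>i\<le>n. primeideal (P i) (veronese_ring d)) \<and> (\<forall>i<n. P i \<subset> P (Suc i))}"
    then obtain n and P :: "nat \<Rightarrow> 'k fps fps set" where n: "e = enat n"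
      "\<And>i. i \<le> n \<Longrightarrow> primeideal (P i) (veronese_ring d)" "\<And>i. i < n \<Longrightarrow> P i \<subset> P (Suc i)" by auto
    have "n \<le> 2" by (rule prime_chain_length_le_2[of d n P, OF d n(2,3)])
    then show "e \<le> 2" using n(1) by (simp add: numeral_eq_enat)
  qed
  \<comment> \<open>The chain \<open>0 \<subset> y k\<lbrakk>x,y\<rbrakk> \<inter> R \<subset> m\<close>.\<close>
  define P where "P i = (if i = 0 then {0} else if i = 1 then {f \<in> graded_part d 0. f $ 0 = 0}
    else {f \<in> graded_part d 0. f $ 0 $ 0 = (0 :: 'k)})" for i :: nat
  have "primeideal (P i) (veronese_ring d)" if "i \<le> 2" for i
  proof -
    have "primeideal {0 :: 'k fps fps} (veronese_ring d)"
      by (rule primeideal_veronese_ringI[OF d ideal_veronese_ringI[OF d]]) auto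
    moreover have "primeideal {f \<in> graded_part d 0. f $ 0 = (0 :: 'k fps)} (veronese_ring d)"
      by (rule primeideal_veronese_ringI[OF d ideal_veronese_ringI[OF d]])
         (auto simp: graded_part_add graded_part_mult_0)
    moreover have "primeideal {f \<in> graded_part d 0. f $ 0 $ 0 = (0 :: 'k)} (veronese_ring d)"
      by (rule primeideal_veronese_ringI[OF d ideal_veronese_ringI[OF d]])
         (auto simp: graded_part_add graded_part_mult_0 fps_fps_mult_nth)
    ultimately show ?thesis unfolding P_def by simp
  qed
  moreover have "P i \<subset> P (Suc i)" if "i < 2" for i
  proof -
    have "P 0 \<subset> P 1"
    proof
      show "P 0 \<subseteq> P 1" by (auto simp: P_def)
      have "yv ^ d \<in> P 1" using d by (simp add: P_def fps_power_zeroth)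
      moreover have "yv ^ d \<notin> P 0" by (simp add: P_def)
      ultimately show "P 0 \<noteq> P 1" by metis
    qed
    moreover have "P 1 \<subset> P 2"
    proof
      show "P 1 \<subseteq> P 2" by (auto simp: P_def)
      have "(xv ^ d) $ 0 $ 0 = (0 :: 'k)" "(xv ^ d :: 'k fps fps) $ 0 \<noteq> 0"
        using d by (simp_all add: fps_power_zeroth xv_def)
      then have "xv ^ d \<in> P 2" "xv ^ d \<notin> P 1" by (simp_all add: P_def)
      then show "P 1 \<noteq> P 2" by metis
    qed
    ultimately show ?thesis using that by (cases i) (auto simp: numeral_2_eq_2)
  qed
  ultimately have "enat 2 \<in> {enat n |n. \<exists>P :: nat \<Rightarrow> 'k fps fps set.
      (\<forall>i\<le>n. primeideal (P i) (veronese_ring d)) \<and> (\<forall>i<n. P i \<subset> P (Suc i))}"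
    by (intro CollectI exI[of _ 2] exI[of _ P] conjI allI impI refl)
  then show "2 \<le> krull_dim (veronese_ring d :: 'k fps fps ring)"
    unfolding krull_dim_def numeral_eq_enat by (rule Sup_upper)
qed


section \<open>Depth\<close>

context veronese_module
begin

lemma seq_submodule_Nil: "seq_submodule M [] = {\<zero>}"
  unfolding seq_submodule_def by auto

lemma seq_submodule_single:
  assumes "a \<in> G0"
  shows "seq_submodule M [a] = {a \<odot> v | v. v \<in> C}"
proof -
  have eq: "(\<Oplus>i\<in>{..<length [a]}. ([a] ! i) \<odot> v i) = a \<odot> v 0" if "v 0 \<in> C" for v
    using that assms by (simp add: lessThan_Suc)
  show ?thesis
  proof (intro equalityI subsetI)
    fix w assume "w \<in> seq_submodule M [a]"
    then obtain v where "v \<in> {..<length [a]} \<rightarrow> C" "w = (\<Oplus>i\<in>{..<length [a]}. ([a] ! i) \<odot> v i)"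
      unfolding seq_submodule_def by blast
    then show "w \<in> {a \<odot> v | v. v \<in> C}" using eq[of v] by auto
  next
    fix w assume "w \<in> {a \<odot> v | v. v \<in> C}"
    then obtain v where "v \<in> C" "w = a \<odot> v" by blast
    then show "w \<in> seq_submodule M [a]" unfolding seq_submodule_def
      using eq[of "\<lambda>_. v"] by (intro CollectI exI[of _ "\<lambda>_. v"] conjI) auto
  qed
qed

lemma seq_submodule_pair:
  assumes "a \<in> G0" "b \<in> G0"
  shows "seq_submodule M [a, b] = {a \<odot> v \<oplus> b \<odot> w | v w. v \<in> C \<and> w \<in> C}"
proof -
  have eq: "(\<Oplus>i\<in>{..<length [a, b]}. ([a, b] ! i) \<odot> v i) = a \<odot> v 0 \<oplus> b \<odot> v 1" if "v 0 \<in> C" "v 1 \<in> C" for v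
    using that assms by (simp add: lessThan_Suc M.a_comm)
  show ?thesis
  proof (intro equalityI subsetI)
    fix u assume "u \<in> seq_submodule M [a, b]"
    then obtain v where v: "v \<in> {..<length [a, b]} \<rightarrow> C" "u = (\<Oplus>i\<in>{..<length [a, b]}. ([a, b] ! i) \<odot> v i)"
      unfolding seq_submodule_def by blast
    have "v 0 \<in> C" "v 1 \<in> C" using v(1) by auto
    then show "u \<in> {a \<odot> v \<oplus> b \<odot> w | v w. v \<in> C \<and> w \<in> C}" using eq[of v] v(2) by auto
  next
    fix u assume "u \<in> {a \<odot> v \<oplus> b \<odot> w | v w. v \<in> C \<and> w \<in> C}"
    then obtain v w where vw: "v \<in> C" "w \<in> C" "u = a \<odot> v \<oplus> b \<odot> w" by blast
    define f where "f i = (if i = 0 then v else w)" for i :: nat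
    have "f 0 \<in> C" "f 1 \<in> C" "f 0 = v" "f 1 = w" using vw by (simp_all add: f_def)
    then have "u = (\<Oplus>i\<in>{..<length [a, b]}. ([a, b] ! i) \<odot> f i) \<and> f \<in> {..<length [a, b]} \<rightarrow> C"
      using eq[of f] vw by (auto simp: f_def)
    then show "u \<in> seq_submodule M [a, b]" unfolding seq_submodule_def by blast
  qed
qed

lemma seq_submodule_unit:
  assumes xs: "set xs \<subseteq> G0" and i: "i < length xs" "(xs ! i) $ 0 $ 0 \<noteq> 0"
  shows "seq_submodule M xs = C"
proof (intro equalityI subsetI)
  have xsi: "xs ! j \<in> G0" if "j < length xs" for j using xs that nth_mem by blast
  fix w assume "w \<in> seq_submodule M xs"
  then obtain v where v: "v \<in> {..<length xs} \<rightarrow> C" "w = (\<Oplus>i\<in>{..<length xs}. (xs ! i) \<odot> v i)"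
    unfolding seq_submodule_def by blast
  show "w \<in> C" unfolding v(2) by (rule M.finsum_closed) (use v(1) xsi in auto)
next
  have xsi: "xs ! j \<in> G0" if "j < length xs" for j using xs that nth_mem by blast
  fix w assume w: "w \<in> C"
  obtain g where g: "g \<in> G0" "xs ! i * g = 1" using unit_if_constant_nonzero[OF i(2) xsi[OF i(1)]] .
  define v where "v j = (if j = i then g \<odot> w else \<zero>)" for j
  have "(\<Oplus>j\<in>{..<length xs}. (xs ! j) \<odot> v j) = (\<Oplus>j\<in>{..<length xs}. if i = j then (xs ! j) \<odot> (g \<odot> w) else \<zero>)"
    by (rule M.finsum_cong'[OF refl]) (use xsi g w in \<open>auto simp: v_def\<close>)
  also have "\<dots> = (xs ! i) \<odot> (g \<odot> w)"
    by (rule M.finsum_singleton) (use i xsi g w in auto)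
  also have "\<dots> = w" using sm_mult[OF xsi[OF i(1)] g(1) w] g(2) w by simp
  finally have "w = (\<Oplus>j\<in>{..<length xs}. (xs ! j) \<odot> v j)" ..
  moreover have "v \<in> {..<length xs} \<rightarrow> C" using g w by (auto simp: v_def)
  ultimately show "w \<in> seq_submodule M xs" unfolding seq_submodule_def by blast
qed

lemma regular_sequence_constant_zero:
  assumes "regular_sequence (veronese_ring d) M xs" "i < length xs"
  shows "xs ! i \<in> G0" "(xs ! i) $ 0 $ 0 = 0"
proof -
  have xs: "set xs \<subseteq> G0" "seq_submodule M xs \<noteq> C" using assms(1) unfolding regular_sequence_def carrR by blast+
  show "xs ! i \<in> G0" using xs(1) assms(2) nth_mem by blast
  show "(xs ! i) $ 0 $ 0 = 0" using seq_submodule_unit[OF xs(1) assms(2)] xs(2) by blast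
qed

lemma regular_sequenceD:
  assumes "regular_sequence (veronese_ring d) M xs" "i < length xs" "v \<in> C" "(xs ! i) \<odot> v \<in> seq_submodule M (take i xs)"
  shows "v \<in> seq_submodule M (take i xs)"
  using assms unfolding regular_sequence_def by blast

lemma regular_pair_of_sequence:
  assumes reg: "regular_sequence (veronese_ring d) M xs" and len: "length xs \<ge> 2"
  shows "regular_pair (xs ! 0) (xs ! 1)"
proof -
  have a: "xs ! 0 \<in> G0" "(xs ! 0) $ 0 $ 0 = 0" by (rule regular_sequence_constant_zero[OF reg]; use len in linarith)+
  have b: "xs ! 1 \<in> G0" "(xs ! 1) $ 0 $ 0 = 0" by (rule regular_sequence_constant_zero[OF reg]; use len in linarith)+
  have t1: "take 1 xs = [xs ! 0]" using len by (cases xs) auto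
  have 1: "v = \<zero>" if "v \<in> C" "xs ! 0 \<odot> v = \<zero>" for v
  proof -
    have "0 < length xs" using len by linarith
    from regular_sequenceD[OF reg this that(1)] show ?thesis using that(2) by (simp add: seq_submodule_Nil)
  qed
  have 2: "\<exists>u\<in>C. v = xs ! 0 \<odot> u" if "v \<in> C" "w \<in> C" "xs ! 1 \<odot> v = xs ! 0 \<odot> w" for v w
  proof -
    have "1 < length xs" using len by simp
    from regular_sequenceD[OF reg this that(1)] show ?thesis
      using that(2,3) unfolding t1 seq_submodule_single[OF a(1)] by blast
  qed
  show ?thesis unfolding regular_pair_def using a b 1 2 by blast
qed

lemma regular_pair_of_depth:
  assumes "module_depth (veronese_ring d) M \<ge> 2"
  shows "\<exists>a b. regular_pair a b"
proof -
  have "\<exists>xs. regular_sequence (veronese_ring d) M xs \<and> length xs \<ge> 2"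
  proof (rule ccontr)
    assume no: "\<not> ?thesis"
    have "module_depth (veronese_ring d) M \<le> 1"
      unfolding module_depth_def
    proof (rule Sup_least)
      fix e assume "e \<in> {enat (length xs) |xs. regular_sequence (veronese_ring d) M xs}"
      then obtain xs where "e = enat (length xs)" "regular_sequence (veronese_ring d) M xs" by blast
      then show "e \<le> 1" using no by (force simp: one_enat_def)
    qed
    then have "(2 :: enat) \<le> 1" using assms by (rule order_trans[rotated])
    then show False by (simp add: numeral_eq_enat one_enat_def)
  qed
  then show ?thesis using regular_pair_of_sequence by blast
qed

end

lemma power_regular_modulo:
  fixes a b :: "'k::field fps fps"
  assumes b: "b \<in> graded_part d 0"
    and reg: "\<forall>v\<in>graded_part d j. \<forall>w\<in>graded_part d j. b * v = a * w \<longrightarrow> (\<exists>u\<in>graded_part d j. v = a * u)"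
    and "v \<in> graded_part d j" "w \<in> graded_part d j" "b ^ n * v = a * w"
  shows "\<exists>u\<in>graded_part d j. v = a * u"
  using assms(3-)
proof (induction n arbitrary: v w)
  case 0
    then show ?case by auto
  next
  case (Suc n)
    have "b * (b ^ n * v) = a * w" using Suc.prems(3) by (simp add: mult.assoc)
    from reg[rule_format, OF graded_part_mult_0[OF graded_part_power_0[OF b] Suc.prems(1)] Suc.prems(2) this]
    obtain u where "u \<in> graded_part d j" "b ^ n * v = a * u" by blast
    then show ?case using Suc.IH Suc.prems(1) by blast
  qed

text \<open>If \<open>a, b\<close> is regular on \<open>S\<^sub>j\<close> and \<open>a\<close> does not vanish at \<open>y = 0\<close>, then the module \<open>S\<^sub>j / (a, b) S\<^sub>j\<close> is
  annihilated by powers of \<open>x\<^sup>d\<close> and \<open>y\<^sup>d\<close>: elimination gives \<open>b\<^sup>i (y\<^sup>d\<^sup>e + b u) = a h\<close>, and the factor \<open>b\<^sup>i\<close> can be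
  cancelled modulo \<open>a\<close>.\<close>

lemma xy_powers_in_pair:
  fixes a b :: "'k::field fps fps"
  assumes d: "d > 0" and ab: "a \<in> graded_part d 0" "b \<in> graded_part d 0" "a $ 0 \<noteq> 0"
    and reg: "\<forall>v\<in>graded_part d j. \<forall>w\<in>graded_part d j. b * v = a * w \<longrightarrow> (\<exists>u\<in>graded_part d j. v = a * u)"
  shows "\<exists>e. \<forall>v\<in>graded_part d j. \<exists>s\<in>graded_part d j. \<exists>t\<in>graded_part d j. (yv ^ d) ^ e * v = a * s + b * t"
    "\<exists>e. \<forall>v\<in>graded_part d j. \<exists>s\<in>graded_part d j. \<exists>t\<in>graded_part d j. (xv ^ d) ^ e * v = a * s + b * t"
proof -
  let ?P = "graded_part d j :: 'k fps fps set"
  note regp = power_regular_modulo[OF ab(2) reg]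
  obtain i e u h where el: "u \<in> graded_part d 0" "h \<in> graded_part d 0" "b ^ i * ((yv ^ d) ^ e + b * u) = a * h"
    using elimination[OF d ab(1,3,2)] .
  have ye: "(yv ^ d) ^ e \<in> graded_part d 0" by (intro graded_part_power_0 yv_power_d)
  have Y: "\<exists>s\<in>?P. \<exists>t\<in>?P. (yv ^ d) ^ e * v = a * s + b * t" if v: "v \<in> ?P" for v
  proof -
    have "b ^ i * (((yv ^ d) ^ e + b * u) * v) = a * (h * v)" unfolding mult.assoc[symmetric] el(3) ..
    from regp[OF _ _ this] obtain w where w: "w \<in> ?P" "((yv ^ d) ^ e + b * u) * v = a * w"
      using v el(1,2) ye ab(2) graded_part_mult_0 graded_part_add by metis
    have "(yv ^ d) ^ e * v = a * w + b * (- (u * v))" using w(2) by (simp add: algebra_simps)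
    then show ?thesis using w(1) graded_part_uminus[OF graded_part_mult_0[OF el(1) v]] by blast
  qed
  then show "\<exists>e. \<forall>v\<in>?P. \<exists>s\<in>?P. \<exists>t\<in>?P. (yv ^ d) ^ e * v = a * s + b * t" by blast
  obtain e' s t where st: "s \<in> graded_part d 0" "t \<in> graded_part d 0" "(xv ^ d) ^ e' = yv ^ d * s + a * t"
    using x_power_in_ideal[OF ab(1,3)] .
  have ys: "yv ^ d * s \<in> graded_part d 0" by (intro graded_part_mult_0 st yv_power_d)
  have at: "a * t \<in> graded_part d 0" by (intro graded_part_mult_0 st ab)
  obtain t' where t': "t' \<in> graded_part d 0" "(yv ^ d * s + a * t) ^ e = (yv ^ d * s) ^ e + (yv ^ d * s + a * t - yv ^ d * s) * t'"
    using power_eq_power_plus_diff_mult[OF graded_part_add[OF ys at] ys] .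
  have "(xv ^ d) ^ (e' * e) = (yv ^ d) ^ e * s ^ e + a * (t * t')"
    unfolding power_mult[of _ e' e] st(3) t'(2) power_mult_distrib by (simp only: add_diff_cancel_left' mult.assoc)
  note X = this
  have "\<exists>s'\<in>?P. \<exists>t''\<in>?P. (xv ^ d) ^ (e' * e) * v = a * s' + b * t''" if v: "v \<in> ?P" for v
  proof -
    have "s ^ e * v \<in> ?P" by (rule graded_part_mult_0[OF graded_part_power_0[OF st(1)] v])
    then obtain p r where pr: "p \<in> ?P" "r \<in> ?P" "(yv ^ d) ^ e * (s ^ e * v) = a * p + b * r" using Y by blast
    have "(xv ^ d) ^ (e' * e) * v = (yv ^ d) ^ e * (s ^ e * v) + a * (t * t' * v)"
      unfolding X by (simp only: distrib_right mult.assoc)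
    also have "\<dots> = a * (p + t * t' * v) + b * r" unfolding pr(3) by (simp add: algebra_simps)
    finally show ?thesis
      using graded_part_add[OF pr(1) graded_part_mult_0[OF graded_part_mult_0[OF st(2) t'(1)] v]] pr(2) by blast
  qed
  then show "\<exists>e. \<forall>v\<in>?P. \<exists>s\<in>?P. \<exists>t\<in>?P. (xv ^ d) ^ e * v = a * s + b * t" by blast
qed

text \<open>Let \<open>a = y\<^sup>c a'\<close> with \<open>c > 0\<close> maximal. If \<open>y\<close> divided \<open>b\<close> as well, a power of \<open>b\<close> would multiply \<open>a'\<^sup>d x\<^sup>j\<close>
  into \<open>a S\<^sub>j\<close>, and regularity would make \<open>a'\<^sup>d x\<^sup>j\<close> divisible by \<open>y\<close>.\<close>

lemma pair_not_both_divisible_by_y: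
  fixes a b :: "'k::field fps fps"
  assumes d: "d > 0" and ab: "a \<in> graded_part d 0" "b \<in> graded_part d 0" "a \<noteq> 0"
    and reg: "\<forall>v\<in>graded_part d j. \<forall>w\<in>graded_part d j. b * v = a * w \<longrightarrow> (\<exists>u\<in>graded_part d j. v = a * u)"
    and a0: "a $ 0 = 0"
  shows "b $ 0 \<noteq> 0"
proof
  assume b0: "b $ 0 = 0"
  let ?P = "graded_part d j :: 'k fps fps set"
  note regp = power_regular_modulo[OF ab(2) reg]
  obtain c a' where a': "a = yv ^ c * a'" "a' $ 0 \<noteq> 0" using factor_y_power[OF ab(3)] .
  have c: "c \<noteq> 0" using a' a0 by (metis mult_1 power_0)
  have b_y: "b = yv * fps_shift 1 b" using split_constant_y[of b] b0 by simp
  have "yv * fps_shift 1 b \<in> graded_part d 0" using ab(2) unfolding b_y[symmetric] .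
  then obtain q where q: "q \<in> graded_part d 0" "b ^ d = yv ^ d * q"
    using power_d_of_multiple_of_y[of "fps_shift 1 b" d] unfolding b_y[symmetric] by blast
  have ad: "a ^ d = (yv ^ d) ^ c * a' ^ d" unfolding a'(1) power_mult_distrib by (simp only: power_mult[symmetric] mult.commute)
  have yp: "(yv ^ d) ^ c \<in> graded_part d 0" "(yv ^ d) ^ c \<noteq> (0 :: 'k fps fps)" by (auto intro: graded_part_power_0)
  have a'd: "a' ^ d \<in> graded_part d 0"
    by (rule graded_part_cancel[OF yp]) (use graded_part_power_0[OF ab(1), of d] ad in simp)
  define v where "v = a' ^ d * xv ^ j"
  have vP: "v \<in> ?P" unfolding v_def by (intro graded_part_mult_0 a'd xv_power_part)
  have "(yv ^ d) ^ c * a' ^ d = a * a ^ (d - 1)" unfolding ad[symmetric] using d by (cases d) simp_all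
  moreover have "(b ^ d) ^ c * v = ((yv ^ d) ^ c * a' ^ d) * (q ^ c * xv ^ j)"
    unfolding q(2) v_def power_mult_distrib by (simp only: mult_ac)
  ultimately have "b ^ (d * c) * v = a * (a ^ (d - 1) * (q ^ c * xv ^ j))"
    unfolding power_mult by (simp only: mult.assoc)
  moreover have "a ^ (d - 1) * (q ^ c * xv ^ j) \<in> ?P"
    by (intro graded_part_mult_0 graded_part_power_0 ab q xv_power_part)
  ultimately obtain u where "u \<in> ?P" "v = a * u" using regp[OF vP] by blast
  then have "v $ 0 = a $ 0 * u $ 0" by simp
  then have "v $ 0 = 0" using a0 by simp
  moreover have "v $ 0 \<noteq> 0" unfolding v_def using a'(2) by (simp add: fps_power_zeroth xv_def)
  ultimately show False by simp
qed

text \<open>If \<open>a, b, c\<close> were regular on \<open>S\<^sub>j\<close>, then \<open>c\<close> would be injective on \<open>S\<^sub>j / (a, b) S\<^sub>j\<close>, where some power of \<open>c\<close>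
  is zero. So \<open>S\<^sub>j = (a, b) S\<^sub>j\<close>, which is impossible, because multiplication by \<open>a\<close> or \<open>b\<close> raises degrees.\<close>

lemma regular_sequence_graded_module_length:
  fixes xs :: "'k::field fps fps list"
  assumes d: "d > 0" and reg: "regular_sequence (veronese_ring d) (graded_module d j) xs"
  shows "length xs \<le> 2"
proof (rule ccontr)
  assume "\<not> length xs \<le> 2"
  then have len: "length xs \<ge> 3" by simp
  let ?P = "graded_part d j :: 'k fps fps set"
  interpret N: veronese_module d "graded_module d j :: ('k fps fps, (nat \<Rightarrow> 'k fps fps) set) module"
    by (rule veronese_module.intro[OF d module_graded_module[OF d]])
  define a b c where "a = xs ! 0" and "b = xs ! 1" and "c = xs ! 2"
  have pair: "N.regular_pair a b" unfolding a_def b_def by (rule N.regular_pair_of_sequence[OF reg]) (use len in simp)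
  have a: "a \<in> graded_part d 0" "a $ 0 $ 0 = 0" and b: "b \<in> graded_part d 0" "b $ 0 $ 0 = 0"
    using pair unfolding N.regular_pair_def by simp_all
  have c: "c \<in> graded_part d 0" "c $ 0 $ 0 = 0"
    unfolding c_def by (rule N.regular_sequence_constant_zero[OF reg]; use len in linarith)+
  have xj: "xv ^ j \<in> ?P" by (rule xv_power_part)
  have a_ne: "a \<noteq> 0"
  proof
    assume "a = 0"
    moreover have "\<forall>v\<in>carrier (graded_module d j). a \<odot>\<^bsub>graded_module d j\<^esub> v = \<zero>\<^bsub>graded_module d j\<^esub> \<longrightarrow> v = \<zero>\<^bsub>graded_module d j\<^esub>"
      using pair unfolding N.regular_pair_def by (elim conjE)
    ultimately have "\<forall>v\<in>?P. v = 0" by auto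
    then have "xv ^ j = (0 :: 'k fps fps)" using xj by (rule bspec)
    then show False by simp
  qed
  have reg1: "\<forall>v\<in>?P. \<forall>w\<in>?P. b * v = a * w \<longrightarrow> (\<exists>u\<in>?P. v = a * u)"
  proof (intro ballI impI)
    fix v w assume that: "v \<in> ?P" "w \<in> ?P" "b * v = a * w"
    have "\<forall>v\<in>carrier (graded_module d j). \<forall>w\<in>carrier (graded_module d j).
        b \<odot>\<^bsub>graded_module d j\<^esub> v = a \<odot>\<^bsub>graded_module d j\<^esub> w \<longrightarrow> (\<exists>u\<in>carrier (graded_module d j). v = a \<odot>\<^bsub>graded_module d j\<^esub> u)"
      using pair unfolding N.regular_pair_def by (elim conjE)
    from this[rule_format, of "enc v" "enc w"] that show "\<exists>u\<in>?P. v = a * u" by auto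
  qed
  have t2: "take 2 xs = [a, b]" unfolding a_def b_def using len by (cases xs; cases "tl xs") (auto simp: numeral_2_eq_2)
  have sub: "seq_submodule (graded_module d j) (take 2 xs) = {enc (a * s + b * t) | s t. s \<in> ?P \<and> t \<in> ?P}"
    unfolding t2 N.seq_submodule_pair[OF a(1) b(1)]
  proof (intro equalityI subsetI)
    fix z assume "z \<in> {a \<odot>\<^bsub>graded_module d j\<^esub> v \<oplus>\<^bsub>graded_module d j\<^esub> b \<odot>\<^bsub>graded_module d j\<^esub> w | v w.
      v \<in> carrier (graded_module d j) \<and> w \<in> carrier (graded_module d j)}"
    then obtain v w where vw: "v \<in> carrier (graded_module d j)" "w \<in> carrier (graded_module d j)"
      "z = a \<odot>\<^bsub>graded_module d j\<^esub> v \<oplus>\<^bsub>graded_module d j\<^esub> b \<odot>\<^bsub>graded_module d j\<^esub> w" by blast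
    obtain s t where st: "s \<in> ?P" "v = enc s" "t \<in> ?P" "w = enc t" using vw(1,2) by auto
    have "z = enc (a * s + b * t)" unfolding vw(3) st(2,4) graded_module_simps ..
    then show "z \<in> {enc (a * s + b * t) | s t. s \<in> ?P \<and> t \<in> ?P}" using st(1,3) by blast
  next
    fix z assume "z \<in> {enc (a * s + b * t) | s t. s \<in> ?P \<and> t \<in> ?P}"
    then obtain s t where st: "s \<in> ?P" "t \<in> ?P" "z = enc (a * s + b * t)" by blast
    have "z = a \<odot>\<^bsub>graded_module d j\<^esub> enc s \<oplus>\<^bsub>graded_module d j\<^esub> b \<odot>\<^bsub>graded_module d j\<^esub> enc t"
      unfolding st(3) graded_module_simps ..
    moreover have "enc s \<in> carrier (graded_module d j)" "enc t \<in> carrier (graded_module d j)" using st(1,2) by simp_all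
    ultimately show "z \<in> {a \<odot>\<^bsub>graded_module d j\<^esub> v \<oplus>\<^bsub>graded_module d j\<^esub> b \<odot>\<^bsub>graded_module d j\<^esub> w | v w.
      v \<in> carrier (graded_module d j) \<and> w \<in> carrier (graded_module d j)}" by blast
  qed
  \<comment> \<open>The annihilator of \<open>S\<^sub>j / (a, b) S\<^sub>j\<close>.\<close>
  define I where "I = {r \<in> graded_part d 0. \<forall>v\<in>?P. \<exists>s\<in>?P. \<exists>t\<in>?P. r * v = a * s + b * t}"
  have I_add: "r + r' \<in> I" if rI: "r \<in> I" "r' \<in> I" for r r'
    unfolding I_def
  proof (intro CollectI conjI ballI)
    show "r + r' \<in> graded_part d 0" using rI graded_part_add unfolding I_def by blast
    fix v assume v: "v \<in> ?P"
    obtain s t where 1: "s \<in> ?P" "t \<in> ?P" "r * v = a * s + b * t" using rI(1) v unfolding I_def by blast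
    obtain s' t' where 2: "s' \<in> ?P" "t' \<in> ?P" "r' * v = a * s' + b * t'" using rI(2) v unfolding I_def by blast
    have "(r + r') * v = a * (s + s') + b * (t + t')" using 1(3) 2(3) by (simp add: algebra_simps)
    then show "\<exists>s\<in>?P. \<exists>t\<in>?P. (r + r') * v = a * s + b * t"
      using graded_part_add[OF 1(1) 2(1)] graded_part_add[OF 1(2) 2(2)] by blast
  qed
  have I_mult: "r * q \<in> I" if "r \<in> I" "q \<in> graded_part d 0" for r q
    unfolding I_def
  proof (intro CollectI conjI ballI)
    show "r * q \<in> graded_part d 0" using that graded_part_mult_0 unfolding I_def by blast
    fix v assume "v \<in> ?P"
    then have "q * v \<in> ?P" using graded_part_mult_0 that(2) by blast
    then show "\<exists>s\<in>?P. \<exists>t\<in>?P. r * q * v = a * s + b * t" using that(1) unfolding I_def mult.assoc by blast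
  qed
  have "\<exists>e e'. (yv ^ d) ^ e \<in> I \<and> (xv ^ d) ^ e' \<in> I"
  proof (cases "a $ 0 = 0")
    case False
    obtain e e' where "\<forall>v\<in>?P. \<exists>s\<in>?P. \<exists>t\<in>?P. (yv ^ d) ^ e * v = a * s + b * t"
        "\<forall>v\<in>?P. \<exists>s\<in>?P. \<exists>t\<in>?P. (xv ^ d) ^ e' * v = a * s + b * t"
      using xy_powers_in_pair[OF d a(1) b(1) False reg1] by blast
    then have "(yv ^ d) ^ e \<in> I" "(xv ^ d) ^ e' \<in> I"
      unfolding I_def by (auto intro: graded_part_power_0)
    then show ?thesis by blast
  next
    case True
    then have b0: "b $ 0 \<noteq> 0" using pair_not_both_divisible_by_y[OF d a(1) b(1) a_ne reg1] by blast
    have reg2: "\<forall>v\<in>?P. \<forall>w\<in>?P. a * v = b * w \<longrightarrow> (\<exists>u\<in>?P. v = b * u)"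
    proof (intro ballI impI)
      fix v w assume vw: "v \<in> ?P" "w \<in> ?P" "a * v = b * w"
      obtain u where u: "u \<in> ?P" "w = a * u" using reg1[rule_format, OF vw(2,1)] vw(3) by auto
      have "a * v = a * (b * u)" using vw(3) u(2) by (simp add: mult.left_commute)
      then have "v = b * u" using a_ne by simp
      then show "\<exists>u\<in>?P. v = b * u" using u(1) by blast
    qed
    have swap: "(\<exists>s\<in>?P. \<exists>t\<in>?P. z = b * s + a * t) \<Longrightarrow> (\<exists>s\<in>?P. \<exists>t\<in>?P. z = a * s + b * t)" for z
      by (metis add.commute)
    obtain e e' where "\<forall>v\<in>?P. \<exists>s\<in>?P. \<exists>t\<in>?P. (yv ^ d) ^ e * v = b * s + a * t"
        "\<forall>v\<in>?P. \<exists>s\<in>?P. \<exists>t\<in>?P. (xv ^ d) ^ e' * v = b * s + a * t"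
      using xy_powers_in_pair[OF d b(1) a(1) b0 reg2] by blast
    then have "(yv ^ d) ^ e \<in> I" "(xv ^ d) ^ e' \<in> I"
      unfolding I_def using swap by (auto intro: graded_part_power_0)
    then show ?thesis by blast
  qed
  then obtain e e' where y: "(yv ^ d) ^ e \<in> I" and x: "(xv ^ d) ^ e' \<in> I" by blast
  obtain s t where st: "s \<in> graded_part d 0" "t \<in> graded_part d 0" "c ^ (d * d) = xv ^ d * s + yv ^ d * t"
    using power_in_xy_ideal[OF d c] .
  define X Y where "X = xv ^ d * s" and "Y = yv ^ d * t"
  have XY: "X \<in> graded_part d 0" "Y \<in> graded_part d 0" unfolding X_def Y_def by (intro graded_part_mult_0 st xv_power_d yv_power_d)+
  have Ye: "Y ^ e \<in> I" unfolding Y_def power_mult_distrib by (rule I_mult[OF y graded_part_power_0[OF st(2)]])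
  have Xe: "X ^ e' \<in> I" unfolding X_def power_mult_distrib by (rule I_mult[OF x graded_part_power_0[OF st(1)]])
  obtain r where r: "r \<in> graded_part d 0" "(X + Y) ^ e = Y ^ e + (X + Y - Y) * r"
    using power_eq_power_plus_diff_mult[OF graded_part_add[OF XY] XY(2)] .
  have Xr: "X * r \<in> graded_part d 0" by (rule graded_part_mult_0[OF XY(1) r(1)])
  have XYe: "(X + Y) ^ e \<in> graded_part d 0" by (rule graded_part_power_0[OF graded_part_add[OF XY]])
  obtain r' where r': "r' \<in> graded_part d 0" "((X + Y) ^ e) ^ e' = (X * r) ^ e' + ((X + Y) ^ e - X * r) * r'"
    using power_eq_power_plus_diff_mult[OF XYe Xr] .
  have "((X + Y) ^ e) ^ e' = X ^ e' * r ^ e' + Y ^ e * r'"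
    using r'(2) unfolding r(2) power_mult_distrib by simp
  moreover have "X ^ e' * r ^ e' + Y ^ e * r' \<in> I"
    by (intro I_add I_mult Xe Ye graded_part_power_0 r r')
  moreover have "((X + Y) ^ e) ^ e' = c ^ (d * d * e * e')" unfolding X_def Y_def st(3)[symmetric] power_mult ..
  ultimately have cI: "c ^ (d * d * e * e') \<in> I" by simp
  have c_reg: "v \<in> {a * s + b * t | s t. s \<in> ?P \<and> t \<in> ?P}"
    if "v \<in> ?P" "c ^ n * v \<in> {a * s + b * t | s t. s \<in> ?P \<and> t \<in> ?P}" for n v
    using that
  proof (induction n arbitrary: v)
    case (Suc n)
    have "c ^ n * (c * v) \<in> {a * s + b * t | s t. s \<in> ?P \<and> t \<in> ?P}"
      using Suc.prems(2) by (simp only: power_Suc mult_ac)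
    then have "c * v \<in> {a * s + b * t | s t. s \<in> ?P \<and> t \<in> ?P}"
      using Suc.IH graded_part_mult_0[OF c(1) Suc.prems(1)] by blast
    then obtain s t where st: "s \<in> ?P" "t \<in> ?P" "c * v = a * s + b * t" by blast
    have "c \<odot>\<^bsub>graded_module d j\<^esub> enc v \<in> seq_submodule (graded_module d j) (take 2 xs)"
      unfolding sub graded_module_simps st(3) using st(1,2) by blast
    moreover have "2 < length xs" "enc v \<in> carrier (graded_module d j)" using len Suc.prems(1) by simp_all
    ultimately have "enc v \<in> seq_submodule (graded_module d j) (take 2 xs)"
      using N.regular_sequenceD[OF reg, of 2 "enc v", folded c_def] by blast
    then obtain s' t' where st': "s' \<in> ?P" "t' \<in> ?P" "enc v = enc (a * s' + b * t')" unfolding sub by blast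
    have "v = a * s' + b * t'" using st'(3) by (simp only: enc_eq_iff)
    then show ?case using st'(1,2) by blast
  qed simp
  have "carrier (graded_module d j) \<subseteq> seq_submodule (graded_module d j) (take 2 xs)"
    unfolding sub
  proof
    fix w :: "(nat \<Rightarrow> 'k fps fps) set" assume "w \<in> carrier (graded_module d j)"
    then obtain v where v: "v \<in> ?P" "w = enc v" by auto
    have "c ^ (d * d * e * e') * v \<in> {a * s + b * t | s t. s \<in> ?P \<and> t \<in> ?P}" using cI v(1) unfolding I_def by blast
    from c_reg[OF v(1) this] show "w \<in> {enc (a * s + b * t) | s t. s \<in> ?P \<and> t \<in> ?P}" using v(2) by blast
  qed
  note * = this
  have all: "\<exists>s\<in>?P. \<exists>t\<in>?P. v = a * s + b * t" if "v \<in> ?P" for v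
  proof -
    have "enc v \<in> carrier (graded_module d j)" using that by simp
    then have "enc v \<in> {enc (a * s + b * t) | s t. s \<in> ?P \<and> t \<in> ?P}" using * unfolding sub by blast
    then obtain s t where st: "s \<in> ?P" "t \<in> ?P" "enc v = enc (a * s + b * t)" by blast
    have "v = a * s + b * t" using st(3) by (simp only: enc_eq_iff)
    then show ?thesis using st(1,2) by blast
  qed
  \<comment> \<open>The smallest degree that occurs in \<open>S\<^sub>j\<close> is \<open>j mod d\<close>.\<close>
  have low: "(f * s) $ 0 $ (j mod d) = 0" if f: "f \<in> graded_part d 0" "f $ 0 $ 0 = 0" for f s :: "'k fps fps"
  proof -
    have "f $ 0 $ l = 0" if "l \<le> j mod d" for l
    proof (cases "l = 0")
      case False
      have "l mod d = l" using that d by (meson le_less_trans mod_less mod_less_divisor)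
      then show ?thesis using graded_partD[OF f(1), of 0 l] False by auto
    qed (use f(2) in simp)
    then show ?thesis unfolding fps_fps_mult_nth by (intro sum.neutral ballI) auto
  qed
  have "xv ^ (j mod d) \<in> ?P" using xv_power_part[of "j mod d" d] graded_part_cong[of "j mod d" d j, where 'a = 'k] by auto
  then obtain s t where "s \<in> ?P" "t \<in> ?P" "xv ^ (j mod d) = a * s + b * t" using all by blast
  then have "(xv ^ (j mod d)) $ 0 $ (j mod d) = (a * s) $ 0 $ (j mod d) + (b * t) $ 0 $ (j mod d)" by simp
  then have "(xv ^ (j mod d) :: 'k fps fps) $ 0 $ (j mod d) = 0" unfolding low[OF a] low[OF b] by simp
  then show False by (simp add: xv_def fps_const_power)
qed

section \<open>Maximal Cohen-Macaulay modules\<close>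

lemma MCM_graded_module_1:
  assumes d: "d \<ge> 2"
  shows "MCM_module (veronese_ring d) (graded_module d 1 :: ('k::field fps fps, (nat \<Rightarrow> 'k fps fps) set) module)"
proof -
  let ?N = "graded_module d 1 :: ('k fps fps, (nat \<Rightarrow> 'k fps fps) set) module"
  have d0: "d > 0" using d by simp
  interpret N: veronese_module d ?N by (rule veronese_module.intro[OF d0 module_graded_module[OF d0]])
  have ne: "enc xv \<noteq> enc (yv :: 'k fps fps)"
  proof
    assume "enc xv = enc (yv :: 'k fps fps)"
    then have "(xv :: 'k fps fps) $ 0 = yv $ 0" by (simp only: enc_eq_iff)
    then show False by (simp add: xv_def)
  qed
  have C: "enc xv \<in> carrier ?N" "enc yv \<in> carrier ?N" using xv_part yv_part by auto
  have span: "linear_span (veronese_ring d) ?N {enc xv, enc yv} = carrier ?N"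
  proof (intro equalityI subsetI)
    fix w assume "w \<in> linear_span (veronese_ring d) ?N {enc xv, enc yv}"
    then obtain F a where F: "finite F" "F \<subseteq> {enc xv, enc yv}" "a \<in> F \<rightarrow> graded_part d 0"
      "w = (\<Oplus>\<^bsub>?N\<^esub>s\<in>F. a s \<odot>\<^bsub>?N\<^esub> s)"
      unfolding linear_span_def N.carrR by blast
    have "a s \<odot>\<^bsub>?N\<^esub> s \<in> carrier ?N" if "s \<in> F" for s
      using F(2,3) C that by (intro N.sm_closed) auto
    then show "w \<in> carrier ?N" unfolding F(4) by (intro N.M.finsum_closed) blast
  next
    fix w assume "w \<in> carrier ?N"
    then obtain s where s: "s \<in> graded_part d (Suc 0)" "w = enc s" by auto
    have "s $ 0 $ 0 = 0" using graded_partD[OF s(1), of 0 0] d by force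
    then obtain s' s'' where ss: "s' \<in> graded_part d 0" "s'' \<in> graded_part d 0" "s = xv * s' + yv * s''"
      using split_xy[OF s(1)] by blast
    define a where "a u = (if u = enc xv then s' else s'')" for u :: "(nat \<Rightarrow> 'k fps fps) set"
    have a: "a u \<in> graded_part d 0" for u using ss by (simp add: a_def)
    have "(\<Oplus>\<^bsub>?N\<^esub>u\<in>{enc xv, enc yv}. a u \<odot>\<^bsub>?N\<^esub> u) = a (enc xv) \<odot>\<^bsub>?N\<^esub> enc xv \<oplus>\<^bsub>?N\<^esub> (\<Oplus>\<^bsub>?N\<^esub>u\<in>{enc yv}. a u \<odot>\<^bsub>?N\<^esub> u)"
      by (rule N.M.finsum_insert) (use ne C a N.sm_closed in \<open>auto simp del: graded_module_simps\<close>)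
    also have "(\<Oplus>\<^bsub>?N\<^esub>u\<in>{enc yv}. a u \<odot>\<^bsub>?N\<^esub> u) = a (enc yv) \<odot>\<^bsub>?N\<^esub> enc yv \<oplus>\<^bsub>?N\<^esub> (\<Oplus>\<^bsub>?N\<^esub>u\<in>{}. a u \<odot>\<^bsub>?N\<^esub> u)"
      by (rule N.M.finsum_insert) (use C a N.sm_closed in \<open>auto simp del: graded_module_simps\<close>)
    also have "(\<Oplus>\<^bsub>?N\<^esub>u\<in>{}. a u \<odot>\<^bsub>?N\<^esub> u) = enc 0" unfolding N.M.finsum_empty graded_module_simps ..
    also have "a (enc xv) \<odot>\<^bsub>?N\<^esub> enc xv \<oplus>\<^bsub>?N\<^esub> (a (enc yv) \<odot>\<^bsub>?N\<^esub> enc yv \<oplus>\<^bsub>?N\<^esub> enc 0) = w"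
      using ne by (simp add: a_def s(2) ss(3) mult.commute)
    finally have "w = (\<Oplus>\<^bsub>?N\<^esub>u\<in>{enc xv, enc yv}. a u \<odot>\<^bsub>?N\<^esub> u)" ..
    then show "w \<in> linear_span (veronese_ring d) ?N {enc xv, enc yv}"
      unfolding linear_span_def N.carrR using a by (intro CollectI exI[of _ "{enc xv, enc yv}"] exI[of _ a]) simp
  qed
  have fg: "fin_gen_module (veronese_ring d) ?N"
    unfolding fin_gen_module_def
  proof (intro conjI N.module_M exI[of _ "{enc xv, enc yv}"] span)
    show "{enc xv, enc yv} \<subseteq> carrier ?N" using C by simp
  qed simp
  have nz: "carrier ?N \<noteq> {\<zero>\<^bsub>?N\<^esub>}"
  proof
    assume "carrier ?N = {\<zero>\<^bsub>?N\<^esub>}"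
    then have "enc xv = enc (0 :: 'k fps fps)" using C(1) by simp
    then show False by simp
  qed
  have reg: "regular_sequence (veronese_ring d) ?N [yv ^ d, xv ^ d]"
    unfolding regular_sequence_def
  proof (intro conjI allI impI ballI)
    show "set [yv ^ d, xv ^ d] \<subseteq> carrier (veronese_ring d :: 'k fps fps ring)" by (simp add: N.carrR)
    show "seq_submodule ?N [yv ^ d, xv ^ d] \<noteq> carrier ?N"
    proof
      assume "seq_submodule ?N [yv ^ d, xv ^ d] = carrier ?N"
      then have "enc xv \<in> {yv ^ d \<odot>\<^bsub>?N\<^esub> v \<oplus>\<^bsub>?N\<^esub> xv ^ d \<odot>\<^bsub>?N\<^esub> w | v w. v \<in> carrier ?N \<and> w \<in> carrier ?N}"
        using C(1) unfolding N.seq_submodule_pair[OF yv_power_d xv_power_d] by (simp only:)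
      then obtain v w where vw: "v \<in> carrier ?N" "w \<in> carrier ?N" "enc xv = yv ^ d \<odot>\<^bsub>?N\<^esub> v \<oplus>\<^bsub>?N\<^esub> xv ^ d \<odot>\<^bsub>?N\<^esub> w" by blast
      obtain s t where "v = enc s" "w = enc t" using vw(1,2) by auto
      then have eq: "xv = yv ^ d * s + xv ^ d * t" using vw(3) by simp
      have "xv $ 0 $ 1 = (yv ^ d * s) $ 0 $ 1 + (xv ^ d * t) $ 0 $ 1"
        using arg_cong[OF eq, of "\<lambda>f. f $ 0 $ 1"] by (simp only: fps_add_nth)
      moreover have "(yv ^ d * s) $ 0 $ 1 = 0" using d by (simp add: fps_X_power_mult_nth)
      moreover have "(xv ^ d * t) $ 0 $ 1 = 0" using d by (simp add: xv_def fps_const_power fps_X_power_mult_nth)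
      ultimately show False by (simp add: xv_def)
    qed
    fix i v assume i: "i < length [yv ^ d, xv ^ d :: 'k fps fps]" and v: "v \<in> carrier ?N"
      and mem: "([yv ^ d, xv ^ d] ! i) \<odot>\<^bsub>?N\<^esub> v \<in> seq_submodule ?N (take i [yv ^ d, xv ^ d])"
    obtain s where s: "s \<in> graded_part d 1" "v = enc s" using v by auto
    consider "i = 0" | "i = 1" using i by fastforce
    then show "v \<in> seq_submodule ?N (take i [yv ^ d, xv ^ d])"
    proof cases
      case 1
      then have "yv ^ d \<odot>\<^bsub>?N\<^esub> v \<in> {\<zero>\<^bsub>?N\<^esub>}" using mem by (simp only: nth_Cons_0 take_0 N.seq_submodule_Nil)
      then have "yv ^ d * s = 0" using s by simp
      then have "s = 0" by simp
      then show ?thesis unfolding 1 take_0 N.seq_submodule_Nil s(2) by simp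
    next
      case 2
      have t1: "take i [yv ^ d, xv ^ d] = [yv ^ d :: 'k fps fps]" using 2 by simp
      have "xv ^ d \<odot>\<^bsub>?N\<^esub> v \<in> {yv ^ d \<odot>\<^bsub>?N\<^esub> w | w. w \<in> carrier ?N}"
        using mem 2 unfolding t1 N.seq_submodule_single[OF yv_power_d] by simp
      then obtain w where "w \<in> carrier ?N" "xv ^ d \<odot>\<^bsub>?N\<^esub> v = yv ^ d \<odot>\<^bsub>?N\<^esub> w" by blast
      then obtain t where t: "xv ^ d * s = yv ^ d * t" using s by auto
      have "s $ n = 0" if "n < d" for n
      proof -
        have "fps_X ^ d * s $ n = (yv ^ d * t) $ n" using t[symmetric] by (simp add: xv_def fps_const_power)
        then show ?thesis using that by (simp add: fps_X_power_mult_nth)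
      qed
      then have s_eq: "s = yv ^ d * fps_shift d s"
        by (intro fps_ext) (simp add: fps_X_power_mult_nth)
      have "fps_shift d s \<in> graded_part d 1"
      proof (rule graded_part_cancel[OF yv_power_d])
        show "yv ^ d \<noteq> (0 :: 'k fps fps)" by simp
        show "yv ^ d * fps_shift d s \<in> graded_part d (0 + 1)" using s(1) s_eq by simp
      qed
      then have "enc (fps_shift d s) \<in> carrier ?N" by simp
      moreover have "v = yv ^ d \<odot>\<^bsub>?N\<^esub> enc (fps_shift d s)" unfolding s(2) graded_module_simps s_eq[symmetric] ..
      ultimately show ?thesis unfolding t1 N.seq_submodule_single[OF yv_power_d] by blast
    qed
  qed
  have "module_depth (veronese_ring d) ?N = 2"
  proof (rule antisym)
    show "module_depth (veronese_ring d) ?N \<le> 2"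
      unfolding module_depth_def
    proof (rule Sup_least)
      fix e assume "e \<in> {enat (length xs) |xs. regular_sequence (veronese_ring d) ?N xs}"
      then obtain xs where "e = enat (length xs)" "regular_sequence (veronese_ring d) ?N xs" by blast
      then show "e \<le> 2" using regular_sequence_graded_module_length[OF d0] by (simp add: numeral_eq_enat)
    qed
    have "enat (length [yv ^ d, xv ^ d :: 'k fps fps]) \<in> {enat (length xs) |xs. regular_sequence (veronese_ring d) ?N xs}"
      using reg by blast
    then have "enat (length [yv ^ d, xv ^ d :: 'k fps fps]) \<le> module_depth (veronese_ring d) ?N"
      unfolding module_depth_def by (rule Sup_upper)
    then show "2 \<le> module_depth (veronese_ring d) ?N" by (simp add: numeral_eq_enat numeral_2_eq_2)
  qed
  then show ?thesis
    unfolding MCM_module_def using fg nz krull_dim_veronese_ring[OF d0, where 'k = 'k] by simp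
qed

lemma MCM_split_surjection:
  fixes M :: "('k::field fps fps, 'm) module"
  assumes d: "d > 0" and M: "MCM_module (veronese_ring d) M"
  shows "veronese_module d M"
    "\<exists>j<d. \<exists>p q. split_summand d M j p q"
proof -
  have modM: "Module.module (veronese_ring d) M" and nz: "carrier M \<noteq> {\<zero>\<^bsub>M\<^esub>}"
    using M unfolding MCM_module_def fin_gen_module_def by blast+
  show vM: "veronese_module d M" by (rule veronese_module.intro[OF d modM])
  interpret veronese_module d M by (rule vM)
  have fg: finitely_generated
    using M unfolding MCM_module_def fin_gen_module_def finitely_generated_def by blast
  have "module_depth (veronese_ring d) M = krull_dim (veronese_ring d :: 'k fps fps ring)"
    using M unfolding MCM_module_def by blast
  then have "2 \<le> module_depth (veronese_ring d) M" using krull_dim_veronese_ring[OF d, where 'k = 'k] by simp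
  then obtain a b where "regular_pair a b" using regular_pair_of_depth by blast
  note reg = yd_regular[OF fg this] xd_regular_mod_yd[OF fg this]
  show "\<exists>j<d. \<exists>p q. split_summand d M j p q"
    by (rule split_surjection[OF fg _ _ nz]) (use reg in blast)+
qed

lemma maximal_subset_test_ideal:
  fixes M :: "('k::field fps fps, 'm) module"
  assumes d: "d > 0" and M: "MCM_module (veronese_ring d) M" and r: "r \<in> graded_part d 0" "r $ 0 $ 0 = 0"
  shows "r \<in> test_ideal (veronese_ring d) M"
proof -
  interpret veronese_module d M by (rule MCM_split_surjection(1)[OF d M])
  obtain j p q where "j < d" "\<forall>u\<in>C. p u \<in> graded_part d j" "\<forall>u\<in>C. \<forall>v\<in>C. p (u \<oplus>\<^bsub>M\<^esub> v) = p u + p v"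
    "\<forall>r\<in>graded_part d 0. \<forall>u\<in>C. p (r \<odot>\<^bsub>M\<^esub> u) = r * p u"
    "\<forall>s\<in>graded_part d j. q s \<in> C" "\<forall>s\<in>graded_part d j. p (q s) = s"
    using MCM_split_surjection(2)[OF d M] unfolding split_summand_def by (elim exE conjE) (rule that)
  then show ?thesis using test_ideal_contains_maximal[of j p q r] r by simp
qed

text \<open>An indecomposable module is isomorphic to its summand, and the summand of degree \<open>0\<close> is free.\<close>

lemma indecomposable_MCM_isomorphic:
  fixes M :: "('k::field fps fps, 'm) module"
  assumes d: "d > 0" and M: "MCM_module (veronese_ring d) M" and ind: "indecomposable_module (veronese_ring d) M"
    and nf: "\<not> free_module (veronese_ring d) M"
  shows "\<exists>i q. 1 \<le> i \<and> i < d \<and> (\<forall>s\<in>graded_part d i. q s \<in> carrier M) \<and> carrier M \<subseteq> q ` graded_part d i \<and>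
    (\<forall>s\<in>graded_part d i. \<forall>t\<in>graded_part d i. q (s + t) = q s \<oplus>\<^bsub>M\<^esub> q t) \<and>
    (\<forall>r\<in>graded_part d 0. \<forall>s\<in>graded_part d i. q (r * s) = r \<odot>\<^bsub>M\<^esub> q s)"
proof -
  interpret veronese_module d M by (rule MCM_split_surjection(1)[OF d M])
  obtain j p q where j: "j < d" and p0: "\<forall>u\<in>C. p u \<in> graded_part d j" "\<forall>u\<in>C. \<forall>v\<in>C. p (u \<oplus>\<^bsub>M\<^esub> v) = p u + p v"
    "\<forall>r\<in>graded_part d 0. \<forall>u\<in>C. p (r \<odot>\<^bsub>M\<^esub> u) = r * p u"
    and q0: "\<forall>s\<in>graded_part d j. q s \<in> C" "\<forall>s\<in>graded_part d j. \<forall>t\<in>graded_part d j. q (s + t) = q s \<oplus>\<^bsub>M\<^esub> q t"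
    "\<forall>r\<in>graded_part d 0. \<forall>s\<in>graded_part d j. q (r * s) = r \<odot>\<^bsub>M\<^esub> q s" "\<forall>s\<in>graded_part d j. p (q s) = s"
    using MCM_split_surjection(2)[OF d M] unfolding split_summand_def by (elim exE conjE) (rule that)
  note p = p0[rule_format] and q = q0[rule_format]
  let ?P = "graded_part d j :: 'k fps fps set"
  have p_zero: "p \<zero>\<^bsub>M\<^esub> = 0" using p(3)[OF graded_part_0, of "\<zero>\<^bsub>M\<^esub>"] by simp
  have q_zero: "q 0 = \<zero>\<^bsub>M\<^esub>" using q(3)[OF graded_part_0 graded_part_0] q(1)[OF graded_part_0] by simp
  have minus1: "- 1 \<in> G0" by (simp add: graded_part_uminus)
  have neg: "\<ominus>\<^bsub>M\<^esub> u = - 1 \<odot>\<^bsub>M\<^esub> u" if "u \<in> C" for u using sm_minus_left[OF graded_part_1 that] that by simp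
  \<comment> \<open>The decomposition \<open>M = q(S\<^sub>j) \<oplus> ker p\<close>.\<close>
  define N1 N2 where "N1 = q ` ?P" and "N2 = {u \<in> C. p u = 0}"
  have s1: "submodule N1 (veronese_ring d) M"
  proof (rule submoduleI)
    show "N1 \<subseteq> C" unfolding N1_def using q(1) by blast
    show "\<zero>\<^bsub>M\<^esub> \<in> N1" unfolding N1_def using q_zero graded_part_0 by (metis image_eqI)
    show smult: "r \<odot>\<^bsub>M\<^esub> u \<in> N1" if "r \<in> carrier (veronese_ring d)" "u \<in> N1" for r u
    proof -
      obtain s where s: "s \<in> ?P" "u = q s" using \<open>u \<in> N1\<close> unfolding N1_def by blast
      have "r \<in> G0" using that(1) carrR by simp
      then have "r \<odot>\<^bsub>M\<^esub> u = q (r * s)" "r * s \<in> ?P" using q(3) s graded_part_mult_0 by auto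
      then show ?thesis unfolding N1_def by blast
    qed
    show "\<ominus>\<^bsub>M\<^esub> u \<in> N1" if "u \<in> N1" for u
    proof -
      have "u \<in> C" using that q(1) unfolding N1_def by blast
      then show ?thesis using neg smult[of "- 1" u] that minus1 carrR by simp
    qed
    show "u \<oplus>\<^bsub>M\<^esub> v \<in> N1" if "u \<in> N1" "v \<in> N1" for u v
    proof -
      obtain s t where st: "s \<in> ?P" "u = q s" "t \<in> ?P" "v = q t" using \<open>u \<in> N1\<close> \<open>v \<in> N1\<close> unfolding N1_def by blast
      have "u \<oplus>\<^bsub>M\<^esub> v = q (s + t)" using q(2)[OF st(1,3)] st by simp
      then show ?thesis unfolding N1_def using graded_part_add[OF st(1,3)] by blast
    qed
  qed
  have s2: "submodule N2 (veronese_ring d) M"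
  proof (rule submoduleI)
    show smult: "r \<odot>\<^bsub>M\<^esub> u \<in> N2" if "r \<in> carrier (veronese_ring d)" "u \<in> N2" for r u
      using that p(3) unfolding N2_def carrR by auto
    show "\<ominus>\<^bsub>M\<^esub> u \<in> N2" if "u \<in> N2" for u
    proof -
      have "u \<in> C" using that unfolding N2_def by blast
      then show ?thesis using neg smult[of "- 1" u] that minus1 carrR by simp
    qed
  qed (use p(2) p_zero in \<open>auto simp: N2_def\<close>)
  have diff: "u = q (p u) \<oplus>\<^bsub>M\<^esub> (u \<ominus>\<^bsub>M\<^esub> q (p u))" "u \<ominus>\<^bsub>M\<^esub> q (p u) \<in> N2" if u: "u \<in> C" for u
  proof -
    have qC: "q (p u) \<in> C" using q(1) p(1) u by blast
    show "u = q (p u) \<oplus>\<^bsub>M\<^esub> (u \<ominus>\<^bsub>M\<^esub> q (p u))"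
      using u qC by (simp add: a_minus_def M.a_comm[of u] M.r_neg2)
    have "p (u \<ominus>\<^bsub>M\<^esub> q (p u)) = p u + - 1 * p (q (p u))"
      unfolding a_minus_def neg[OF qC] using p(2)[OF u sm_closed[OF minus1 qC]] p(3)[OF minus1 qC] by simp
    also have "\<dots> = 0" using q(4)[OF p(1)[OF u]] by simp
    finally show "u \<ominus>\<^bsub>M\<^esub> q (p u) \<in> N2" unfolding N2_def using u qC by simp
  qed
  have sum: "N1 <+>\<^bsub>M\<^esub> N2 = C"
  proof (intro equalityI subsetI)
    fix u assume "u \<in> N1 <+>\<^bsub>M\<^esub> N2"
    then obtain u1 u2 where "u1 \<in> N1" "u2 \<in> N2" "u = u1 \<oplus>\<^bsub>M\<^esub> u2" unfolding set_add_def' by blast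
    then show "u \<in> C" using submoduleE(1)[OF s1] submoduleE(1)[OF s2] by blast
  next
    fix u assume u: "u \<in> C"
    have "q (p u) \<in> N1" unfolding N1_def using p(1)[OF u] by blast
    then show "u \<in> N1 <+>\<^bsub>M\<^esub> N2" unfolding set_add_def' using diff[OF u] by blast
  qed
  have int: "N1 \<inter> N2 = {\<zero>\<^bsub>M\<^esub>}"
  proof (intro equalityI subsetI)
    fix u assume "u \<in> N1 \<inter> N2"
    then obtain s where "s \<in> ?P" "u = q s" "p u = 0" unfolding N1_def N2_def by blast
    then show "u \<in> {\<zero>\<^bsub>M\<^esub>}" using q(4) q_zero by auto
  next
    fix u assume "u \<in> {\<zero>\<^bsub>M\<^esub>}"
    moreover have "\<zero>\<^bsub>M\<^esub> \<in> N1" unfolding N1_def using q_zero graded_part_0 by (metis image_eqI)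
    ultimately show "u \<in> N1 \<inter> N2" unfolding N2_def using p_zero by simp
  qed
  have "N1 \<noteq> {\<zero>\<^bsub>M\<^esub>}"
  proof
    assume "N1 = {\<zero>\<^bsub>M\<^esub>}"
    moreover have "q (xv ^ j) \<in> N1" unfolding N1_def using xv_power_part by blast
    ultimately have "p (q (xv ^ j)) = 0" using p_zero by simp
    then show False using q(4)[OF xv_power_part] by simp
  qed
  then have N2: "N2 = {\<zero>\<^bsub>M\<^esub>}" using ind s1 s2 sum int unfolding indecomposable_module_def by blast
  have qp: "u = q (p u)" if u: "u \<in> C" for u
  proof -
    have "u \<ominus>\<^bsub>M\<^esub> q (p u) = \<zero>\<^bsub>M\<^esub>" using diff(2)[OF u] N2 by blast
    then show ?thesis using diff(1)[OF u] q(1)[OF p(1)[OF u]] by simp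
  qed
  have "1 \<le> j"
  proof (rule ccontr)
    assume "\<not> 1 \<le> j"
    then have j0: "j = 0" by simp
    have q1: "q 1 \<in> C" using q(1) unfolding j0 by simp
    have q_eq: "q s = s \<odot>\<^bsub>M\<^esub> q 1" if "s \<in> G0" for s using q(3)[of s 1] that unfolding j0 by simp
    have single: "(\<Oplus>\<^bsub>M\<^esub>s\<in>{q 1}. a s \<odot>\<^bsub>M\<^esub> s) = a (q 1) \<odot>\<^bsub>M\<^esub> q 1" if "a (q 1) \<in> G0" for a
      using that q1 by simp
    have "free_module (veronese_ring d) M"
      unfolding free_module_def
    proof (intro conjI exI[of _ "{q 1}"] allI impI)
      show "Module.module (veronese_ring d) M" by (rule module_M)
      show "{q 1} \<subseteq> C" using q1 by simp
      show "linear_span (veronese_ring d) M {q 1} = C"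
      proof (intro equalityI subsetI)
        fix u assume "u \<in> linear_span (veronese_ring d) M {q 1}"
        then obtain F a where F: "F \<subseteq> {q 1}" "a \<in> F \<rightarrow> G0" "u = (\<Oplus>\<^bsub>M\<^esub>s\<in>F. a s \<odot>\<^bsub>M\<^esub> s)"
          unfolding linear_span_def carrR by blast
        show "u \<in> C" unfolding F(3) by (rule M.finsum_closed) (use F(1,2) q1 in auto)
      next
        fix u assume u: "u \<in> C"
        have pu: "p u \<in> G0" using p(1)[OF u] unfolding j0 .
        have "u = (\<Oplus>\<^bsub>M\<^esub>s\<in>{q 1}. (\<lambda>_. p u) s \<odot>\<^bsub>M\<^esub> s)"
          using single[of "\<lambda>_. p u", OF pu] q_eq[OF pu] qp[OF u] by simp
        then show "u \<in> linear_span (veronese_ring d) M {q 1}"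
          unfolding linear_span_def carrR using pu
          by (intro CollectI exI[of _ "{q 1}"] exI[of _ "\<lambda>_. p u"]) simp
      qed
    next
      fix F a
      assume F: "finite F \<and> F \<subseteq> {q 1} \<and> a \<in> F \<rightarrow> carrier (veronese_ring d) \<and> (\<Oplus>\<^bsub>M\<^esub>s\<in>F. a s \<odot>\<^bsub>M\<^esub> s) = \<zero>\<^bsub>M\<^esub>"
      show "\<forall>s\<in>F. a s = \<zero>\<^bsub>veronese_ring d\<^esub>"
      proof
        fix s assume s: "s \<in> F"
        then have F1: "F = {q 1}" "s = q 1" using F by auto
        then have a: "a (q 1) \<in> G0" using F carrR by auto
        then have "a (q 1) \<odot>\<^bsub>M\<^esub> q 1 = \<zero>\<^bsub>M\<^esub>" using F single unfolding F1 by simp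
        then have "p (q (a (q 1))) = 0" using q_eq[OF a] p_zero by simp
        then show "a s = \<zero>\<^bsub>veronese_ring d\<^esub>" using q(4)[of "a (q 1)"] a unfolding F1 j0 by simp
      qed
    qed
    then show False using nf by blast
  qed
  moreover have "C \<subseteq> q ` ?P" using qp p(1) by blast
  ultimately show ?thesis using j q0 by (intro exI[of _ j] exI[of _ q] conjI)
qed

theorem proposition3p1:
  fixes d :: nat and m :: "'k::field fps fps set"
  assumes "d > 0"
    and "maximalideal m (veronese_ring d)"
  shows "(d \<ge> 2 \<longrightarrow> MCM_test_ideal (veronese_ring d) = m) \<and>
    (\<forall>M :: ('k fps fps, 'm) module.
       MCM_module (veronese_ring d) M \<and> indecomposable_module (veronese_ring d) M \<and>
       \<not> free_module (veronese_ring d) M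
       \<longrightarrow> test_ideal (veronese_ring d) M = m)"
proof -
  have m: "m = {f \<in> graded_part d 0. f $ 0 $ 0 = 0}" by (rule maximalideal_veronese_ring[OF assms])
  have m_sub: "r \<in> test_ideal (veronese_ring d) M" if "MCM_module (veronese_ring d) M" "r \<in> m"
    for r and M :: "('k fps fps, 'n) module"
    using maximal_subset_test_ideal[OF assms(1) that(1)] that(2) m by blast
  show ?thesis
  proof (intro conjI impI allI)
    assume d: "d \<ge> 2"
    show "MCM_test_ideal (veronese_ring d) = m"
    proof (intro equalityI subsetI)
      fix r :: "'k fps fps" assume "r \<in> MCM_test_ideal (veronese_ring d)"
      then have r: "r \<in> test_ideal (veronese_ring d) (graded_module d 1)"
        unfolding MCM_test_ideal_def using MCM_graded_module_1[OF d] by blast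
      interpret N: veronese_module d "graded_module d 1 :: ('k fps fps, (nat \<Rightarrow> 'k fps fps) set) module"
        by (rule veronese_module.intro[OF assms(1) module_graded_module[OF assms(1)]])
      have "r \<in> graded_part d 0" "r $ 0 $ 0 = 0"
        by (rule N.test_ideal_proper[where i = 1 and q = enc]; use d r in simp)+
      then show "r \<in> m" using m by simp
    next
      fix r assume r: "r \<in> m"
      then have "r \<in> carrier (veronese_ring d)" using m carrier_veronese_ring[OF assms(1)] by blast
      then show "r \<in> MCM_test_ideal (veronese_ring d)"
        unfolding MCM_test_ideal_def using maximal_subset_test_ideal[OF assms(1)] r m by blast
    qed
  next
    fix M :: "('k fps fps, 'm) module"
    assume M: "MCM_module (veronese_ring d) M \<and> indecomposable_module (veronese_ring d) M \<and> \<not> free_module (veronese_ring d) M"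
    interpret veronese_module d M by (rule MCM_split_surjection(1)[OF assms(1)]) (use M in blast)
    obtain i q where iq: "1 \<le> i" "i < d" "\<forall>s\<in>graded_part d i. q s \<in> carrier M" "carrier M \<subseteq> q ` graded_part d i"
      "\<forall>s\<in>graded_part d i. \<forall>t\<in>graded_part d i. q (s + t) = q s \<oplus>\<^bsub>M\<^esub> q t"
      "\<forall>r\<in>graded_part d 0. \<forall>s\<in>graded_part d i. q (r * s) = r \<odot>\<^bsub>M\<^esub> q s"
    proof -
      have "MCM_module (veronese_ring d) M" "indecomposable_module (veronese_ring d) M" "\<not> free_module (veronese_ring d) M"
        using M by blast+
      from indecomposable_MCM_isomorphic[OF assms(1) this] show thesis by (elim exE conjE) (rule that)
    qed
    show "test_ideal (veronese_ring d) M = m"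
    proof (intro equalityI subsetI)
      fix r assume r: "r \<in> test_ideal (veronese_ring d) M"
      have "r \<in> graded_part d 0" "r $ 0 $ 0 = 0"
        using test_ideal_proper[OF iq(1,2) iq(3)[rule_format] iq(4) iq(5)[rule_format] iq(6)[rule_format] r]
        by blast+
      then show "r \<in> m" using m by simp
    next
      fix r assume "r \<in> m"
      then show "r \<in> test_ideal (veronese_ring d) M"
        using maximal_subset_test_ideal[OF assms(1)] M m by blast
    qed
  qed
qed

end
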